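(* Let $N'_r$ denote the number of vertices of the Crofton cell of the stationary isotropic Poisson line process in the plane, conditioned on the largest disk centered at the origin contained in the cell having radius $r$. Let $a'_1=2^{4/3}\pi\cdot 3^{-1/3}\,\Gamma(5/3)$. Then, as $r\to+\infty$: (i) $\mathbf{E}N'_r\sim a'_1 r^{1/3}$; (ii) $\lim_{r\to+\infty}N'_r\,(a'_1r^{1/3})^{-1}=1$ in $L^1$.
   Context: $\Phi'$ is a Poisson point process in $\mathbb{R}^2$ of intensity measure, in polar coordinates, $\mathbf{1}_{\mathbb{R}_+}(\rho)\,d\rho\,d\theta$. For $x\ne0$ let $L(x)=\{y\in\mathbb{R}^2:\langle y-x,x\rangle=0\}$ and let $H(x)$ be the closed half-plane bounded by $L(x)$ containing the origin. The line process is $\{L(x):x\in\Phi'\}$ and its Crofton cell is $\mathcal{P}_0=\bigcap_{x\in\Phi'}H(x)$. $R'_m$ is the radius of the largest disk centered at the origin contained in $\mathcal{P}_0$; $\mathcal{P}_r$ is a random polygon distributed as $\mathcal{P}_0$ conditioned on $\{R'_m=r\}$, and $N'_r$ is the number of vertices of $\mathcal{P}_r$. Explicitly, up to a uniform random rotation about the origin, $\mathcal{P}_r$ is distributed as $\bigcap_{x\in\Phi'_r}H(x)\cap H((r;0))$, where $\Phi'_r$ is a Poisson point process of intensity measure (in polar coordinates) $\mathbf{1}_{(r,+\infty)}(\rho)\,d\rho\,d\theta$. Notation: $\alpha_r\sim\beta_r$ means $\lim_{r\to\infty}\alpha_r/\beta_r=1$. *)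

theory Defs
  imports "HOL-Probability.Probability"
begin

text \<open>
  The plane is \<^typ>\<open>complex\<close> with its Euclidean structure; \<^term>\<open>rcis \<rho> \<theta>\<close> is the point with
  polar coordinates \<open>(\<rho>, \<theta>)\<close>.
\<close>

section \<open>Poisson point processes\<close>

definition locally_finite_sets :: "'a::metric_space set set" where
  "locally_finite_sets = {S. \<forall>B. bounded B \<longrightarrow> finite (S \<inter> B)}"

text \<open>The \<open>\<sigma>\<close>-algebra generated by the counting maps \<open>S \<mapsto> card (S \<inter> B)\<close>; only its measurable
  structure is used.\<close>

definition configurations :: "'a::metric_space set measure" where
  "configurations = sigma locally_finite_sets
     {{S \<in> locally_finite_sets. card (S \<inter> B) = k} | B k. B \<in> sets borel \<and> bounded B}"

text \<open>
  Points carry no multiplicities, so this notion is meant for diffuse \<open>\<mu>\<close>. The Poisson law is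
  written out because a bounded set may have \<open>\<mu>\<close>-measure 0, where it has to mean that
  the count is almost surely 0. Restricting to bounded Borel sets keeps all counts finite and
  determines the law of \<open>\<Phi>\<close>.
\<close>

definition poisson_point_process ::
    "'w measure \<Rightarrow> 'a::metric_space measure \<Rightarrow> ('w \<Rightarrow> 'a set) \<Rightarrow> bool" where
  "poisson_point_process M \<mu> \<Phi> \<longleftrightarrow>
     prob_space M \<and>
     \<Phi> \<in> M \<rightarrow>\<^sub>M configurations \<and>
     sets \<mu> = sets borel \<and>
     (\<forall>B \<in> sets borel. bounded B \<longrightarrow> emeasure \<mu> B < \<infinity>) \<and>
     (\<forall>B \<in> sets borel. bounded B \<longrightarrow>
        (\<forall>k. measure M {\<omega> \<in> space M. card (\<Phi> \<omega> \<inter> B) = k}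
              = exp (- measure \<mu> B) * measure \<mu> B ^ k / fact k)) \<and>
     (\<forall>(I :: nat set) B.
        finite I \<and> (\<forall>i\<in>I. B i \<in> sets borel \<and> bounded (B i)) \<and> disjoint_family_on B I \<longrightarrow>
        prob_space.indep_vars M (\<lambda>_. count_space UNIV) (\<lambda>i \<omega>. card (\<Phi> \<omega> \<inter> B i)) I)"

section \<open>The Crofton cell and its conditioned version\<close>

text \<open>The measure with density \<open>1\<^bsub>(r, \<infinity>)\<^esub>(\<rho>) d\<rho> d\<theta>\<close> in polar coordinates.\<close>

definition polar_intensity :: "real \<Rightarrow> complex measure" where
  "polar_intensity r =
     distr (density lborel (indicator ({r<..} \<times> {0..<2 * pi}))) borel (\<lambda>(\<rho>, \<theta>). rcis \<rho> \<theta>)"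

text \<open>For \<open>x \<noteq> 0\<close>, the closed half-plane containing the origin that is bounded by the line
  through \<open>x\<close> orthogonal to \<open>x\<close>.\<close>

definition half_plane :: "complex \<Rightarrow> complex set" where
  "half_plane x = {y. inner (y - x) x \<le> 0}"

definition crofton_cell :: "complex set \<Rightarrow> complex set" where
  "crofton_cell S = (\<Inter>x\<in>S. half_plane x)"

text \<open>
  The Crofton cell of the stationary isotropic Poisson line process is \<^term>\<open>crofton_cell S\<close> for
  \<open>S\<close> a Poisson point process with density \<open>1\<^bsub>[0, \<infinity>)\<^esub>(\<rho>) d\<rho> d\<theta>\<close>. Conditioning it on its
  largest centred disk having radius \<open>r\<close> means conditioning on a null event; the version of the
  conditional law used here is the explicit one. It has one line at distance exactly \<open>r\<close> from the
  origin, in a uniformly distributed direction, and independently of that direction a Poisson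
  process of lines at distance greater than \<open>r\<close>. The next predicate describes this random input:
  \<open>\<Theta>\<close> is the direction and \<open>\<Phi>\<close> the process seen from it; they are independent, stated as their
  joint law being the product law (the library's \<open>indep_var\<close> needs both variables to have the
  same type).
\<close>

definition conditioned_line_process ::
    "'w measure \<Rightarrow> real \<Rightarrow> ('w \<Rightarrow> complex set) \<Rightarrow> ('w \<Rightarrow> real) \<Rightarrow> bool" where
  "conditioned_line_process M r \<Phi> \<Theta> \<longleftrightarrow>
     poisson_point_process M (polar_intensity r) \<Phi> \<and>
     \<Theta> \<in> borel_measurable M \<and>
     distr M borel \<Theta> = uniform_measure lborel {0..<2 * pi} \<and>
     distr M (configurations \<Otimes>\<^sub>M borel) (\<lambda>\<omega>. (\<Phi> \<omega>, \<Theta> \<omega>))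
       = distr M configurations \<Phi> \<Otimes>\<^sub>M distr M borel \<Theta>"

definition conditioned_cell :: "real \<Rightarrow> complex set \<Rightarrow> real \<Rightarrow> complex set" where
  "conditioned_cell r S \<theta> = (\<lambda>z. cis \<theta> * z) ` (crofton_cell S \<inter> half_plane (rcis r 0))"

text \<open>Conditioned cells are almost surely bounded polygons, hence have finitely many extreme
  points; the value 0 of \<^const>\<open>card\<close> on infinite sets plays no role.\<close>

definition num_vertices :: "complex set \<Rightarrow> nat" where
  "num_vertices P = card {v. v extreme_point_of P}"

definition a1' :: real where
  "a1' = 2 powr (4/3) * pi * 3 powr (-1/3) * Gamma (5/3)"

end

theory Submission
  imports Defs "HOL-Real_Asymp.Real_Asymp"
begin

text \<open>
  A vertex of the cell is a point \<open>v\<close> where two lines meet and which no other line separates from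
  the origin. The lines separating \<open>v\<close> from the origin are those with foot in the disk with diameter
  \<open>[0, v]\<close>, so the Mecke formula turns the expected number of vertices in a region into an explicit
  integral over the position of \<open>v\<close>. With \<open>R = \<bar>v\<bar>\<close> and \<open>tan (arccos (r / R)) = r powr (-1/3) * y\<close>, its
  density converges as \<open>r\<close> tends to infinity, and the limit integrates to \<open>a1'\<close>.

  For the convergence in \<open>L\<^sup>1\<close> only the vertices with \<open>y \<le> T\<close> in about \<open>r powr (1/3) / T\<^sup>2\<close> angular blocks
  separated by small gaps are kept. Their numbers depend on disjoint parts of the process, hence are
  independent, and have bounded second moments; so the variance of their sum is of order
  \<open>r powr (1/3)\<close>. All other vertices, including the at most two on the line at distance \<open>r\<close>, are
  negligible in expectation when first \<open>r\<close> and then \<open>T\<close> tends to infinity.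
\<close>

section \<open>Measurability of point configurations\<close>

text \<open>General position is obtained by a squeeze. Pairs of lines whose crossing point is not
  cut off overcount the vertices when three lines are concurrent; pairs with no third foot in the
  closed disk undercount them. The two bounds differ by a circle, which the intensity does not
  charge, so both equal the expectation. Truncation at y <= T makes vertices local: the lines that
  can affect one have feet within an angle \<eta> = T r^(-1/3) of it and in a shell of thickness of
  order T^2 r^(1/3). With about r^(1/3) / T^2 regions, the mean number of points in each region is
  bounded in terms of T alone, which gives the bounded moments, while the gaps take up a share of
  the turn of order at most 1/T. The line at distance r is deterministic once the rotation is
  removed, so it is handled by inclusions of vertex sets rather than by the Mecke formula. The limit
  density is 4/3 y^4 exp(-2/3 y^3); in the variable w = 2/3 y^3 its integral becomes a multiple of
  Gamma(5/3).\<close>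

lemma space_configurations [simp]: "space configurations = locally_finite_sets"
  unfolding configurations_def by (rule space_measure_of) auto

lemma sets_configurations:
  "sets (configurations :: 'a::metric_space set measure) = sigma_sets locally_finite_sets
     {{S \<in> locally_finite_sets. card (S \<inter> B) = k} | (B :: 'a set) k. B \<in> sets borel \<and> bounded B}"
  unfolding configurations_def by (rule sets_measure_of) auto

lemma locally_finite_setsD:
  "S \<in> locally_finite_sets \<Longrightarrow> bounded B \<Longrightarrow> finite (S \<inter> B)"
  by (simp add: locally_finite_sets_def)

lemma locally_finite_sets_subset:
  "S \<in> locally_finite_sets \<Longrightarrow> T \<subseteq> S \<Longrightarrow> T \<in> locally_finite_sets"
  unfolding locally_finite_sets_def by (blast intro: finite_subset[OF Int_mono])

lemma locally_finite_sets_insert: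
  "S \<in> locally_finite_sets \<Longrightarrow> insert x S \<in> locally_finite_sets"
  by (simp add: locally_finite_sets_def Int_insert_left)

lemma measurable_card_configurations:
  assumes "B \<in> sets borel" "bounded B"
  shows "(\<lambda>S. card (S \<inter> B)) \<in> configurations \<rightarrow>\<^sub>M count_space UNIV"
proof (rule measurable_count_space_eq2_countable[THEN iffD2]; (intro conjI ballI)?)
  fix k :: nat
  have "(\<lambda>S. card (S \<inter> B)) -` {k} \<inter> space configurations
    = {S \<in> locally_finite_sets. card (S \<inter> B) = k}" by auto
  also have "\<dots> \<in> sets configurations"
    unfolding sets_configurations using assms by (intro sigma_sets.Basic) auto
  finally show "(\<lambda>S. card (S \<inter> B)) -` {k} \<inter> space configurations \<in> sets configurations" .
qed simp_all

text \<open>The count of a finite set is the limit of the numbers of cells of finer and finer grids that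
  it hits.\<close>

definition grid :: "nat \<Rightarrow> complex \<Rightarrow> int \<times> int" where
  "grid n z = (\<lfloor>real n * Re z\<rfloor>, \<lfloor>real n * Im z\<rfloor>)"

lemma finite_grid_image:
  assumes "bounded B" shows "finite (grid n ` B)"
proof -
  obtain R where R: "\<And>z. z \<in> B \<Longrightarrow> cmod z \<le> R"
    using assms by (auto simp: bounded_iff)
  define K where "K = \<lceil>real n * R\<rceil>"
  have "grid n ` B \<subseteq> {-K-1..K} \<times> {-K-1..K}"
  proof (rule image_subsetI)
    fix z assume "z \<in> B"
    then have z: "\<bar>Re z\<bar> \<le> R" "\<bar>Im z\<bar> \<le> R"
      using R abs_Re_le_cmod abs_Im_le_cmod order_trans by blast+
    have aux: "\<lfloor>real n * t\<rfloor> \<in> {-K-1..K}" if "\<bar>t\<bar> \<le> R" for t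
    proof -
      have "real n * t \<le> real n * R" "real n * (-R) \<le> real n * t"
        using that by (intro mult_left_mono; simp add: abs_le_iff)+
      then show ?thesis unfolding K_def by auto linarith+
    qed
    show "grid n z \<in> {-K-1..K} \<times> {-K-1..K}" unfolding grid_def using aux z by blast
  qed
  then show ?thesis by (rule finite_subset) simp
qed

lemma measurable_grid_vimage: "grid n -` {c} \<in> sets borel"
proof -
  have "{z. \<lfloor>real n * Re z\<rfloor> = a \<and> \<lfloor>real n * Im z\<rfloor> = b} \<in> sets borel" for a b
    by measurable
  then show ?thesis by (cases c) (simp add: grid_def vimage_def)
qed

text \<open>Once the mesh 1/n is smaller than the difference of some coordinate, the scaled
  coordinates differ by more than 1 and so have different floors.\<close>

lemma eventually_grid_neq:
  assumes "z \<noteq> w" shows "\<forall>\<^sub>F n in sequentially. grid n z \<noteq> grid n w"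
proof -
  have aux: "\<forall>\<^sub>F n in sequentially. \<lfloor>real n * s\<rfloor> \<noteq> \<lfloor>real n * t\<rfloor>" if "s < t" for s t
  proof -
    have "\<forall>\<^sub>F n in sequentially. real n > 1 / (t - s)"
      using filterlim_real_sequentially unfolding filterlim_at_top_dense by blast
    then show ?thesis
    proof eventually_elim
      case (elim n)
      then have "real n * s + 1 < real n * t" using that by (simp add: field_simps)
      then show ?case by linarith
    qed
  qed
  have neq: "\<forall>\<^sub>F n in sequentially. \<lfloor>real n * s\<rfloor> \<noteq> \<lfloor>real n * t\<rfloor>" if "s \<noteq> t" for s t :: real
    using aux[of s t] aux[of t s] that by (cases "s < t") (auto elim: eventually_mono)
  show ?thesis
  proof (cases "Re z = Re w")
    case True
    then show ?thesis using neq[of "Im z" "Im w"] assms by (simp add: grid_def complex_eq_iff)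
  next
    case False
    from neq[OF this] show ?thesis by eventually_elim (simp add: grid_def)
  qed
qed

lemma eventually_card_grid_image:
  assumes "finite F" shows "\<forall>\<^sub>F n in sequentially. card (grid n ` F) = card F"
proof -
  have "\<forall>\<^sub>F n in sequentially. \<forall>z\<in>F. \<forall>w\<in>F. z \<noteq> w \<longrightarrow> grid n z \<noteq> grid n w"
    using assms eventually_grid_neq
    by (intro eventually_ball_finite ballI assms) (auto simp: eventually_mono)
  then show ?thesis
    by eventually_elim (intro card_image, auto simp: inj_on_def)
qed

text \<open>Void events suffice: the number of grid cells hit inside \<open>B\<close> is a finite
  sum of indicators of cells that are not void, and it equals the count for all large
  \<open>n\<close>. Every later random set (an added point, a restriction, the vertices) is shown
  measurable through this criterion.\<close>

lemma measurable_configurationsI: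
  fixes \<Psi> :: "'q \<Rightarrow> complex set"
  assumes lf: "\<And>q. q \<in> space Q \<Longrightarrow> \<Psi> q \<in> locally_finite_sets"
    and void: "\<And>B. B \<in> sets borel \<Longrightarrow> bounded B \<Longrightarrow> {q \<in> space Q. \<Psi> q \<inter> B = {}} \<in> sets Q"
  shows "\<Psi> \<in> Q \<rightarrow>\<^sub>M configurations"
  unfolding configurations_def
proof (rule measurable_measure_of)
  fix A assume "A \<in> {{S \<in> locally_finite_sets. card (S \<inter> B) = k} | (B::complex set) k. B \<in> sets borel \<and> bounded B}"
  then obtain B k where A: "A = {S \<in> locally_finite_sets. card (S \<inter> B) = k}"
    and B: "B \<in> sets borel" "bounded B" by blast
  \<comment> \<open>A cell contributes 1 exactly if \<open>X\<close> meets its part inside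
    \<open>B\<close>, and only finitely many cells meet the bounded set \<open>B\<close>.\<close>
  have card_eq: "real (card (grid n ` (X \<inter> B))) =
      (\<Sum>c\<in>grid n ` B. indicat_real (- {X. X \<inter> (B \<inter> grid n -` {c}) = {}}) X)" for n X
  proof -
    have "(\<Sum>c\<in>grid n ` B. indicat_real (- {X. X \<inter> (B \<inter> grid n -` {c}) = {}}) X)
      = (\<Sum>c\<in>grid n ` (X \<inter> B). 1)"
      using finite_grid_image[OF B(2), of n]
      by (intro sum.mono_neutral_cong_right ballI)
         (auto simp: indicator_def simp del: split_paired_All dest: sym intro: rev_image_eqI)
    then show ?thesis by simp
  qed
  have "(\<lambda>q. real (card (grid n ` (\<Psi> q \<inter> B)))) \<in> borel_measurable Q" for n
    unfolding card_eq
  proof (intro borel_measurable_sum)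
    fix c
    have "{q \<in> space Q. \<Psi> q \<inter> (B \<inter> grid n -` {c}) = {}} \<in> sets Q"
      using B measurable_grid_vimage[of n c]
      by (intro void sets.Int) (auto intro: bounded_subset)
    then have "(indicat_real (space Q - {q \<in> space Q. \<Psi> q \<inter> (B \<inter> grid n -` {c}) = {}})) \<in> borel_measurable Q"
      by measurable
    then show "(\<lambda>q. indicat_real (- {X. X \<inter> (B \<inter> grid n -` {c}) = {}}) (\<Psi> q)) \<in> borel_measurable Q"
      by (rule measurable_cong[THEN iffD1, rotated]) (auto simp: indicator_def)
  qed
  then have "(\<lambda>q. real (card (\<Psi> q \<inter> B))) \<in> borel_measurable Q"
  proof (rule borel_measurable_LIMSEQ_real[rotated])
    fix q assume "q \<in> space Q"
    then have "\<forall>\<^sub>F n in sequentially. card (grid n ` (\<Psi> q \<inter> B)) = card (\<Psi> q \<inter> B)"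
      using lf B by (intro eventually_card_grid_image) (auto intro: locally_finite_setsD)
    then show "(\<lambda>n. real (card (grid n ` (\<Psi> q \<inter> B)))) \<longlonglongrightarrow> real (card (\<Psi> q \<inter> B))"
      by (intro tendsto_eventually) (auto elim: eventually_mono)
  qed
  then have "{q \<in> space Q. real (card (\<Psi> q \<inter> B)) = real k} \<in> sets Q" by measurable
  also have "{q \<in> space Q. real (card (\<Psi> q \<inter> B)) = real k} = \<Psi> -` A \<inter> space Q"
    using lf by (auto simp: A)
  finally show "\<Psi> -` A \<inter> space Q \<in> sets Q" .
qed (use lf in auto)

section \<open>Sums and quantifiers over the points of a random set\<close>

lemma measurable_nn_integral_count_space_bounded:
  fixes \<Psi> :: "'q \<Rightarrow> 'a::metric_space set"
  assumes \<Psi>: "\<Psi> \<in> Q \<rightarrow>\<^sub>M configurations" and g: "g \<in> borel_measurable (Q \<Otimes>\<^sub>M borel)"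
    and B: "B \<in> sets borel" "bounded B"
  shows "(\<lambda>q. \<integral>\<^sup>+z. g (q, z) \<partial>count_space (\<Psi> q \<inter> B)) \<in> borel_measurable Q"
proof -
  have lf: "\<Psi> q \<in> locally_finite_sets" if "q \<in> space Q" for q
    using measurable_space[OF \<Psi> that] by simp
  have fin: "finite (\<Psi> q \<inter> C)" if "q \<in> space Q" "bounded C" for q C
    using lf that by (auto intro: locally_finite_setsD)
  have card_meas: "(\<lambda>q. ennreal (card (\<Psi> q \<inter> C))) \<in> borel_measurable Q"
    if "C \<in> sets borel" "bounded C" for C
    using measurable_compose[OF measurable_compose[OF \<Psi> measurable_card_configurations[OF that]],
        of "\<lambda>k. ennreal (real k)" borel] by simp
  show ?thesis using g
  proof induction
    case (cong f h)
    have "(\<lambda>q. \<integral>\<^sup>+z. f (q, z) \<partial>count_space (\<Psi> q \<inter> B)) \<in> borel_measurable Q \<longleftrightarrow>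
       (\<lambda>q. \<integral>\<^sup>+z. h (q, z) \<partial>count_space (\<Psi> q \<inter> B)) \<in> borel_measurable Q"
      using cong by (intro measurable_cong nn_integral_cong) (auto simp: space_pair_measure)
    then show ?case using cong by simp
  next
    case (set E)
    then have "E \<in> sigma_sets (space Q \<times> space borel) {a \<times> b |a b. a \<in> sets Q \<and> b \<in> sets (borel :: 'a measure)}"
      by (simp add: sets_pair_measure)
    with Int_stable_pair_measure_generator pair_measure_closed show ?case
    proof (induction rule: sigma_sets_induct_disjoint)
      case (basic E)
      then obtain a b where E: "E = a \<times> b" "a \<in> sets Q" "b \<in> sets borel" by auto
      have *: "(\<integral>\<^sup>+z. indicator E (q, z) \<partial>count_space (\<Psi> q \<inter> B))
          = indicator a q * ennreal (card (\<Psi> q \<inter> (B \<inter> b)))" if "q \<in> space Q" for q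
      proof -
        have "(\<integral>\<^sup>+z. indicator E (q, z) \<partial>count_space (\<Psi> q \<inter> B))
          = (\<integral>\<^sup>+z. indicator a q * indicator b z \<partial>count_space (\<Psi> q \<inter> B))"
          by (simp add: E indicator_times)
        also have "\<dots> = indicator a q * (\<integral>\<^sup>+z. indicator (\<Psi> q \<inter> B \<inter> b) z \<partial>count_space (\<Psi> q \<inter> B))"
          by (subst nn_integral_cmult) (auto intro!: nn_integral_cong arg_cong2[where f="(*)"] simp: indicator_def)
        also have "(\<integral>\<^sup>+z. indicator (\<Psi> q \<inter> B \<inter> b) z \<partial>count_space (\<Psi> q \<inter> B))
            = emeasure (count_space (\<Psi> q \<inter> B)) (\<Psi> q \<inter> B \<inter> b)"
          by (rule nn_integral_indicator) auto
        also have "\<dots> = of_nat (card (\<Psi> q \<inter> (B \<inter> b)))"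
          using finite_Int[OF disjI1[OF fin[OF that B(2)]], of b]
          by (subst emeasure_count_space) (auto simp: Int_assoc)
        also have "\<dots> = ennreal (card (\<Psi> q \<inter> (B \<inter> b)))"
          by (rule ennreal_of_nat_eq_real_of_nat)
        finally show ?thesis .
      qed
      have "(\<lambda>q. indicator a q * ennreal (card (\<Psi> q \<inter> (B \<inter> b)))) \<in> borel_measurable Q"
        using card_meas[of "B \<inter> b"] E B bounded_subset[OF B(2), of "B \<inter> b"] by auto
      then show ?case using * by (simp cong: measurable_cong)
    next
      case empty
      show ?case by simp
    next
      case (compl E)
      have *: "(\<integral>\<^sup>+z. indicator (space Q \<times> space borel - E) (q, z) \<partial>count_space (\<Psi> q \<inter> B))
          = ennreal (card (\<Psi> q \<inter> B)) - (\<integral>\<^sup>+z. indicator E (q, z) \<partial>count_space (\<Psi> q \<inter> B))"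
        if "q \<in> space Q" for q
      proof -
        have "(\<integral>\<^sup>+z. indicator (space Q \<times> space borel - E) (q, z) \<partial>count_space (\<Psi> q \<inter> B))
           = (\<integral>\<^sup>+z. 1 - indicator E (q, z) \<partial>count_space (\<Psi> q \<inter> B))"
          using that by (intro nn_integral_cong) (auto simp: indicator_def)
        also have "\<dots> = (\<integral>\<^sup>+z. 1 \<partial>count_space (\<Psi> q \<inter> B)) - (\<integral>\<^sup>+z. indicator E (q, z) \<partial>count_space (\<Psi> q \<inter> B))"
          using fin[OF that B(2)]
          by (intro nn_integral_diff)
             (auto simp: nn_integral_count_space_finite AE_count_space indicator_def)
        also have "(\<integral>\<^sup>+z. 1 \<partial>count_space (\<Psi> q \<inter> B)) = ennreal (card (\<Psi> q \<inter> B))"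
          using fin[OF that B(2)] by (simp add: nn_integral_count_space_finite ennreal_of_nat_eq_real_of_nat)
        finally show ?thesis .
      qed
      show ?case using * compl card_meas[OF B] by (simp cong: measurable_cong)
    next
      case (union F)
      have *: "(\<integral>\<^sup>+z. indicator (\<Union>i. F i) (q, z) \<partial>count_space (\<Psi> q \<inter> B))
          = (\<Sum>i. \<integral>\<^sup>+z. indicator (F i) (q, z) \<partial>count_space (\<Psi> q \<inter> B))" for q
        using union by (subst nn_integral_suminf[symmetric]) (auto intro!: nn_integral_cong simp: suminf_indicator)
      show ?case unfolding * using union by measurable
    qed
  next
    case (mult u c)
    then show ?case by (simp add: nn_integral_cmult)
  next
    case (add u v)
    then show ?case by (simp add: nn_integral_add)
  next
    case (seq U)
    have "(\<integral>\<^sup>+z. (SUP i. U i) (q, z) \<partial>count_space (\<Psi> q \<inter> B))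
        = (SUP i. \<integral>\<^sup>+z. U i (q, z) \<partial>count_space (\<Psi> q \<inter> B))" for q
      unfolding SUP_apply using seq
      by (intro nn_integral_monotone_convergence_SUP) (auto simp: incseq_def le_fun_def)
    then show ?case using seq by simp
  qed
qed

text \<open>Statements about sums are first obtained on bounded sets, where counts are finite and
  can be subtracted; monotone convergence over growing balls then removes the bound.\<close>

lemma nn_integral_count_space_Int_ball:
  fixes S :: "'a::real_normed_vector set"
  shows "(\<integral>\<^sup>+z. f z \<partial>count_space S) = (SUP n. \<integral>\<^sup>+z. f z \<partial>count_space (S \<inter> cball 0 (real n)))"
proof -
  have "(\<integral>\<^sup>+z. f z \<partial>count_space S) = (\<integral>\<^sup>+z. (SUP n. f z * indicator (S \<inter> cball 0 (real n)) z) \<partial>count_space UNIV)"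
    unfolding nn_integral_count_space_indicator[of S f, simplified]
  proof (intro nn_integral_cong antisym SUP_least)
    fix z :: 'a
    obtain n where "norm z \<le> real n" using real_arch_simple by blast
    then have "f z * indicator S z \<le> f z * indicator (S \<inter> cball 0 (real n)) z"
      by (auto simp: indicator_def)
    then show "f z * indicator S z \<le> (SUP n. f z * indicator (S \<inter> cball 0 (real n)) z)"
      by (rule SUP_upper2[rotated]) simp
  qed (auto simp: indicator_def)
  also have "\<dots> = (SUP n. \<integral>\<^sup>+z. f z * indicator (S \<inter> cball 0 (real n)) z \<partial>count_space UNIV)"
    by (intro nn_integral_monotone_convergence_SUP) (auto simp: incseq_def le_fun_def indicator_def)
  finally show ?thesis by (simp add: nn_integral_count_space_indicator)
qed

lemma measurable_nn_integral_count_space: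
  fixes \<Psi> :: "'q \<Rightarrow> complex set"
  assumes "\<Psi> \<in> Q \<rightarrow>\<^sub>M configurations" "g \<in> borel_measurable (Q \<Otimes>\<^sub>M borel)"
  shows "(\<lambda>q. \<integral>\<^sup>+z. g (q, z) \<partial>count_space (\<Psi> q)) \<in> borel_measurable Q"
  by (subst nn_integral_count_space_Int_ball)
     (intro borel_measurable_SUP measurable_nn_integral_count_space_bounded assms; auto)

text \<open>A point with the property exists iff the number of such points is nonzero. This
  eliminates one quantifier over random points; since \<open>Q\<close> is arbitrary, nested
  quantifiers can be removed one after another.\<close>

lemma measurable_count_space_pred:
  fixes \<Psi> :: "'q \<Rightarrow> complex set"
  assumes \<Psi>: "\<Psi> \<in> Q \<rightarrow>\<^sub>M configurations" and P: "Measurable.pred (Q \<Otimes>\<^sub>M borel) P"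
  shows "Measurable.pred Q (\<lambda>q. \<exists>z\<in>\<Psi> q. P (q, z))"
proof -
  have "(\<integral>\<^sup>+z. (if P (q, z) then 1 else 0) \<partial>count_space (\<Psi> q)) = 0 \<longleftrightarrow> \<not> (\<exists>z\<in>\<Psi> q. P (q, z))" for q
    by (subst nn_integral_0_iff_AE) (auto simp: AE_count_space)
  moreover have "Measurable.pred Q (\<lambda>q. \<not> (\<integral>\<^sup>+z. (if P (q, z) then 1 else 0) \<partial>count_space (\<Psi> q)) = 0)"
    using measurable_nn_integral_count_space[OF \<Psi>, of "\<lambda>p. if P p then 1 else 0"] P by measurable
  ultimately show ?thesis by simp
qed

lemma measurable_insert_configurations [measurable]:
  fixes f :: "'q \<Rightarrow> complex"
  assumes [measurable]: "f \<in> borel_measurable Q" and \<Psi>: "\<Psi> \<in> Q \<rightarrow>\<^sub>M configurations"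
  shows "(\<lambda>q. insert (f q) (\<Psi> q)) \<in> Q \<rightarrow>\<^sub>M configurations"
proof (rule measurable_configurationsI)
  show "insert (f q) (\<Psi> q) \<in> locally_finite_sets" if "q \<in> space Q" for q
    using measurable_space[OF \<Psi> that] by (auto intro: locally_finite_sets_insert)
  fix B :: "complex set" assume [measurable]: "B \<in> sets borel"
  have [measurable]: "Measurable.pred Q (\<lambda>q. \<exists>z\<in>\<Psi> q. (\<lambda>(q, z). z \<in> B) (q, z))"
    by (rule measurable_count_space_pred[OF \<Psi>]) measurable
  have "{q \<in> space Q. insert (f q) (\<Psi> q) \<inter> B = {}}
    = {q \<in> space Q. f q \<notin> B \<and> \<not> (\<exists>z\<in>\<Psi> q. (\<lambda>(q, z). z \<in> B) (q, z))}" by auto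
  also have "\<dots> \<in> sets Q" by measurable
  finally show "{q \<in> space Q. insert (f q) (\<Psi> q) \<inter> B = {}} \<in> sets Q" .
qed

lemma measurable_Int_configurations:
  fixes A :: "complex set"
  assumes \<Psi>: "\<Psi> \<in> Q \<rightarrow>\<^sub>M configurations" and A[measurable]: "A \<in> sets borel"
  shows "(\<lambda>q. \<Psi> q \<inter> A) \<in> Q \<rightarrow>\<^sub>M configurations"
proof (rule measurable_configurationsI)
  show "\<Psi> q \<inter> A \<in> locally_finite_sets" if "q \<in> space Q" for q
    using measurable_space[OF \<Psi> that] by (auto intro: locally_finite_sets_subset)
  fix B :: "complex set" assume [measurable]: "B \<in> sets borel"
  have [measurable]: "Measurable.pred Q (\<lambda>q. \<exists>z\<in>\<Psi> q. (\<lambda>(q, z). z \<in> A \<and> z \<in> B) (q, z))"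
    by (rule measurable_count_space_pred[OF \<Psi>]) measurable
  have "{q \<in> space Q. \<Psi> q \<inter> A \<inter> B = {}}
    = {q \<in> space Q. \<not> (\<exists>z\<in>\<Psi> q. (\<lambda>(q, z). z \<in> A \<and> z \<in> B) (q, z))}" by auto
  also have "\<dots> \<in> sets Q" by measurable
  finally show "{q \<in> space Q. \<Psi> q \<inter> A \<inter> B = {}} \<in> sets Q" .
qed

section \<open>Void events as a generating pi-system\<close>

definition void_events :: "complex set set set" where
  "void_events = {{S \<in> locally_finite_sets. S \<inter> C = {}} | C. C \<in> sets borel \<and> bounded C}"

text \<open>Avoiding \<open>C\<close> and avoiding \<open>D\<close> is avoiding
  \<open>C \<union> D\<close>. The count events that define \<open>configurations\<close> lack this
  stability, which the pi-lambda arguments below rest on.\<close>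

lemma Int_stable_void_events: "Int_stable void_events"
  unfolding Int_stable_def void_events_def
proof safe
  fix C D :: "complex set" assume "C \<in> sets borel" "D \<in> sets borel" "bounded C" "bounded D"
  then show "\<exists>E. {S \<in> locally_finite_sets. S \<inter> C = {}} \<inter> {S \<in> locally_finite_sets. S \<inter> D = {}}
      = {S \<in> locally_finite_sets. S \<inter> E = {}} \<and> E \<in> sets borel \<and> bounded E"
    by (intro exI[of _ "C \<union> D"]) auto
qed

lemma void_events_subset: "void_events \<subseteq> Pow locally_finite_sets"
  by (auto simp: void_events_def)

text \<open>By \<open>measurable_configurationsI\<close> the identity is measurable from the
  void-event \<sigma>-algebra to \<open>configurations\<close>, which is the inclusion that is not
  immediate. Conversely, on a bounded set being void means having count 0.\<close>

lemma sets_configurations_void: "sets configurations = sigma_sets locally_finite_sets void_events"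
proof
  define Q where "Q = sigma locally_finite_sets void_events"
  have Q: "space Q = locally_finite_sets" "sets Q = sigma_sets locally_finite_sets void_events"
    unfolding Q_def using void_events_subset by (auto simp: space_measure_of_conv)
  have "(\<lambda>S. S) \<in> Q \<rightarrow>\<^sub>M configurations"
  proof (rule measurable_configurationsI)
    fix B :: "complex set" assume "B \<in> sets borel" "bounded B"
    then have "{S \<in> locally_finite_sets. S \<inter> B = {}} \<in> void_events" by (auto simp: void_events_def)
    then show "{S \<in> space Q. S \<inter> B = {}} \<in> sets Q" by (simp add: Q)
  qed (simp add: Q)
  then have id: "(\<lambda>S. S) \<in> Q \<rightarrow>\<^sub>M configurations" .
  show "sets configurations \<subseteq> sigma_sets locally_finite_sets void_events"
  proof
    fix X :: "complex set set" assume X: "X \<in> sets configurations"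
    then have "X \<subseteq> locally_finite_sets" using sets.sets_into_space by fastforce
    then show "X \<in> sigma_sets locally_finite_sets void_events"
      using measurable_sets[OF id X] by (simp add: Q Int_absorb2)
  qed
  show "sigma_sets locally_finite_sets void_events \<subseteq> sets configurations"
  proof (rule sets.sigma_sets_subset[of _ configurations, simplified], rule subsetI)
    fix X assume "X \<in> void_events"
    then obtain C where C: "X = {S \<in> locally_finite_sets. S \<inter> C = {}}" "C \<in> sets borel" "bounded C"
      by (auto simp: void_events_def)
    have "X = {S \<in> locally_finite_sets. card (S \<inter> C) = 0}"
      using C(1,3) by (auto simp: locally_finite_setsD card_eq_0_iff)
    then show "X \<in> sets configurations"
      unfolding sets_configurations using C by (auto intro!: sigma_sets.Basic)
  qed
qed

section \<open>The Mecke formula\<close>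

text \<open>The whole space is itself a void event (take \<open>C = {}\<close>), so the strips over
  a Borel set belong to the generated \<sigma>-algebra and complements within a strip can be
  formed.\<close>

lemma sets_pair_borel_configurations:
  "sets (borel \<Otimes>\<^sub>M (configurations :: complex set measure)) = sigma_sets (UNIV \<times> locally_finite_sets)
     {b \<times> v | b v. b \<in> sets (borel :: 'b::topological_space measure) \<and> v \<in> void_events}" (is "_ = sigma_sets ?\<Omega> ?G")
proof
  interpret sa: sigma_algebra ?\<Omega> "sigma_sets ?\<Omega> ?G"
    using void_events_subset by (intro sigma_algebra_sigma_sets) auto
  have lf: "locally_finite_sets \<in> void_events"
    unfolding void_events_def by (intro CollectI exI[of _ "{}"]) auto
  have "a \<times> b \<in> sigma_sets ?\<Omega> ?G" if a: "a \<in> sets borel" and b: "b \<in> sets configurations"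
    for a :: "'b set" and b :: "complex set set"
    using b unfolding sets_configurations_void
  proof (induction rule: sigma_sets.induct)
    case (Basic v)
    then show ?case using a by (auto intro!: sigma_sets.Basic)
  next
    case Empty
    show ?case by (simp add: sigma_sets.Empty)
  next
    case (Compl v)
    have "a \<times> (locally_finite_sets - v) = a \<times> locally_finite_sets - a \<times> v" by auto
    moreover have "a \<times> locally_finite_sets \<in> sigma_sets ?\<Omega> ?G"
      using a lf by (auto intro!: sigma_sets.Basic)
    ultimately show ?case
      using sa.Diff Compl.IH by simp
  next
    case (Union v)
    have "a \<times> (\<Union>i. v i) = (\<Union>i. a \<times> v i)" by auto
    then show ?case using Union by (auto intro: sigma_sets.Union)
  qed
  then show "sets (borel \<Otimes>\<^sub>M configurations) \<subseteq> sigma_sets ?\<Omega> ?G"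
    unfolding sets_pair_measure by (auto intro!: sigma_sets_mono)
  have "v \<in> sets configurations" if "v \<in> void_events" for v
    using that by (auto simp: sets_configurations_void)
  then have "?G \<subseteq> sets (borel \<Otimes>\<^sub>M configurations)" by auto
  from sets.sigma_sets_subset[OF this] show "sigma_sets ?\<Omega> ?G \<subseteq> sets (borel \<Otimes>\<^sub>M configurations)"
    by (simp add: space_pair_measure)
qed

section \<open>Counts and void probabilities of a Poisson process\<close>

locale poisson_process =
  fixes M :: "'w measure" and \<mu> :: "complex measure" and \<Phi> :: "'w \<Rightarrow> complex set"
  assumes poisson: "poisson_point_process M \<mu> \<Phi>"
begin

lemma prob_space_M: "prob_space M"
  using poisson by (simp add: poisson_point_process_def)

sublocale prob_space M by (rule prob_space_M)

lemma measurable_process [measurable]: "\<Phi> \<in> M \<rightarrow>\<^sub>M configurations"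
  using poisson by (simp add: poisson_point_process_def)

lemma sets_intensity [measurable_cong, simp]: "sets \<mu> = sets borel"
  using poisson by (simp add: poisson_point_process_def)

lemma space_intensity [simp]: "space \<mu> = UNIV"
  using sets_eq_imp_space_eq[OF sets_intensity] by simp

lemma locally_finite_process: "\<omega> \<in> space M \<Longrightarrow> \<Phi> \<omega> \<in> locally_finite_sets"
  using measurable_space[OF measurable_process] by simp

lemma finite_process_Int: "\<omega> \<in> space M \<Longrightarrow> bounded B \<Longrightarrow> finite (\<Phi> \<omega> \<inter> B)"
  by (rule locally_finite_setsD[OF locally_finite_process])

lemma emeasure_intensity:
  "B \<in> sets borel \<Longrightarrow> bounded B \<Longrightarrow> emeasure \<mu> B = ennreal (measure \<mu> B)"
  using poisson by (intro emeasure_eq_ennreal_measure) (auto simp: poisson_point_process_def)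

lemma measurable_card_process:
  "B \<in> sets borel \<Longrightarrow> bounded B \<Longrightarrow> (\<lambda>\<omega>. card (\<Phi> \<omega> \<inter> B)) \<in> M \<rightarrow>\<^sub>M count_space UNIV"
  by (rule measurable_compose[OF measurable_process measurable_card_configurations])

lemma prob_card:
  "B \<in> sets borel \<Longrightarrow> bounded B \<Longrightarrow>
    prob {\<omega> \<in> space M. card (\<Phi> \<omega> \<inter> B) = k} = exp (- measure \<mu> B) * measure \<mu> B ^ k / fact k"
  using poisson by (simp add: poisson_point_process_def)

text \<open>Boundedness matters: \<open>card\<close> is 0 on infinite sets too, and local finiteness
  excludes these.\<close>

lemma void_iff_card:
  "bounded B \<Longrightarrow> {\<omega> \<in> space M. \<Phi> \<omega> \<inter> B = {}} = {\<omega> \<in> space M. card (\<Phi> \<omega> \<inter> B) = 0}"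
  by (auto simp: finite_process_Int card_eq_0_iff)

lemma prob_void:
  "B \<in> sets borel \<Longrightarrow> bounded B \<Longrightarrow>
    prob {\<omega> \<in> space M. \<Phi> \<omega> \<inter> B = {}} = exp (- measure \<mu> B)"
  by (simp add: void_iff_card prob_card)

lemma void_event [measurable]:
  assumes [measurable]: "B \<in> sets borel" shows "{\<omega> \<in> space M. \<Phi> \<omega> \<inter> B = {}} \<in> events"
proof -
  have [measurable]: "Measurable.pred M (\<lambda>\<omega>. \<exists>z\<in>\<Phi> \<omega>. (\<lambda>(\<omega>, z). z \<in> B) (\<omega>, z))"
    by (rule measurable_count_space_pred) measurable
  have "{\<omega> \<in> space M. \<Phi> \<omega> \<inter> B = {}} = {\<omega> \<in> space M. \<not> (\<exists>z\<in>\<Phi> \<omega>. (\<lambda>(\<omega>, z). z \<in> B) (\<omega>, z))}"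
    by auto
  also have "\<dots> \<in> events" by measurable
  finally show ?thesis .
qed

lemma prob_card_void:
  assumes B: "B \<in> sets borel" "bounded B" and C: "C \<in> sets borel" "bounded C" and "B \<inter> C = {}"
  shows "prob {\<omega> \<in> space M. card (\<Phi> \<omega> \<inter> B) = k \<and> \<Phi> \<omega> \<inter> C = {}}
    = exp (- measure \<mu> B) * measure \<mu> B ^ k / fact k * exp (- measure \<mu> C)"
proof -
  \<comment> \<open>Independence is stated for families indexed by naturals; the pair
    \<open>B\<close>, \<open>C\<close> becomes such a family on \<open>{0, 1}\<close>.\<close>
  define D where "D i = (if i = (0::nat) then B else C)" for i
  have "disjoint_family_on D {0, 1}"
    using assms by (auto simp: disjoint_family_on_def D_def)
  then have "indep_vars (\<lambda>_. count_space UNIV) (\<lambda>i \<omega>. card (\<Phi> \<omega> \<inter> D i)) {0, 1}"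
    using poisson[unfolded poisson_point_process_def, THEN conjunct2, THEN conjunct2, THEN conjunct2,
        THEN conjunct2, THEN conjunct2, rule_format, of "{0, 1}" D] B C
    by (simp add: D_def)
  from indep_varsD[OF this, of "{0, 1}" "\<lambda>i. if i = 0 then {k} else {0}"]
  have "prob ({\<omega> \<in> space M. card (\<Phi> \<omega> \<inter> B) = k} \<inter> {\<omega> \<in> space M. card (\<Phi> \<omega> \<inter> C) = 0})
    = prob {\<omega> \<in> space M. card (\<Phi> \<omega> \<inter> B) = k} * prob {\<omega> \<in> space M. card (\<Phi> \<omega> \<inter> C) = 0}"
    by (simp add: D_def vimage_def Int_def conj_commute conj_ac)
  moreover have "{\<omega> \<in> space M. card (\<Phi> \<omega> \<inter> B) = k} \<inter> {\<omega> \<in> space M. card (\<Phi> \<omega> \<inter> C) = 0}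
     = {\<omega> \<in> space M. card (\<Phi> \<omega> \<inter> B) = k \<and> \<Phi> \<omega> \<inter> C = {}}"
    using C by (auto simp: finite_process_Int card_eq_0_iff)
  ultimately show ?thesis using B C by (simp add: prob_card)
qed

lemma nn_integral_card_void:
  assumes B: "B \<in> sets borel" "bounded B" and C: "C \<in> sets borel" "bounded C" and "B \<inter> C = {}"
  shows "(\<integral>\<^sup>+\<omega>. f (card (\<Phi> \<omega> \<inter> B)) * indicator {\<omega>. \<Phi> \<omega> \<inter> C = {}} \<omega> \<partial>M)
    = (\<Sum>k. f k * ennreal (exp (- measure \<mu> B) * measure \<mu> B ^ k / fact k)) * ennreal (exp (- measure \<mu> C))"
proof -
  note [measurable] = C measurable_card_process[OF B]
  define E where "E k = {\<omega> \<in> space M. card (\<Phi> \<omega> \<inter> B) = k \<and> \<Phi> \<omega> \<inter> C = {}}" for k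
  have [measurable]: "E k \<in> events" for k
  proof -
    have "E k = {\<omega> \<in> space M. card (\<Phi> \<omega> \<inter> B) = k} \<inter> {\<omega> \<in> space M. \<Phi> \<omega> \<inter> C = {}}"
      by (auto simp: E_def)
    also have "\<dots> \<in> events" by measurable
    finally show ?thesis .
  qed
  have "(\<integral>\<^sup>+\<omega>. f (card (\<Phi> \<omega> \<inter> B)) * indicator {\<omega>. \<Phi> \<omega> \<inter> C = {}} \<omega> \<partial>M)
    = (\<integral>\<^sup>+\<omega>. (\<Sum>k. f k * indicator (E k) \<omega>) \<partial>M)"
  proof (rule nn_integral_cong)
    fix \<omega> assume "\<omega> \<in> space M"
    then have "(\<Sum>k. f k * indicator (E k) \<omega>)
      = (\<Sum>k\<in>{card (\<Phi> \<omega> \<inter> B)}. f k * indicator (E k) \<omega>)"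
      by (intro suminf_finite) (auto simp: E_def indicator_def)
    then show "f (card (\<Phi> \<omega> \<inter> B)) * indicator {\<omega>. \<Phi> \<omega> \<inter> C = {}} \<omega> = (\<Sum>k. f k * indicator (E k) \<omega>)"
      using \<open>\<omega> \<in> space M\<close> by (auto simp: E_def indicator_def)
  qed
  also have "\<dots> = (\<Sum>k. \<integral>\<^sup>+\<omega>. f k * indicator (E k) \<omega> \<partial>M)"
    by (rule nn_integral_suminf) measurable
  also have "\<dots> = (\<Sum>k. f k * ennreal (exp (- measure \<mu> B) * measure \<mu> B ^ k / fact k) * ennreal (exp (- measure \<mu> C)))"
  proof (rule suminf_cong)
    fix k
    show "(\<integral>\<^sup>+\<omega>. f k * indicator (E k) \<omega> \<partial>M) = f k * ennreal (exp (- measure \<mu> B) * measure \<mu> B ^ k / fact k) * ennreal (exp (- measure \<mu> C))"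
    proof -
      have "emeasure M (E k) = ennreal (exp (- measure \<mu> B) * measure \<mu> B ^ k / fact k) * ennreal (exp (- measure \<mu> C))"
        unfolding emeasure_eq_measure E_def prob_card_void[OF assms] by (rule ennreal_mult) simp_all
      then show ?thesis by (simp add: nn_integral_cmult_indicator mult.assoc)
    qed
  qed
  finally show ?thesis by simp
qed

lemma nn_integral_card_void_mean:
  assumes "B \<in> sets borel" "bounded B" "C \<in> sets borel" "bounded C" "B \<inter> C = {}"
  shows "(\<integral>\<^sup>+\<omega>. ennreal (card (\<Phi> \<omega> \<inter> B)) * indicator {\<omega>. \<Phi> \<omega> \<inter> C = {}} \<omega> \<partial>M)
    = emeasure \<mu> B * ennreal (exp (- measure \<mu> C))"
proof -
  let ?m = "measure \<mu> B"
  \<comment> \<open>The mean is the exponential series shifted by one index, since k / k! = 1 / (k -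
    1)!.\<close>
  have "(\<lambda>k. ?m ^ k /\<^sub>R fact k) sums exp ?m" by (rule exp_converges)
  then have "(\<lambda>k. exp (- ?m) * ?m * (?m ^ k /\<^sub>R fact k)) sums (exp (- ?m) * ?m * exp ?m)"
    by (rule sums_mult)
  also have "exp (- ?m) * ?m * exp ?m = ?m" by (simp add: exp_minus field_simps)
  also have "(\<lambda>k. exp (- ?m) * ?m * (?m ^ k /\<^sub>R fact k))
     = (\<lambda>k. real (Suc k) * (exp (- ?m) * ?m ^ Suc k / fact (Suc k)))"
    by (rule ext) (simp add: divide_simps del: of_nat_Suc)
  \<comment> \<open>The term for k = 0, which the shift dropped, vanishes.\<close>
  finally have "(\<lambda>k. real k * (exp (- ?m) * ?m ^ k / fact k)) sums ?m"
    by (subst (asm) sums_Suc_iff) simp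
  then have "(\<Sum>k. ennreal (real k * (exp (- ?m) * ?m ^ k / fact k))) = ennreal ?m"
    by (intro suminf_ennreal_eq) auto
  then have "(\<Sum>k. ennreal k * ennreal (exp (- ?m) * ?m ^ k / fact k)) = ennreal ?m"
    by (simp add: ennreal_mult[symmetric])
  then show ?thesis
    using nn_integral_card_void[OF assms, of "\<lambda>k. ennreal k"] assms by (simp add: emeasure_intensity)
qed

text \<open>The exponential moment is finite and explicit, so it can later stand in for the fourth
  moment of the number of points in a region.\<close>

lemma nn_integral_exp_card:
  assumes "B \<in> sets borel" "bounded B"
  shows "(\<integral>\<^sup>+\<omega>. ennreal (exp (card (\<Phi> \<omega> \<inter> B))) \<partial>M) = ennreal (exp (measure \<mu> B * (exp 1 - 1)))"
proof -
  let ?m = "measure \<mu> B"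
  have "(\<lambda>k. (exp 1 * ?m) ^ k /\<^sub>R fact k) sums exp (exp 1 * ?m)" by (rule exp_converges)
  then have "(\<lambda>k. exp (- ?m) * ((exp 1 * ?m) ^ k /\<^sub>R fact k)) sums (exp (- ?m) * exp (exp 1 * ?m))"
    by (rule sums_mult)
  also have "exp (- ?m) * exp (exp 1 * ?m) = exp (?m * (exp 1 - 1))"
    by (simp add: mult_exp_exp algebra_simps)
  also have "(\<lambda>k. exp (- ?m) * ((exp 1 * ?m) ^ k /\<^sub>R fact k))
     = (\<lambda>k. exp (real k) * (exp (- ?m) * ?m ^ k / fact k))"
    by (rule ext) (simp add: divide_simps power_mult_distrib exp_of_nat_mult[of _ 1, simplified])
  finally have "(\<Sum>k. ennreal (exp (real k) * (exp (- ?m) * ?m ^ k / fact k))) = ennreal (exp (?m * (exp 1 - 1)))"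
    by (intro suminf_ennreal_eq) auto
  then have "(\<Sum>k. ennreal (exp (real k)) * ennreal (exp (- ?m) * ?m ^ k / fact k)) = ennreal (exp (?m * (exp 1 - 1)))"
    by (simp add: ennreal_mult[symmetric])
  then show ?thesis
    using nn_integral_card_void[OF assms, of "{}" "\<lambda>k. ennreal (exp (real k))"] by simp
qed

lemma measurable_sum_process_bounded:
  assumes [measurable]: "g \<in> borel_measurable (borel \<Otimes>\<^sub>M configurations)" and A: "A \<in> sets borel" "bounded A"
  shows "(\<lambda>\<omega>. \<integral>\<^sup>+x. g (x, \<Phi> \<omega>) \<partial>count_space (\<Phi> \<omega> \<inter> A)) \<in> borel_measurable M"
proof -
  have "(\<lambda>q. g (snd q, \<Phi> (fst q))) \<in> borel_measurable (M \<Otimes>\<^sub>M borel)" by measurable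
  from measurable_nn_integral_count_space_bounded[OF measurable_process this A] show ?thesis by simp
qed

text \<open>The sets \<open>b \<times> {S. S \<inter> C = {}}\<close> generate, so that only the mean of the number of points in
  \<open>A \<inter> b - C\<close> on the event that \<open>C\<close> is void has to be computed.\<close>

lemma mecke_bounded:
  assumes g: "g \<in> borel_measurable (borel \<Otimes>\<^sub>M configurations)" and A: "A \<in> sets borel" "bounded A"
  shows "(\<integral>\<^sup>+\<omega>. \<integral>\<^sup>+x. g (x, \<Phi> \<omega>) \<partial>count_space (\<Phi> \<omega> \<inter> A) \<partial>M)
    = (\<integral>\<^sup>+x. indicator A x * (\<integral>\<^sup>+\<omega>. g (x, insert x (\<Phi> \<omega>)) \<partial>M) \<partial>\<mu>)"
proof -
  note [measurable] = A(1)
  define lhs where "lhs g = (\<integral>\<^sup>+\<omega>. \<integral>\<^sup>+x. g (x, \<Phi> \<omega>) \<partial>count_space (\<Phi> \<omega> \<inter> A) \<partial>M)"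
    for g :: "complex \<times> complex set \<Rightarrow> ennreal"
  define rhs where "rhs g = (\<integral>\<^sup>+x. indicator A x * (\<integral>\<^sup>+\<omega>. g (x, insert x (\<Phi> \<omega>)) \<partial>M) \<partial>\<mu>)"
    for g :: "complex \<times> complex set \<Rightarrow> ennreal"
  let ?N = "borel \<Otimes>\<^sub>M configurations :: (complex \<times> complex set) measure"
  note meas_l [measurable] = measurable_sum_process_bounded[OF _ A]
  have meas_r [measurable]: "(\<lambda>x. \<integral>\<^sup>+\<omega>. g (x, insert x (\<Phi> \<omega>)) \<partial>M) \<in> borel_measurable borel"
    if [measurable]: "g \<in> borel_measurable ?N" for g
    by measurable
  have meas_r' [measurable]: "(\<lambda>\<omega>. g (x, insert x (\<Phi> \<omega>))) \<in> borel_measurable M"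
    if [measurable]: "g \<in> borel_measurable ?N" for g x
    by measurable
  have lhs_add: "lhs (\<lambda>p. g p + h p) = lhs g + lhs h"
    if [measurable]: "g \<in> borel_measurable ?N" "h \<in> borel_measurable ?N" for g h
    unfolding lhs_def by (simp add: nn_integral_add)
  have rhs_add: "rhs (\<lambda>p. g p + h p) = rhs g + rhs h"
    if [measurable]: "g \<in> borel_measurable ?N" "h \<in> borel_measurable ?N" for g h
    unfolding rhs_def by (simp add: nn_integral_add distrib_left)
  have lhs_cmult: "lhs (\<lambda>p. c * g p) = c * lhs g" if [measurable]: "g \<in> borel_measurable ?N" for g c
    unfolding lhs_def by (simp add: nn_integral_cmult)
  have rhs_cmult: "rhs (\<lambda>p. c * g p) = c * rhs g" if [measurable]: "g \<in> borel_measurable ?N" for g c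
    unfolding rhs_def by (simp add: nn_integral_cmult mult.left_commute)
  have lhs_SUP: "lhs (SUP i. U i) = (SUP i. lhs (U i))"
    if [measurable]: "\<And>i::nat. U i \<in> borel_measurable ?N" and U: "incseq U" for U
  proof -
    have "(\<integral>\<^sup>+x. (SUP i. U i) (x, \<Phi> \<omega>) \<partial>count_space (\<Phi> \<omega> \<inter> A))
        = (SUP i. \<integral>\<^sup>+x. U i (x, \<Phi> \<omega>) \<partial>count_space (\<Phi> \<omega> \<inter> A))" for \<omega>
      unfolding SUP_apply using U
      by (intro nn_integral_monotone_convergence_SUP) (auto simp: incseq_def le_fun_def)
    then show ?thesis
      unfolding lhs_def using U
      by (simp, intro nn_integral_monotone_convergence_SUP)
         (auto simp: incseq_def le_fun_def intro!: nn_integral_mono)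
  qed
  have rhs_SUP: "rhs (SUP i. U i) = (SUP i. rhs (U i))"
    if [measurable]: "\<And>i::nat. U i \<in> borel_measurable ?N" and U: "incseq U" for U
  proof -
    have "(\<integral>\<^sup>+\<omega>. (SUP i. U i) (x, insert x (\<Phi> \<omega>)) \<partial>M)
        = (SUP i. \<integral>\<^sup>+\<omega>. U i (x, insert x (\<Phi> \<omega>)) \<partial>M)" for x
      unfolding SUP_apply using U
      by (intro nn_integral_monotone_convergence_SUP) (auto simp: incseq_def le_fun_def)
    then show ?thesis
      unfolding rhs_def using U
      by (simp add: SUP_mult_left_ennreal, intro nn_integral_monotone_convergence_SUP)
         (auto simp: incseq_def le_fun_def intro!: nn_integral_mono mult_left_mono)
  qed
  have sets_case: "lhs (indicator E) = rhs (indicator E) \<and> rhs (indicator E) \<le> emeasure \<mu> A" if "E \<in> sets ?N" for E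
  proof -
    \<comment> \<open>Finiteness allows the value on \<open>E\<close> to be cancelled when passing
      from \<open>E\<close> to its complement.\<close>
    have bound: "rhs (indicator E) \<le> emeasure \<mu> A" if "E \<in> sets ?N" for E
    proof -
      have "rhs (indicator E) \<le> (\<integral>\<^sup>+x. indicator A x * (\<integral>\<^sup>+\<omega>. 1 \<partial>M) \<partial>\<mu>)"
        unfolding rhs_def by (intro nn_integral_mono mult_left_mono) (auto simp: indicator_def)
      also have "\<dots> = emeasure \<mu> A" by (simp add: emeasure_space_1)
      finally show ?thesis .
    qed
    have fin: "emeasure \<mu> A < \<top>" using A by (simp add: emeasure_intensity)
    have stable: "Int_stable {b \<times> v |b v. b \<in> sets (borel :: complex measure) \<and> v \<in> void_events}"
      using Int_stable_void_events unfolding Int_stable_def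
      by (intro ballI, elim CollectE exE conjE, hypsubst, unfold Times_Int_Times)
         (intro CollectI exI conjI, rule refl, auto)
    have closed: "{b \<times> v |b v. b \<in> sets (borel :: complex measure) \<and> v \<in> void_events} \<subseteq> Pow (UNIV \<times> locally_finite_sets)"
      using void_events_subset by auto
    have "lhs (indicator E) = rhs (indicator E)"
    proof (rule sigma_sets_induct_disjoint[OF stable closed that[unfolded sets_pair_borel_configurations]])
      fix E assume "E \<in> {b \<times> v |b v. b \<in> sets (borel :: complex measure) \<and> v \<in> void_events}"
      then obtain b C where E: "E = b \<times> {S \<in> locally_finite_sets. S \<inter> C = {}}"
        and b: "b \<in> sets borel" and C: "C \<in> sets borel" "bounded C"
        unfolding void_events_def by blast
      note [measurable] = b C(1)
      have bd: "bounded (A \<inter> b - C)" by (rule bounded_subset[OF A(2)]) auto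
      \<comment> \<open>If \<open>C\<close> is void, all points counted lie outside
        \<open>C\<close>. Removing \<open>C\<close> from the counting set makes it disjoint from
        \<open>C\<close>, so count and void event are independent.\<close>
      have "lhs (indicator E)
        = (\<integral>\<^sup>+\<omega>. ennreal (card (\<Phi> \<omega> \<inter> (A \<inter> b - C))) * indicator {\<omega>. \<Phi> \<omega> \<inter> C = {}} \<omega> \<partial>M)"
        unfolding lhs_def
      proof (rule nn_integral_cong)
        fix \<omega> assume \<omega>: "\<omega> \<in> space M"
        have fin: "finite (\<Phi> \<omega> \<inter> A)" using finite_process_Int[OF \<omega> A(2)] .
        show "(\<integral>\<^sup>+x. indicator E (x, \<Phi> \<omega>) \<partial>count_space (\<Phi> \<omega> \<inter> A))
          = ennreal (card (\<Phi> \<omega> \<inter> (A \<inter> b - C))) * indicator {\<omega>. \<Phi> \<omega> \<inter> C = {}} \<omega>"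
        proof (cases "\<Phi> \<omega> \<inter> C = {}")
          case True
          then have "(\<integral>\<^sup>+x. indicator E (x, \<Phi> \<omega>) \<partial>count_space (\<Phi> \<omega> \<inter> A))
            = (\<integral>\<^sup>+x. indicator (\<Phi> \<omega> \<inter> (A \<inter> b - C)) x \<partial>count_space (\<Phi> \<omega> \<inter> A))"
            using locally_finite_process[OF \<omega>]
            by (intro nn_integral_cong) (auto simp: E indicator_def)
          also have "\<dots> = emeasure (count_space (\<Phi> \<omega> \<inter> A)) (\<Phi> \<omega> \<inter> (A \<inter> b - C))"
            by (rule nn_integral_indicator) auto
          also have "\<dots> = of_nat (card (\<Phi> \<omega> \<inter> (A \<inter> b - C)))"
            using finite_subset[OF _ fin, of "\<Phi> \<omega> \<inter> (A \<inter> b - C)"]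
            by (subst emeasure_count_space) auto
          finally show ?thesis using True by (simp add: ennreal_of_nat_eq_real_of_nat)
        next
          case False
          then have "(\<integral>\<^sup>+x. indicator E (x, \<Phi> \<omega>) \<partial>count_space (\<Phi> \<omega> \<inter> A)) = (\<integral>\<^sup>+x. 0 \<partial>count_space (\<Phi> \<omega> \<inter> A))"
            by (intro nn_integral_cong) (auto simp: E indicator_def)
          then show ?thesis using False by simp
        qed
      qed
      also have "\<dots> = emeasure \<mu> (A \<inter> b - C) * ennreal (exp (- measure \<mu> C))"
        using bd C by (intro nn_integral_card_void_mean) auto
      also have "\<dots> = (\<integral>\<^sup>+x. indicator (A \<inter> b - C) x * ennreal (exp (- measure \<mu> C)) \<partial>\<mu>)"
        by (subst nn_integral_multc) auto
      also have "\<dots> = rhs (indicator E)"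
        unfolding rhs_def
      proof (rule nn_integral_cong)
        \<comment> \<open>After inserting \<open>x\<close>, the set \<open>C\<close> is still void
          iff it was void before and \<open>x\<close> lies outside it.\<close>
        fix x
        have "(\<integral>\<^sup>+\<omega>. indicator E (x, insert x (\<Phi> \<omega>)) \<partial>M)
          = (\<integral>\<^sup>+\<omega>. indicator (b - C) x * indicator {\<omega> \<in> space M. \<Phi> \<omega> \<inter> C = {}} \<omega> \<partial>M)"
          by (intro nn_integral_cong)
             (auto simp: E indicator_def locally_finite_process intro!: locally_finite_sets_insert)
        also have "\<dots> = indicator (b - C) x * ennreal (exp (- measure \<mu> C))"
          using C by (subst nn_integral_cmult_indicator) (auto simp: emeasure_eq_measure prob_void)
        finally show "indicator (A \<inter> b - C) x * ennreal (exp (- measure \<mu> C))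
          = indicator A x * (\<integral>\<^sup>+\<omega>. indicator E (x, insert x (\<Phi> \<omega>)) \<partial>M)"
          by (auto simp: indicator_def)
      qed
      finally show "lhs (indicator E) = rhs (indicator E)" .
    next
      show "lhs (indicator {}) = rhs (indicator {})" by (simp add: lhs_def rhs_def)
    next
      fix E assume E: "E \<in> sigma_sets (UNIV \<times> locally_finite_sets) {b \<times> v |b v. b \<in> sets (borel :: complex measure) \<and> v \<in> void_events}"
        and IH: "lhs (indicator E) = rhs (indicator E)"
      let ?O = "UNIV \<times> locally_finite_sets :: (complex \<times> complex set) set"
      have EN [measurable]: "E \<in> sets ?N" using E by (simp add: sets_pair_borel_configurations)
      have [measurable]: "?O \<in> sets ?N" using sets.top[of ?N] by (simp add: space_pair_measure)
      have add1: "(\<lambda>p. indicator E p + indicator (?O - E) p :: ennreal) = indicator ?O"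
        using sets.sets_into_space[OF EN] by (intro ext) (auto simp: space_pair_measure split: split_indicator)
      have "lhs (indicator ?O) = rhs (indicator ?O)"
      proof -
        have "lhs (indicator ?O) = (\<integral>\<^sup>+\<omega>. ennreal (card (\<Phi> \<omega> \<inter> A)) \<partial>M)"
          unfolding lhs_def
        proof (rule nn_integral_cong)
          fix \<omega> assume \<omega>: "\<omega> \<in> space M"
          have "(\<integral>\<^sup>+x. indicator ?O (x, \<Phi> \<omega>) \<partial>count_space (\<Phi> \<omega> \<inter> A)) = (\<integral>\<^sup>+x. 1 \<partial>count_space (\<Phi> \<omega> \<inter> A))"
            using locally_finite_process[OF \<omega>] by (intro nn_integral_cong) auto
          then show "(\<integral>\<^sup>+x. indicator ?O (x, \<Phi> \<omega>) \<partial>count_space (\<Phi> \<omega> \<inter> A)) = ennreal (card (\<Phi> \<omega> \<inter> A))"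
            using finite_process_Int[OF \<omega> A(2)]
            by (simp add: nn_integral_count_space_finite ennreal_of_nat_eq_real_of_nat)
        qed
        also have "\<dots> = emeasure \<mu> A"
          using nn_integral_card_void_mean[OF A, of "{}"] by simp
        also have "\<dots> = (\<integral>\<^sup>+x. indicator A x * (\<integral>\<^sup>+\<omega>. 1 \<partial>M) \<partial>\<mu>)" by (simp add: emeasure_space_1)
        also have "\<dots> = rhs (indicator ?O)"
          unfolding rhs_def
          by (intro nn_integral_cong arg_cong2[where f="(*)"] refl)
             (auto simp: locally_finite_process locally_finite_sets_insert)
        finally show ?thesis .
      qed
      then have "lhs (indicator E) + lhs (indicator (?O - E)) = rhs (indicator E) + rhs (indicator (?O - E))"
        using lhs_add[of "indicator E" "indicator (?O - E)"] rhs_add[of "indicator E" "indicator (?O - E)"]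
        by (simp add: add1)
      moreover have "rhs (indicator E) \<noteq> \<top>" using bound[OF EN] fin by (auto simp: top_unique)
      ultimately show "lhs (indicator (?O - E)) = rhs (indicator (?O - E))"
        by (simp add: IH ennreal_add_left_cancel)
    next
      fix F :: "nat \<Rightarrow> (complex \<times> complex set) set"
      assume dis: "disjoint_family F"
        and F: "range F \<subseteq> sigma_sets (UNIV \<times> locally_finite_sets) {b \<times> v |b v. b \<in> sets borel \<and> v \<in> void_events}"
        and IH: "\<And>i. lhs (indicator (F i)) = rhs (indicator (F i))"
      have [measurable]: "F i \<in> sets ?N" for i using F by (auto simp: sets_pair_borel_configurations)
      \<comment> \<open>Partial sums turn the disjoint union into an increasing limit, for which
        both sides are continuous.\<close>
      define U where "U n = (\<lambda>p. \<Sum>i<n. indicator (F i) p :: ennreal)" for n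
      have U_meas [measurable]: "U n \<in> borel_measurable ?N" for n unfolding U_def by measurable
      have U_Suc: "U (Suc n) = (\<lambda>p. U n p + indicator (F n) p)" for n by (auto simp: U_def)
      have U_eq: "lhs (U n) = rhs (U n)" for n
      proof (induction n)
        case 0 show ?case by (simp add: U_def lhs_def rhs_def)
      next
        case (Suc n)
        then show ?case by (simp add: U_Suc lhs_add rhs_add IH)
      qed
      have "incseq U" by (auto simp: incseq_Suc_iff U_Suc le_fun_def)
      moreover have "(SUP n. U n) = indicator (\<Union>i. F i)"
      proof
        fix p
        have "(SUP n. U n) p = (\<Sum>i. indicator (F i) p)"
          by (simp add: U_def suminf_eq_SUP image_image)
        also have "\<dots> = indicator (\<Union>i. F i) p" using dis by (rule suminf_indicator)
        finally show "(SUP n. U n) p = indicator (\<Union>i. F i) p" .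
      qed
      ultimately show "lhs (indicator (\<Union>i. F i)) = rhs (indicator (\<Union>i. F i))"
        using lhs_SUP[of U] rhs_SUP[of U] U_meas U_eq by simp
    qed
    with bound[OF that] show ?thesis by simp
  qed
  have "lhs g = rhs g" using g
  proof induction
    case (cong f h)
    have "lhs f = lhs h" unfolding lhs_def
      using cong by (intro nn_integral_cong) (auto simp: space_pair_measure locally_finite_process)
    moreover have "rhs f = rhs h" unfolding rhs_def
      using cong
      by (intro nn_integral_cong arg_cong2[where f="(*)"] refl)
         (auto simp: space_pair_measure locally_finite_process locally_finite_sets_insert)
    ultimately show ?case using cong by simp
  next
    case (set E) then show ?case using sets_case by simp
  next
    case (mult u c) then show ?case by (simp add: lhs_cmult rhs_cmult)
  next
    case (add u v) then show ?case by (simp add: lhs_add rhs_add)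
  next
    case (seq U) then show ?case by (simp only: lhs_SUP rhs_SUP)
  qed
  then show ?thesis by (simp add: lhs_def rhs_def)
qed

lemma mecke:
  assumes g: "g \<in> borel_measurable (borel \<Otimes>\<^sub>M configurations)"
  shows "(\<integral>\<^sup>+\<omega>. \<integral>\<^sup>+x. g (x, \<Phi> \<omega>) \<partial>count_space (\<Phi> \<omega>) \<partial>M)
    = (\<integral>\<^sup>+x. \<integral>\<^sup>+\<omega>. g (x, insert x (\<Phi> \<omega>)) \<partial>M \<partial>\<mu>)"
proof -
  note [measurable] = g
  let ?A = "\<lambda>n::nat. cball 0 (real n) :: complex set"
  have "(\<integral>\<^sup>+\<omega>. \<integral>\<^sup>+x. g (x, \<Phi> \<omega>) \<partial>count_space (\<Phi> \<omega>) \<partial>M)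
    = (\<integral>\<^sup>+\<omega>. (SUP n. \<integral>\<^sup>+x. g (x, \<Phi> \<omega>) \<partial>count_space (\<Phi> \<omega> \<inter> ?A n)) \<partial>M)"
    by (subst nn_integral_count_space_Int_ball) simp
  also have "\<dots> = (SUP n. \<integral>\<^sup>+\<omega>. \<integral>\<^sup>+x. g (x, \<Phi> \<omega>) \<partial>count_space (\<Phi> \<omega> \<inter> ?A n) \<partial>M)"
  proof (rule nn_integral_monotone_convergence_SUP)
    show "incseq (\<lambda>n \<omega>. \<integral>\<^sup>+x. g (x, \<Phi> \<omega>) \<partial>count_space (\<Phi> \<omega> \<inter> ?A n))"
      by (auto simp: incseq_def le_fun_def indicator_def nn_integral_count_space_indicator intro!: nn_integral_mono)
  qed (intro measurable_sum_process_bounded g; auto)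
  also have "\<dots> = (SUP n. \<integral>\<^sup>+x. indicator (?A n) x * (\<integral>\<^sup>+\<omega>. g (x, insert x (\<Phi> \<omega>)) \<partial>M) \<partial>\<mu>)"
    by (subst mecke_bounded[OF g]) auto
  also have "\<dots> = (\<integral>\<^sup>+x. (SUP n. indicator (?A n) x * (\<integral>\<^sup>+\<omega>. g (x, insert x (\<Phi> \<omega>)) \<partial>M)) \<partial>\<mu>)"
    by (intro nn_integral_monotone_convergence_SUP[symmetric])
       (auto simp: incseq_def le_fun_def indicator_def)
  also have "\<dots> = (\<integral>\<^sup>+x. \<integral>\<^sup>+\<omega>. g (x, insert x (\<Phi> \<omega>)) \<partial>M \<partial>\<mu>)"
  proof (intro nn_integral_cong antisym SUP_least)
    fix x :: complex
    obtain n where "norm x \<le> real n" using real_arch_simple by blast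
    then show "(\<integral>\<^sup>+\<omega>. g (x, insert x (\<Phi> \<omega>)) \<partial>M) \<le> (SUP n. indicator (?A n) x * (\<integral>\<^sup>+\<omega>. g (x, insert x (\<Phi> \<omega>)) \<partial>M))"
      by (intro SUP_upper2[of n]) auto
  qed (auto simp: indicator_def)
  finally show ?thesis .
qed

text \<open>Two applications of \<open>mecke\<close>. The first produces an inner sum over
  \<open>insert x (\<Phi> \<omega>)\<close>; by \<open>diag\<close> the term with
  \<open>y = x\<close> vanishes, so this is a sum over \<open>\<Phi> \<omega>\<close> and the
  formula applies again.\<close>

lemma mecke2:
  assumes g [measurable]: "g \<in> borel_measurable (borel \<Otimes>\<^sub>M borel \<Otimes>\<^sub>M configurations)"
    and diag: "\<And>x S. g (x, x, S) = 0"
  shows "(\<integral>\<^sup>+\<omega>. \<integral>\<^sup>+x. \<integral>\<^sup>+y. g (x, y, \<Phi> \<omega>) \<partial>count_space (\<Phi> \<omega>) \<partial>count_space (\<Phi> \<omega>) \<partial>M)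
    = (\<integral>\<^sup>+x. \<integral>\<^sup>+y. \<integral>\<^sup>+\<omega>. g (x, y, insert x (insert y (\<Phi> \<omega>))) \<partial>M \<partial>\<mu> \<partial>\<mu>)"
proof -
  have gm: "(\<lambda>q. g (fst (fst q), snd q, snd (fst q))) \<in> borel_measurable ((borel \<Otimes>\<^sub>M configurations) \<Otimes>\<^sub>M borel)"
    by measurable
  from measurable_nn_integral_count_space[OF measurable_snd gm]
  have inner: "(\<lambda>q. \<integral>\<^sup>+y. g (fst q, y, snd q) \<partial>count_space (snd q)) \<in> borel_measurable (borel \<Otimes>\<^sub>M configurations)"
    by simp
  have "(\<integral>\<^sup>+\<omega>. \<integral>\<^sup>+x. \<integral>\<^sup>+y. g (x, y, \<Phi> \<omega>) \<partial>count_space (\<Phi> \<omega>) \<partial>count_space (\<Phi> \<omega>) \<partial>M)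
    = (\<integral>\<^sup>+x. \<integral>\<^sup>+\<omega>. \<integral>\<^sup>+y. g (x, y, insert x (\<Phi> \<omega>)) \<partial>count_space (insert x (\<Phi> \<omega>)) \<partial>M \<partial>\<mu>)"
    using mecke[OF inner] by simp
  also have "\<dots> = (\<integral>\<^sup>+x. \<integral>\<^sup>+\<omega>. \<integral>\<^sup>+y. g (x, y, insert x (\<Phi> \<omega>)) \<partial>count_space (\<Phi> \<omega>) \<partial>M \<partial>\<mu>)"
    by (intro nn_integral_cong)
       (auto simp: nn_integral_count_space_indicator diag indicator_def intro!: nn_integral_cong)
  also have "\<dots> = (\<integral>\<^sup>+x. \<integral>\<^sup>+y. \<integral>\<^sup>+\<omega>. g (x, y, insert x (insert y (\<Phi> \<omega>))) \<partial>M \<partial>\<mu> \<partial>\<mu>)"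
  proof (rule nn_integral_cong)
    fix x
    show "(\<integral>\<^sup>+\<omega>. \<integral>\<^sup>+y. g (x, y, insert x (\<Phi> \<omega>)) \<partial>count_space (\<Phi> \<omega>) \<partial>M)
      = (\<integral>\<^sup>+y. \<integral>\<^sup>+\<omega>. g (x, y, insert x (insert y (\<Phi> \<omega>))) \<partial>M \<partial>\<mu>)"
      using mecke[of "\<lambda>(y, S). g (x, y, insert x S)"] by simp
  qed
  finally show ?thesis .
qed

text \<open>The definition of the process only makes counts independent. Void events of each
  restriction form a pi-system generating its \<sigma>-algebra, and for them the product rule is the
  additivity of \<mu> on disjoint sets, as void probabilities are exponentials of -\<mu>. Any
  functionals of the two restrictions are then independent, in particular their numbers of
  vertices.\<close>

lemma indep_restrictions:
  assumes A: "A \<in> sets borel" and B: "B \<in> sets borel" and AB: "A \<inter> B = {}"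
  shows "indep_var configurations (\<lambda>\<omega>. \<Phi> \<omega> \<inter> A) configurations (\<lambda>\<omega>. \<Phi> \<omega> \<inter> B)"
proof -
  define X where "X D \<omega> = \<Phi> \<omega> \<inter> D" for D \<omega>
  define G where "G D = {X D -` v \<inter> space M | v. v \<in> void_events}" for D
  have rv: "X D \<in> M \<rightarrow>\<^sub>M configurations" if "D \<in> sets borel" for D
    unfolding X_def using that by (intro measurable_Int_configurations) auto
  have sg: "sigma_sets (space M) {X D -` v \<inter> space M | v. v \<in> sets configurations} = sigma_sets (space M) (G D)"
    if "D \<in> sets borel" for D
  proof -
    have "X D \<in> space M \<rightarrow> locally_finite_sets" using measurable_space[OF rv[OF that]] by auto
    from sigma_sets_vimage_commute[OF this, of void_events] show ?thesis
      unfolding sets_configurations_void G_def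
      by (simp add: sigma_sets_sigma_sets_eq[OF sets.space_closed])
         (subst sigma_sets_sigma_sets_eq, auto)
  qed
  have G_eq: "G D = {{\<omega> \<in> space M. \<Phi> \<omega> \<inter> (D \<inter> C) = {}} | C. C \<in> sets borel \<and> bounded C}" if "D \<in> sets borel" for D
  proof -
    have "X D -` {S \<in> locally_finite_sets. S \<inter> C = {}} \<inter> space M = {\<omega> \<in> space M. \<Phi> \<omega> \<inter> (D \<inter> C) = {}}" for C
      using locally_finite_process locally_finite_sets_subset by (auto simp: X_def) (metis Int_lower1)
    then show ?thesis unfolding G_def void_events_def by blast
  qed
  have stable: "Int_stable (G D)" if "D \<in> sets borel" for D
    unfolding Int_stable_def
  proof safe
    fix a b assume "a \<in> G D" "b \<in> G D"
    then obtain u v where "a = X D -` u \<inter> space M" "b = X D -` v \<inter> space M" "u \<in> void_events" "v \<in> void_events"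
      by (auto simp: G_def)
    then show "a \<inter> b \<in> G D"
      using Int_stable_void_events by (auto simp: G_def Int_stable_def intro!: exI[of _ "u \<inter> v"])
  qed
  have "indep_set (G A) (G B)"
  proof (rule indep_setI)
    show "G A \<subseteq> events" "G B \<subseteq> events" using A B by (auto simp: G_eq)
    fix a b assume "a \<in> G A" "b \<in> G B"
    then obtain C D where a: "a = {\<omega> \<in> space M. \<Phi> \<omega> \<inter> (A \<inter> C) = {}}" "C \<in> sets borel" "bounded C"
      and b: "b = {\<omega> \<in> space M. \<Phi> \<omega> \<inter> (B \<inter> D) = {}}" "D \<in> sets borel" "bounded D"
      using A B by (auto simp: G_eq)
    have bd: "bounded (A \<inter> C)" "bounded (B \<inter> D)" using a b by (auto intro: bounded_subset)
    have ab: "a \<inter> b = {\<omega> \<in> space M. \<Phi> \<omega> \<inter> ((A \<inter> C) \<union> (B \<inter> D)) = {}}" using a b by auto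
    have "measure \<mu> ((A \<inter> C) \<union> (B \<inter> D)) = measure \<mu> (A \<inter> C) + measure \<mu> (B \<inter> D)"
      using A B AB a b bd by (intro measure_Union) (auto simp: emeasure_intensity)
    then show "prob (a \<inter> b) = prob a * prob b"
      unfolding ab using A B a b bd by (subst prob_void) (auto simp: prob_void mult_exp_exp[symmetric] exp_add[symmetric])
  qed
  from indep_set_sigma_sets[OF this stable[OF A] stable[OF B]]
  show ?thesis
    using rv[OF A] rv[OF B] unfolding indep_var_eq sg[OF A, unfolded X_def] sg[OF B, unfolded X_def] X_def by simp
qed

end

section \<open>Vertices of the Crofton cell\<close>

text \<open>Infinite on infinite sets, unlike \<open>card\<close>; expected vertex numbers can thus
  be computed before the vertex set is known to be finite.\<close>

abbreviation ecard :: "'a set \<Rightarrow> ennreal" where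
  "ecard X \<equiv> emeasure (count_space UNIV) X"

lemma ecard_image_le: "ecard (f ` X) \<le> ecard X"
  by (cases "finite X") (auto simp: emeasure_count_space card_image_le)

lemma ecard_inj_on_image: "inj_on f X \<Longrightarrow> ecard (f ` X) = ecard X"
  by (simp add: emeasure_count_space card_image finite_image_iff)

lemma nn_integral_indicator_count_space:
  "(\<integral>\<^sup>+x. indicator B x \<partial>count_space S) = ecard (S \<inter> B)"
proof -
  have "(\<integral>\<^sup>+x. indicator B x \<partial>count_space S) = (\<integral>\<^sup>+x. indicator (S \<inter> B) x \<partial>count_space UNIV)"
    by (simp add: nn_integral_count_space_indicator indicator_inter_arith mult.commute)
  then show ?thesis by simp
qed

lemma measurable_ecard_Int:
  fixes \<Psi> :: "'q \<Rightarrow> complex set"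
  assumes \<Psi>: "\<Psi> \<in> Q \<rightarrow>\<^sub>M configurations" and [measurable]: "B \<in> sets borel"
  shows "(\<lambda>q. ecard (\<Psi> q \<inter> B)) \<in> borel_measurable Q"
proof -
  have "(\<lambda>q. \<integral>\<^sup>+z. (\<lambda>(q, z). indicator B z) (q, z) \<partial>count_space (\<Psi> q)) \<in> borel_measurable Q"
    by (rule measurable_nn_integral_count_space[OF \<Psi>]) measurable
  then show ?thesis by (simp add: nn_integral_indicator_count_space)
qed

lemma mem_half_plane: "v \<in> half_plane x \<longleftrightarrow> inner v x \<le> inner x x"
  by (simp add: half_plane_def inner_diff_left)

text \<open>The disk with diameter \<open>[0, v]\<close>: the feet of the lines that separate \<open>v\<close> from the origin.\<close>

definition cut_disk :: "complex \<Rightarrow> complex set" where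
  "cut_disk v = {z. inner z z < inner v z}"

text \<open>The bounding circle consists of the origin and the feet of lines through
  \<open>v\<close>, so the closed disk holds the feet of all lines that cut \<open>v\<close> off or
  pass through it.\<close>

definition closed_cut_disk :: "complex \<Rightarrow> complex set" where
  "closed_cut_disk v = {z. inner z z \<le> inner v z}"

text \<open>This duality makes membership of a point in the cell a void event, whose probability is
  explicit.\<close>

lemma mem_crofton_cell: "v \<in> crofton_cell S \<longleftrightarrow> S \<inter> cut_disk v = {}"
  by (auto simp: crofton_cell_def mem_half_plane cut_disk_def not_less)

lemma cut_disk_subset: "cut_disk v \<subseteq> closed_cut_disk v"
  by (auto simp: cut_disk_def closed_cut_disk_def)

lemma closed_cut_disk_subset: "closed_cut_disk v \<subseteq> cball 0 (norm v)"
proof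
  fix z assume "z \<in> closed_cut_disk v"
  then have "norm z * norm z \<le> norm v * norm z"
    using Cauchy_Schwarz_ineq2[of v z] by (simp add: closed_cut_disk_def power2_norm_eq_inner[symmetric] power2_eq_square)
  then show "z \<in> cball 0 (norm v)" by (cases "z = 0") auto
qed

lemma bounded_cut_disk: "bounded (cut_disk v)" "bounded (closed_cut_disk v)"
proof -
  show "bounded (closed_cut_disk v)" by (rule bounded_subset[OF bounded_cball closed_cut_disk_subset])
  then show "bounded (cut_disk v)" by (rule bounded_subset[OF _ cut_disk_subset])
qed

lemma measurable_cut_disk [measurable]:
  "cut_disk v \<in> sets borel" "closed_cut_disk v \<in> sets borel"
proof -
  have "open (cut_disk v)" unfolding cut_disk_def by (intro open_Collect_less continuous_intros)
  then show "cut_disk v \<in> sets borel" by simp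
  have "closed (closed_cut_disk v)" unfolding closed_cut_disk_def by (intro closed_Collect_le continuous_intros)
  then show "closed_cut_disk v \<in> sets borel" by simp
qed

text \<open>The solution \<open>v\<close> of \<open>\<langle>v, x\<rangle> = \<bar>x\<bar>\<^sup>2\<close> and \<open>\<langle>v, y\<rangle> = \<bar>y\<bar>\<^sup>2\<close>, by Cramer's rule.\<close>

definition meet :: "complex \<Rightarrow> complex \<Rightarrow> complex" where
  "meet x y = \<i> * (of_real (inner y y) * x - of_real (inner x x) * y) / of_real (Im (cnj x * y))"

lemma borel_measurable_cnj [measurable]:
  "f \<in> borel_measurable M \<Longrightarrow> (\<lambda>x. cnj (f x)) \<in> borel_measurable M"
  by (rule borel_measurable_continuous_on[of cnj]) (auto intro: continuous_intros)

lemma measurable_meet [measurable]: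
  assumes [measurable]: "f \<in> borel_measurable M" "g \<in> borel_measurable M"
  shows "(\<lambda>x. meet (f x) (g x)) \<in> borel_measurable M"
  unfolding meet_def by measurable

lemma meet_iff:
  assumes "Im (cnj x * y) \<noteq> 0"
  shows "inner v x = inner x x \<and> inner v y = inner y y \<longleftrightarrow> v = meet x y"
proof -
  have D: "Re x * Im y - Im x * Re y \<noteq> 0" using assms by (simp add: algebra_simps)
  have re: "Re (meet x y) = (inner x x * Im y - inner y y * Im x) / (Re x * Im y - Im x * Re y)"
    by (simp add: meet_def Re_divide_of_real inner_complex_def algebra_simps)
  have im: "Im (meet x y) = (inner y y * Re x - inner x x * Re y) / (Re x * Im y - Im x * Re y)"
    by (simp add: meet_def Im_divide_of_real inner_complex_def algebra_simps)
  let ?a = "inner x x" and ?b = "inner y y"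
  show ?thesis
  proof
    assume "inner v x = ?a \<and> inner v y = ?b"
    then have e: "Re v * Re x + Im v * Im x = ?a" "Re v * Re y + Im v * Im y = ?b"
      by (simp_all add: inner_complex_def[of v])
    have "Re v * (Re x * Im y - Im x * Re y) = ?a * Im y - ?b * Im x"
      unfolding e[symmetric] by (simp add: algebra_simps)
    moreover have "Im v * (Re x * Im y - Im x * Re y) = ?b * Re x - ?a * Re y"
      unfolding e[symmetric] by (simp add: algebra_simps)
    ultimately show "v = meet x y"
      using D by (simp add: complex_eq_iff re im eq_divide_eq)
  next
    assume v: "v = meet x y"
    have "Re v * (Re x * Im y - Im x * Re y) = ?a * Im y - ?b * Im x"
      "Im v * (Re x * Im y - Im x * Re y) = ?b * Re x - ?a * Re y"
      using D by (simp_all add: v re im)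
    then have "(Re v * Re x + Im v * Im x) * (Re x * Im y - Im x * Re y) = ?a * (Re x * Im y - Im x * Re y)"
      "(Re v * Re y + Im v * Im y) * (Re x * Im y - Im x * Re y) = ?b * (Re x * Im y - Im x * Re y)"
      by algebra+
    then show "inner v x = ?a \<and> inner v y = ?b"
      using D by (simp add: inner_complex_def[of v])
  qed
qed

text \<open>\<open>Im (cnj x * y)\<close> is the determinant of \<open>x\<close> and
  \<open>y\<close>. That it is nonzero excludes parallel lines; fixing its sign orders the two
  lines, so that a crossing corresponds to one ordered pair instead of two.\<close>

definition vertices :: "complex set \<Rightarrow> complex set" where
  "vertices S = {v \<in> crofton_cell S. \<exists>x\<in>S. \<exists>y\<in>S. Im (cnj x * y) > 0 \<and>
     inner v x = inner x x \<and> inner v y = inner y y}"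

lemma vertices_altdef:
  "vertices S = {v. \<exists>x\<in>S. \<exists>y\<in>S. Im (cnj x * y) > 0 \<and> v = meet x y \<and> S \<inter> cut_disk v = {}}"
proof -
  have "Im (cnj x * y) > 0 \<and> inner v x = inner x x \<and> inner v y = inner y y \<longleftrightarrow>
      Im (cnj x * y) > 0 \<and> v = meet x y" for v x y
    using meet_iff[of x y v] by (cases "Im (cnj x * y) > 0") simp_all
  then show ?thesis unfolding vertices_def mem_crofton_cell by blast
qed

text \<open>If no two lines through \<open>v\<close> cross transversally, some direction is parallel
  to all of them, and \<open>v\<close> can be moved a little both ways along it without leaving the
  cell. Conversely, if \<open>v\<close> lies inside a segment of the cell, both ends must lie on
  every line through \<open>v\<close>, hence on two crossing lines, and so equal
  \<open>v\<close>.\<close>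

lemma extreme_point_of_crofton_cell_iff:
  assumes lf: "S \<in> locally_finite_sets"
  shows "v extreme_point_of crofton_cell S \<longleftrightarrow> v \<in> vertices S"
proof
  assume ext: "v extreme_point_of crofton_cell S"
  then have vC: "v \<in> crofton_cell S" by (simp add: extreme_point_of_def)
  have le: "inner v x \<le> inner x x" if "x \<in> S" for x
    using vC that by (auto simp: crofton_cell_def mem_half_plane)
  show "v \<in> vertices S"
  proof (rule ccontr)
    assume nv: "v \<notin> vertices S"
    define F where "F = {x \<in> S. inner v x = inner x x}"
    have par: "Im (cnj x * y) = 0" if "x \<in> F" "y \<in> F" for x y
    proof -
      have "\<not> Im (cnj x * y) > 0" "\<not> Im (cnj y * x) > 0"
        using nv that vC by (auto simp: vertices_def F_def)
      then show ?thesis by (simp add: algebra_simps)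
    qed
    obtain d where d: "d \<noteq> 0" "\<And>x. x \<in> F \<Longrightarrow> inner d x = 0"
    proof (cases "F \<subseteq> {0}")
      case True
      then have "inner 1 x = 0" if "x \<in> F" for x :: complex using that by auto
      then show ?thesis using that[of 1] by auto
    next
      case False
      then obtain x where x: "x \<in> F" "x \<noteq> 0" by auto
      \<comment> \<open>All feet in \<open>F\<close> are multiples of \<open>x\<close>, so the
        right-angle rotation of \<open>x\<close> is orthogonal to each of them.\<close>
      show ?thesis
      proof (rule that[of "\<i> * x"])
        fix y assume "y \<in> F"
        from par[OF x(1) this] show "inner (\<i> * x) y = 0"
          by (simp add: inner_complex_def algebra_simps)
      qed (use x in simp)
    qed
    \<comment> \<open>For feet farther out than \<open>R\<close> the slack is at least
      \<open>norm x\<close>, which a move of length at most 1 cannot use up. Only finitely many feet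
      remain to restrict the step \<open>e\<close>.\<close>
    define R where "R = norm v + 1"
    have "\<forall>\<^sub>F e in at_right 0. \<forall>x\<in>S \<inter> cball 0 R. e * \<bar>inner d x\<bar> \<le> inner x x - inner v x"
    proof (intro eventually_ball_finite ballI)
      show "finite (S \<inter> cball 0 R)" using lf by (auto intro: locally_finite_setsD)
      fix x assume x: "x \<in> S \<inter> cball 0 R"
      show "\<forall>\<^sub>F e in at_right 0. e * \<bar>inner d x\<bar> \<le> inner x x - inner v x"
      proof (cases "x \<in> F")
        case True
        then show ?thesis using d(2)[OF True] by (simp add: F_def)
      next
        case False
        then have pos: "inner x x - inner v x > 0" using le[of x] x by (auto simp: F_def less_le)
        have "((\<lambda>e. e * \<bar>inner d x\<bar>) \<longlongrightarrow> 0 * \<bar>inner d x\<bar>) (at_right 0)"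
          by (intro tendsto_intros)
        then have "\<forall>\<^sub>F e in at_right 0. e * \<bar>inner d x\<bar> < inner x x - inner v x"
          using pos by (intro order_tendstoD(2)) auto
        then show ?thesis by (rule eventually_mono) simp
      qed
    qed
    moreover have "\<forall>\<^sub>F e::real in at_right 0. e * norm d \<le> 1"
    proof -
      have "((\<lambda>e::real. e * norm d) \<longlongrightarrow> 0 * norm d) (at_right 0)" by (intro tendsto_intros)
      then have "\<forall>\<^sub>F e::real in at_right 0. e * norm d < 1" by (intro order_tendstoD(2)) auto
      then show ?thesis by (rule eventually_mono) simp
    qed
    moreover have "\<forall>\<^sub>F e::real in at_right 0. e > 0" by (rule eventually_at_right_less)
    ultimately have "\<forall>\<^sub>F e::real in at_right 0. e > 0 \<and> e * norm d \<le> 1 \<and>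
        (\<forall>x\<in>S \<inter> cball 0 R. e * \<bar>inner d x\<bar> \<le> inner x x - inner v x)"
      by eventually_elim simp
    then obtain e where e: "e > 0" "e * norm d \<le> 1"
      "\<And>x. x \<in> S \<inter> cball 0 R \<Longrightarrow> e * \<bar>inner d x\<bar> \<le> inner x x - inner v x"
      by (auto dest!: eventually_happens'[OF trivial_limit_at_right_real])
    have in_cell: "v + s *\<^sub>R d \<in> crofton_cell S" if s: "\<bar>s\<bar> = e" for s
      unfolding crofton_cell_def mem_half_plane INT_iff
    proof
      fix x assume x: "x \<in> S"
      have "s * inner d x \<le> e * \<bar>inner d x\<bar>" using s by (metis abs_ge_self abs_mult)
      also have "\<dots> \<le> inner x x - inner v x"
      proof (cases "x \<in> cball 0 R")
        case True then show ?thesis using e(3) x by simp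
      next
        case False
        then have nx: "norm x \<ge> norm v + 1" by (simp add: R_def)
        have "e * \<bar>inner d x\<bar> \<le> e * (norm d * norm x)"
          using e(1) Cauchy_Schwarz_ineq2[of d x] by (intro mult_left_mono) auto
        also have "\<dots> \<le> norm x" using mult_right_mono[OF e(2), of "norm x"] by (simp add: mult.assoc)
        also have "\<dots> \<le> norm x * (norm x - norm v)" using mult_left_mono[of 1 "norm x - norm v" "norm x"] nx by simp
        also have "\<dots> \<le> inner x x - inner v x"
          using norm_cauchy_schwarz[of v x] by (simp add: algebra_simps power2_norm_eq_inner[symmetric] power2_eq_square)
        finally show ?thesis .
      qed
      finally show "inner (v + s *\<^sub>R d) x \<le> inner x x" by (simp add: inner_add_left)
    qed
    have "midpoint (v + e *\<^sub>R d) (v + (-e) *\<^sub>R d) = v" by (simp add: midpoint_def scaleR_2[symmetric])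
    moreover have "v + e *\<^sub>R d \<noteq> v + (-e) *\<^sub>R d" using e(1) d(1) by (simp add: equation_minus_iff)
    ultimately have "v \<in> open_segment (v + e *\<^sub>R d) (v + (-e) *\<^sub>R d)"
      using midpoint_in_open_segment[of "v + e *\<^sub>R d" "v + (-e) *\<^sub>R d"] by simp
    then show False using ext in_cell[of e] in_cell[of "-e"] e(1) by (auto simp: extreme_point_of_def)
  qed
next
  assume "v \<in> vertices S"
  then obtain x y where vC: "v \<in> crofton_cell S" and xy: "x \<in> S" "y \<in> S" "Im (cnj x * y) > 0"
    and on: "inner v x = inner x x" "inner v y = inner y y" by (auto simp: vertices_def)
  have uniq: "w = v" if "inner w x = inner x x" "inner w y = inner y y" for w
    using meet_iff[of x y w] meet_iff[of x y v] xy(3) on that by simp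
  \<comment> \<open>A convex combination with positive weights of two nonnegative slacks vanishes
    only if both slacks do.\<close>
  have on_line: "inner a z = inner z z \<and> inner b z = inner z z"
    if "a \<in> crofton_cell S" "b \<in> crofton_cell S" "0 < u" "u < 1" "v = (1 - u) *\<^sub>R a + u *\<^sub>R b"
      "z \<in> S" "inner v z = inner z z" for a b u z
  proof -
    have le: "inner a z \<le> inner z z" "inner b z \<le> inner z z"
      using that by (auto simp: crofton_cell_def mem_half_plane)
    have "(1 - u) * (inner z z - inner a z) + u * (inner z z - inner b z) = 0"
      using that(7) unfolding that(5) by (simp add: inner_add_left algebra_simps)
    moreover have "(1 - u) * (inner z z - inner a z) \<ge> 0" "u * (inner z z - inner b z) \<ge> 0"
      using le that(3,4) by simp_all
    ultimately have "(1 - u) * (inner z z - inner a z) = 0" "u * (inner z z - inner b z) = 0"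
      by linarith+
    then show ?thesis using that(3,4) by simp
  qed
  show "v extreme_point_of crofton_cell S"
    unfolding extreme_point_of_def
  proof (intro conjI vC ballI notI)
    fix a b assume ab: "a \<in> crofton_cell S" "b \<in> crofton_cell S" "v \<in> open_segment a b"
    then obtain u where u: "a \<noteq> b" "0 < u" "u < 1" "v = (1 - u) *\<^sub>R a + u *\<^sub>R b"
      by (auto simp: in_segment)
    have "a = v" "b = v"
      using on_line[OF ab(1,2) u(2-4) xy(1) on(1)] on_line[OF ab(1,2) u(2-4) xy(2) on(2)] uniq[of a] uniq[of b]
      by simp_all
    then show False using u(1) by simp
  qed
qed

lemma extreme_point_of_linear_image:
  assumes f: "linear f" "inj f"
  shows "f x extreme_point_of (f ` P) \<longleftrightarrow> x extreme_point_of P"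
  by (simp add: extreme_point_of_def open_segment_linear_image[OF f] inj_image_mem_iff[OF f(2)])

text \<open>Rotation is linear and injective and therefore preserves extreme points. What remains is
  the cell of \<Phi> with one deterministic foot at angle 0.\<close>

lemma num_vertices_conditioned_cell:
  assumes "S \<in> locally_finite_sets"
  shows "num_vertices (conditioned_cell r S \<theta>) = card (vertices (insert (of_real r) S))"
proof -
  let ?f = "\<lambda>z. cis \<theta> * z"
  have f: "linear ?f" "inj ?f"
    by (auto intro!: linearI injI simp: algebra_simps)
  have eq: "crofton_cell S \<inter> half_plane (rcis r 0) = crofton_cell (insert (of_real r) S)"
    by (auto simp: crofton_cell_def)
  have "{v. v extreme_point_of (conditioned_cell r S \<theta>)} = ?f ` {v. v extreme_point_of (crofton_cell (insert (of_real r) S))}"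
    unfolding conditioned_cell_def eq
  proof (intro set_eqI iffI)
    fix v assume "v \<in> {v. v extreme_point_of ?f ` crofton_cell (insert (of_real r) S)}"
    then have v: "v extreme_point_of ?f ` crofton_cell (insert (of_real r) S)" by simp
    then obtain z where "v = ?f z" by (auto simp: extreme_point_of_def)
    then show "v \<in> ?f ` {v. v extreme_point_of crofton_cell (insert (of_real r) S)}"
      using v extreme_point_of_linear_image[OF f, of z] by simp
  next
    fix v assume "v \<in> ?f ` {v. v extreme_point_of crofton_cell (insert (of_real r) S)}"
    then obtain z where "v = ?f z" "z extreme_point_of crofton_cell (insert (of_real r) S)" by blast
    then show "v \<in> {v. v extreme_point_of ?f ` crofton_cell (insert (of_real r) S)}"
      using extreme_point_of_linear_image[OF f, of z] by simp
  qed
  also have "{v. v extreme_point_of (crofton_cell (insert (of_real r) S))} = vertices (insert (of_real r) S)"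
    using extreme_point_of_crofton_cell_iff[OF locally_finite_sets_insert[OF assms]] by auto
  finally show ?thesis
    unfolding num_vertices_def by (simp add: card_image[OF inj_on_subset[OF f(2) subset_UNIV]])
qed

text \<open>Among three points of a line the middle one lies in the open segment between the others,
  so it cannot be an extreme point. With \<open>c = r\<close> this limits the number of vertices on
  the deterministic line.\<close>

lemma vertices_on_vertical_line:
  assumes "S \<in> locally_finite_sets"
  shows "ecard {v \<in> vertices S. Re v = c} \<le> 2"
proof -
  let ?E = "{v \<in> vertices S. Re v = c}"
  have no3: False if "a \<in> ?E" "b \<in> ?E" "d \<in> ?E" "Im a < Im b" "Im b < Im d" for a b d
  proof -
    have ext: "b extreme_point_of crofton_cell S" "a \<in> crofton_cell S" "d \<in> crofton_cell S"
      using that extreme_point_of_crofton_cell_iff[OF assms, of b] by (simp_all add: vertices_def)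
    define u where "u = (Im b - Im a) / (Im d - Im a)"
    have u: "0 < u" "u < 1" "u * (Im d - Im a) = Im b - Im a" using that(4,5) by (simp_all add: u_def)
    have re: "Re a = c" "Re b = c" "Re d = c" using that(1-3) by simp_all
    have "b = (1 - u) *\<^sub>R a + u *\<^sub>R d"
      using u(3) re by (simp add: complex_eq_iff algebra_simps)
    moreover have "a \<noteq> d" using that(4,5) by auto
    ultimately have "b \<in> open_segment a d" using u(1,2) unfolding in_segment by blast
    then show False using ext unfolding extreme_point_of_def by blast
  qed
  have no3': "card T \<noteq> 3" if "T \<subseteq> ?E" for T
  proof
    assume "card T = 3"
    then obtain a b d where T: "T = {a, b, d}" "a \<noteq> b" "b \<noteq> d" "a \<noteq> d" by (auto simp: card_3_iff)
    then have "Im a \<noteq> Im b" "Im b \<noteq> Im d" "Im a \<noteq> Im d" using that by (auto simp: complex_eq_iff)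
    moreover have E: "a \<in> ?E" "b \<in> ?E" "d \<in> ?E" using that T by auto
    ultimately show False
      using no3[OF E(1,2,3)] no3[OF E(1,3,2)] no3[OF E(2,1,3)] no3[OF E(2,3,1)] no3[OF E(3,1,2)] no3[OF E(3,2,1)]
      by linarith
  qed
  have fin: "finite ?E" using no3' infinite_arbitrarily_large[of ?E 3] by metis
  moreover have "card ?E \<le> 2"
  proof (rule ccontr)
    assume "\<not> card ?E \<le> 2"
    then obtain T where "T \<subseteq> ?E" "card T = 3" using obtain_subset_with_card_n[of 3 ?E] by auto
    then show False using no3'[of T] by simp
  qed
  ultimately have "ecard ?E = of_nat (card ?E)" by (simp add: emeasure_count_space)
  also have "\<dots> \<le> of_nat 2" using \<open>card ?E \<le> 2\<close> by (intro of_nat_mono)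
  finally show ?thesis by simp
qed

lemma norm_le_of_on_line:
  assumes "inner v x = inner x x" shows "norm x \<le> norm (v :: complex)"
  using subsetD[OF closed_cut_disk_subset[of v], of x] assms by (simp add: closed_cut_disk_def)

text \<open>The foot of a line is its point closest to the origin, so vertices in a ball come from
  pairs of the finitely many feet in the same ball.\<close>

lemma locally_finite_vertices:
  assumes "S \<in> locally_finite_sets" shows "vertices S \<in> locally_finite_sets"
  unfolding locally_finite_sets_def
proof safe
  fix B :: "complex set" assume "bounded B"
  then obtain R where R: "\<And>z. z \<in> B \<Longrightarrow> norm z \<le> R" by (auto simp: bounded_iff)
  have "vertices S \<inter> B \<subseteq> (\<lambda>(x, y). meet x y) ` ((S \<inter> cball 0 R) \<times> (S \<inter> cball 0 R))"
  proof
    fix v assume v: "v \<in> vertices S \<inter> B"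
    then obtain x y where xy: "x \<in> S" "y \<in> S" "Im (cnj x * y) > 0" "inner v x = inner x x" "inner v y = inner y y"
      by (auto simp: vertices_def)
    moreover have "v = meet x y" using xy meet_iff[of x y v] by simp
    moreover have "norm x \<le> R" "norm y \<le> R"
      using xy v R[of v] norm_le_of_on_line[of v x] norm_le_of_on_line[of v y] by simp_all
    ultimately show "v \<in> (\<lambda>(x, y). meet x y) ` ((S \<inter> cball 0 R) \<times> (S \<inter> cball 0 R))" by auto
  qed
  moreover have "finite ((S \<inter> cball 0 R) \<times> (S \<inter> cball 0 R))"
    using assms by (intro finite_cartesian_product) (auto intro: locally_finite_setsD)
  ultimately show "finite (vertices S \<inter> B)" by (rule finite_subset[OF _ finite_imageI])
qed

text \<open>The event of having no vertex in \<open>B\<close> involves three nested quantifiers: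
  over the two crossing lines and over the lines that might cut off their crossing. They are
  eliminated from the inside outwards.\<close>

lemma measurable_vertices:
  assumes \<Psi>: "\<Psi> \<in> Q \<rightarrow>\<^sub>M configurations"
  shows "(\<lambda>q. vertices (\<Psi> q)) \<in> Q \<rightarrow>\<^sub>M configurations"
proof (rule measurable_configurationsI)
  show "vertices (\<Psi> q) \<in> locally_finite_sets" if "q \<in> space Q" for q
    using measurable_space[OF \<Psi> that] by (auto intro: locally_finite_vertices)
  fix B :: "complex set" assume [measurable]: "B \<in> sets borel"
  have \<Psi>1: "(\<lambda>q. \<Psi> (fst q)) \<in> Q \<Otimes>\<^sub>M borel \<rightarrow>\<^sub>M configurations"
    using \<Psi> by measurable
  have \<Psi>2: "(\<lambda>q. \<Psi> (fst (fst q))) \<in> (Q \<Otimes>\<^sub>M borel) \<Otimes>\<^sub>M borel \<rightarrow>\<^sub>M configurations"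
    using \<Psi> by measurable
  have "Measurable.pred ((Q \<Otimes>\<^sub>M borel) \<Otimes>\<^sub>M borel)
     (\<lambda>p. \<exists>z\<in>\<Psi> (fst (fst p)). (\<lambda>q. inner (snd q) (snd q) < inner (meet (snd (fst (fst q))) (snd (fst q))) (snd q)) (p, z))"
    by (rule measurable_count_space_pred[OF \<Psi>2]) measurable
  then have [measurable]: "Measurable.pred ((Q \<Otimes>\<^sub>M borel) \<Otimes>\<^sub>M borel)
     (\<lambda>p. \<exists>z\<in>\<Psi> (fst (fst p)). inner z z < inner (meet (snd (fst p)) (snd p)) z)" by simp
  have "Measurable.pred (Q \<Otimes>\<^sub>M borel) (\<lambda>p. \<exists>y\<in>\<Psi> (fst p). (\<lambda>q. Im (cnj (snd (fst q)) * snd q) > 0 \<and>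
     meet (snd (fst q)) (snd q) \<in> B \<and> \<not> (\<exists>z\<in>\<Psi> (fst (fst q)). inner z z < inner (meet (snd (fst q)) (snd q)) z)) (p, y))"
    by (rule measurable_count_space_pred[OF \<Psi>1]) measurable
  then have [measurable]: "Measurable.pred (Q \<Otimes>\<^sub>M borel) (\<lambda>p. \<exists>y\<in>\<Psi> (fst p). Im (cnj (snd p) * y) > 0 \<and>
     meet (snd p) y \<in> B \<and> \<not> (\<exists>z\<in>\<Psi> (fst p). inner z z < inner (meet (snd p) y) z))" by simp
  have [measurable]: "Measurable.pred Q (\<lambda>p. \<exists>x\<in>\<Psi> p. (\<lambda>p. \<exists>y\<in>\<Psi> (fst p). Im (cnj (snd p) * y) > 0 \<and>
     meet (snd p) y \<in> B \<and> \<not> (\<exists>z\<in>\<Psi> (fst p). inner z z < inner (meet (snd p) y) z)) (p, x))"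
    by (rule measurable_count_space_pred[OF \<Psi>]) measurable
  have "{q \<in> space Q. vertices (\<Psi> q) \<inter> B = {}}
    = {q \<in> space Q. \<not> (\<exists>x\<in>\<Psi> q. (\<lambda>p. \<exists>y\<in>\<Psi> (fst p). Im (cnj (snd p) * y) > 0 \<and>
     meet (snd p) y \<in> B \<and> \<not> (\<exists>z\<in>\<Psi> (fst p). inner z z < inner (meet (snd p) y) z)) (q, x))}"
    by (simp only: vertices_altdef cut_disk_def disjoint_iff mem_Collect_eq fst_conv snd_conv) blast
  also have "\<dots> \<in> sets Q" by measurable
  finally show "{q \<in> space Q. vertices (\<Psi> q) \<inter> B = {}} \<in> sets Q" .
qed

section \<open>Vertices counted through ordered pairs of lines\<close>

lemma iterated_count_space_indicator:
  fixes S :: "'a set"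
  shows "(\<integral>\<^sup>+x. \<integral>\<^sup>+y. (if P x y then 1 else 0) \<partial>count_space S \<partial>count_space S)
    = ecard {(x, y). x \<in> S \<and> y \<in> S \<and> P x y}"
proof -
  have "(\<integral>\<^sup>+x. \<integral>\<^sup>+y. (if P x y then 1 else 0) \<partial>count_space S \<partial>count_space S)
    = (\<integral>\<^sup>+x. \<integral>\<^sup>+y. indicator {(x, y). x \<in> S \<and> y \<in> S \<and> P x y} (x, y) \<partial>count_space UNIV \<partial>count_space UNIV)"
    unfolding nn_integral_count_space_indicator[of S, simplified]
    by (subst nn_integral_multc[symmetric]) (auto intro!: nn_integral_cong simp: indicator_def)
  also have "\<dots> = ecard {(x, y). x \<in> S \<and> y \<in> S \<and> P x y}"
    by (subst nn_integral_fst_count_space) simp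
  finally show ?thesis .
qed

text \<open>Every vertex is the crossing of at least one pair; concurrent lines only increase the
  number of pairs.\<close>

lemma ecard_vertices_le:
  "ecard (vertices S \<inter> B) \<le> (\<integral>\<^sup>+x. \<integral>\<^sup>+y. (if Im (cnj x * y) > 0 \<and> meet x y \<in> B \<and>
     S \<inter> cut_disk (meet x y) = {} then 1 else 0) \<partial>count_space S \<partial>count_space S)"
proof -
  let ?P = "{(x, y). x \<in> S \<and> y \<in> S \<and> Im (cnj x * y) > 0 \<and> meet x y \<in> B \<and> S \<inter> cut_disk (meet x y) = {}}"
  have "vertices S \<inter> B \<subseteq> (\<lambda>(x, y). meet x y) ` ?P" by (auto simp: vertices_altdef)
  then have "ecard (vertices S \<inter> B) \<le> ecard ((\<lambda>(x, y). meet x y) ` ?P)" by (rule emeasure_mono) simp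
  also have "\<dots> \<le> ecard ?P" by (rule ecard_image_le)
  finally show ?thesis unfolding iterated_count_space_indicator .
qed

text \<open>Pairs whose intersection point lies on no third line are determined by it.\<close>

lemma ecard_vertices_ge:
  "(\<integral>\<^sup>+x. \<integral>\<^sup>+y. (if Im (cnj x * y) > 0 \<and> meet x y \<in> B \<and>
     S \<inter> closed_cut_disk (meet x y) \<subseteq> {x, y} then 1 else 0) \<partial>count_space S \<partial>count_space S)
    \<le> ecard (vertices S \<inter> B)"
proof -
  let ?P = "{(x, y). x \<in> S \<and> y \<in> S \<and> Im (cnj x * y) > 0 \<and> meet x y \<in> B \<and> S \<inter> closed_cut_disk (meet x y) \<subseteq> {x, y}}"
  let ?m = "\<lambda>(x, y). meet x y"
  have on: "inner (meet x y) x = inner x x \<and> inner (meet x y) y = inner y y" if "Im (cnj x * y) > 0" for x y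
    using meet_iff[of x y "meet x y"] that by simp
  have "inj_on ?m ?P"
  proof (rule inj_onI)
    fix p p' assume p: "p \<in> ?P" "p' \<in> ?P" "?m p = ?m p'"
    obtain x y where xy: "p = (x, y)" by (cases p)
    obtain x' y' where xy': "p' = (x', y')" by (cases p')
    have P: "x \<in> S" "y \<in> S" "Im (cnj x * y) > 0" "S \<inter> closed_cut_disk (meet x y) \<subseteq> {x, y}"
      and P': "x' \<in> S" "y' \<in> S" "Im (cnj x' * y') > 0" "meet x y = meet x' y'"
      using p unfolding xy xy' by simp_all
    \<comment> \<open>Lines through the common point have their feet in its closed disk, which
      contains no feet but \<open>x\<close> and \<open>y\<close>. The sign of the determinant then
      fixes the order.\<close>
    have "{x', y'} \<subseteq> {x, y}" using P on[OF P'(3)] P' by (auto simp: closed_cut_disk_def)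
    moreover have "x' \<noteq> y'" using P'(3) by auto
    moreover have "Im (cnj y * x) < 0" using P(3) by (simp add: algebra_simps)
    ultimately have "x = x' \<and> y = y'" using P'(3) by auto
    then show "p = p'" by (simp add: xy xy')
  qed
  then have "ecard ?P = ecard (?m ` ?P)" by (rule ecard_inj_on_image[symmetric])
  also have "\<dots> \<le> ecard (vertices S \<inter> B)"
  proof (rule emeasure_mono)
    show "?m ` ?P \<subseteq> vertices S \<inter> B"
    proof (rule image_subsetI)
      fix p assume p: "p \<in> ?P"
      obtain x y where xy: "p = (x, y)" by (cases p)
      have P: "x \<in> S" "y \<in> S" "Im (cnj x * y) > 0" "meet x y \<in> B" "S \<inter> closed_cut_disk (meet x y) \<subseteq> {x, y}"
        using p unfolding xy by simp_all
      have "S \<inter> cut_disk (meet x y) = {}"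
        using P(5) on[OF P(3)] cut_disk_subset[of "meet x y"] by (fastforce simp: cut_disk_def)
      then show "?m p \<in> vertices S \<inter> B" using P unfolding xy vertices_altdef by auto
    qed
  qed simp
  finally show ?thesis unfolding iterated_count_space_indicator .
qed

lemma measurable_void_pred:
  fixes D :: "('b::topological_space \<times> 'c::topological_space \<times> complex) set"
  assumes [measurable]: "Measurable.pred (borel \<Otimes>\<^sub>M borel \<Otimes>\<^sub>M borel) (\<lambda>q. q \<in> D)"
  shows "Measurable.pred (borel \<Otimes>\<^sub>M borel \<Otimes>\<^sub>M configurations) (\<lambda>(x, y, S). \<exists>z\<in>S. (x, y, z) \<in> D)"
proof -
  have "(\<lambda>q. snd (snd q)) \<in> borel \<Otimes>\<^sub>M borel \<Otimes>\<^sub>M configurations \<rightarrow>\<^sub>M (configurations :: complex set measure)"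
    by measurable
  moreover have "Measurable.pred ((borel \<Otimes>\<^sub>M borel \<Otimes>\<^sub>M (configurations :: complex set measure)) \<Otimes>\<^sub>M borel)
      (\<lambda>q. (fst (fst q), fst (snd (fst q)), snd q) \<in> D)"
    by measurable
  ultimately have "Measurable.pred (borel \<Otimes>\<^sub>M borel \<Otimes>\<^sub>M configurations)
    (\<lambda>q. \<exists>z\<in>snd (snd q). (\<lambda>q. (fst (fst q), fst (snd (fst q)), snd q) \<in> D) (q, z))"
    by (rule measurable_count_space_pred)
  then show ?thesis by (simp add: case_prod_beta')
qed

context poisson_process
begin

text \<open>In the Mecke formula the two inserted feet lie on the circle bounding the open disk and
  not in the disk, so the inner expectation is exactly a void probability.\<close>

lemma expected_vertices_le:
  assumes [measurable]: "B \<in> sets borel"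
  shows "(\<integral>\<^sup>+\<omega>. ecard (vertices (\<Phi> \<omega>) \<inter> B) \<partial>M)
    \<le> (\<integral>\<^sup>+x. \<integral>\<^sup>+y. (if Im (cnj x * y) > 0 \<and> meet x y \<in> B
          then ennreal (exp (- measure \<mu> (cut_disk (meet x y)))) else 0) \<partial>\<mu> \<partial>\<mu>)"
proof -
  define g where "g = (\<lambda>(x, y, S). if Im (cnj x * y) > 0 \<and> meet x y \<in> B \<and> S \<inter> cut_disk (meet x y) = {} then 1 else 0 :: ennreal)"
  have [measurable]: "Measurable.pred (borel \<Otimes>\<^sub>M borel \<Otimes>\<^sub>M configurations)
     (\<lambda>(x, y, S). \<exists>z\<in>S. (x, y, z) \<in> {(x, y, z). inner z z < inner (meet x y) z})"
    by (rule measurable_void_pred) measurable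
  have "g = (\<lambda>q. if Im (cnj (fst q) * fst (snd q)) > 0 \<and> meet (fst q) (fst (snd q)) \<in> B \<and>
     \<not> (\<lambda>(x, y, S). \<exists>z\<in>S. (x, y, z) \<in> {(x, y, z). inner z z < inner (meet x y) z}) q then 1 else 0)"
    by (auto simp: g_def cut_disk_def fun_eq_iff)
  also have "\<dots> \<in> borel_measurable (borel \<Otimes>\<^sub>M borel \<Otimes>\<^sub>M configurations)" by measurable
  finally have g: "g \<in> borel_measurable (borel \<Otimes>\<^sub>M borel \<Otimes>\<^sub>M configurations)" .
  have "(\<integral>\<^sup>+\<omega>. ecard (vertices (\<Phi> \<omega>) \<inter> B) \<partial>M)
    \<le> (\<integral>\<^sup>+\<omega>. \<integral>\<^sup>+x. \<integral>\<^sup>+y. g (x, y, \<Phi> \<omega>) \<partial>count_space (\<Phi> \<omega>) \<partial>count_space (\<Phi> \<omega>) \<partial>M)"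
    unfolding g_def prod.case by (intro nn_integral_mono ecard_vertices_le)
  also have "\<dots> = (\<integral>\<^sup>+x. \<integral>\<^sup>+y. \<integral>\<^sup>+\<omega>. g (x, y, insert x (insert y (\<Phi> \<omega>))) \<partial>M \<partial>\<mu> \<partial>\<mu>)"
    by (rule mecke2[OF g]) (simp add: g_def)
  also have "\<dots> = (\<integral>\<^sup>+x. \<integral>\<^sup>+y. (if Im (cnj x * y) > 0 \<and> meet x y \<in> B
          then ennreal (exp (- measure \<mu> (cut_disk (meet x y)))) else 0) \<partial>\<mu> \<partial>\<mu>)"
  proof (intro nn_integral_cong)
    fix x y
    show "(\<integral>\<^sup>+\<omega>. g (x, y, insert x (insert y (\<Phi> \<omega>))) \<partial>M) = (if Im (cnj x * y) > 0 \<and> meet x y \<in> B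
          then ennreal (exp (- measure \<mu> (cut_disk (meet x y)))) else 0)"
    proof (cases "Im (cnj x * y) > 0 \<and> meet x y \<in> B")
      case True
      then have "x \<notin> cut_disk (meet x y)" "y \<notin> cut_disk (meet x y)"
        using meet_iff[of x y "meet x y"] by (auto simp: cut_disk_def)
      then have "(\<integral>\<^sup>+\<omega>. g (x, y, insert x (insert y (\<Phi> \<omega>))) \<partial>M)
        = (\<integral>\<^sup>+\<omega>. indicator {\<omega> \<in> space M. \<Phi> \<omega> \<inter> cut_disk (meet x y) = {}} \<omega> \<partial>M)"
        using True by (intro nn_integral_cong) (auto simp: g_def)
      also have "\<dots> = ennreal (exp (- measure \<mu> (cut_disk (meet x y))))"
        by (simp add: void_event emeasure_eq_measure prob_void bounded_cut_disk)
      finally show ?thesis using True by simp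
    qed (auto simp: g_def)
  qed
  finally show ?thesis .
qed

text \<open>The inserted feet are the permitted exceptions in the closed disk; that \<Phi> itself
  avoids this disk is sufficient, and its void probability is a lower bound.\<close>

lemma expected_vertices_ge:
  assumes [measurable]: "B \<in> sets borel"
  shows "(\<integral>\<^sup>+x. \<integral>\<^sup>+y. (if Im (cnj x * y) > 0 \<and> meet x y \<in> B
          then ennreal (exp (- measure \<mu> (closed_cut_disk (meet x y)))) else 0) \<partial>\<mu> \<partial>\<mu>)
    \<le> (\<integral>\<^sup>+\<omega>. ecard (vertices (\<Phi> \<omega>) \<inter> B) \<partial>M)"
proof -
  define g where "g = (\<lambda>(x, y, S). if Im (cnj x * y) > 0 \<and> meet x y \<in> B \<and> S \<inter> closed_cut_disk (meet x y) \<subseteq> {x, y} then 1 else 0 :: ennreal)"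
  have [measurable]: "Measurable.pred (borel \<Otimes>\<^sub>M borel \<Otimes>\<^sub>M configurations)
     (\<lambda>(x, y, S). \<exists>z\<in>S. (x, y, z) \<in> {(x, y, z). inner z z \<le> inner (meet x y) z \<and> z \<noteq> x \<and> z \<noteq> y})"
    by (rule measurable_void_pred) measurable
  have "g = (\<lambda>q. if Im (cnj (fst q) * fst (snd q)) > 0 \<and> meet (fst q) (fst (snd q)) \<in> B \<and>
     \<not> (\<lambda>(x, y, S). \<exists>z\<in>S. (x, y, z) \<in> {(x, y, z). inner z z \<le> inner (meet x y) z \<and> z \<noteq> x \<and> z \<noteq> y}) q then 1 else 0)"
    by (auto simp: g_def closed_cut_disk_def fun_eq_iff)
  also have "\<dots> \<in> borel_measurable (borel \<Otimes>\<^sub>M borel \<Otimes>\<^sub>M configurations)" by measurable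
  finally have g: "g \<in> borel_measurable (borel \<Otimes>\<^sub>M borel \<Otimes>\<^sub>M configurations)" .
  have "(\<integral>\<^sup>+x. \<integral>\<^sup>+y. (if Im (cnj x * y) > 0 \<and> meet x y \<in> B
          then ennreal (exp (- measure \<mu> (closed_cut_disk (meet x y)))) else 0) \<partial>\<mu> \<partial>\<mu>)
    \<le> (\<integral>\<^sup>+x. \<integral>\<^sup>+y. \<integral>\<^sup>+\<omega>. g (x, y, insert x (insert y (\<Phi> \<omega>))) \<partial>M \<partial>\<mu> \<partial>\<mu>)"
  proof (intro nn_integral_mono)
    fix x y
    show "(if Im (cnj x * y) > 0 \<and> meet x y \<in> B
          then ennreal (exp (- measure \<mu> (closed_cut_disk (meet x y)))) else 0)
      \<le> (\<integral>\<^sup>+\<omega>. g (x, y, insert x (insert y (\<Phi> \<omega>))) \<partial>M)"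
    proof (cases "Im (cnj x * y) > 0 \<and> meet x y \<in> B")
      case True
      have "ennreal (exp (- measure \<mu> (closed_cut_disk (meet x y))))
         = (\<integral>\<^sup>+\<omega>. indicator {\<omega> \<in> space M. \<Phi> \<omega> \<inter> closed_cut_disk (meet x y) = {}} \<omega> \<partial>M)"
        by (simp add: void_event emeasure_eq_measure prob_void bounded_cut_disk)
      also have "\<dots> \<le> (\<integral>\<^sup>+\<omega>. g (x, y, insert x (insert y (\<Phi> \<omega>))) \<partial>M)"
        using True by (intro nn_integral_mono) (auto simp: g_def indicator_def)
      finally show ?thesis using True by simp
    qed auto
  qed
  also have "\<dots> = (\<integral>\<^sup>+\<omega>. \<integral>\<^sup>+x. \<integral>\<^sup>+y. g (x, y, \<Phi> \<omega>) \<partial>count_space (\<Phi> \<omega>) \<partial>count_space (\<Phi> \<omega>) \<partial>M)"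
    by (rule mecke2[OF g, symmetric]) (simp add: g_def)
  also have "\<dots> \<le> (\<integral>\<^sup>+\<omega>. ecard (vertices (\<Phi> \<omega>) \<inter> B) \<partial>M)"
    unfolding g_def prod.case by (intro nn_integral_mono ecard_vertices_ge)
  finally show ?thesis .
qed

end

section \<open>The expected number of vertices\<close>

lemma borel_measurable_rcis [measurable]:
  assumes [measurable]: "f \<in> borel_measurable M" "g \<in> borel_measurable M"
  shows "(\<lambda>x. rcis (f x) (g x)) \<in> borel_measurable M"
proof -
  have "(\<lambda>x. cis (g x)) \<in> borel_measurable M"
    by (rule borel_measurable_continuous_on[of cis]) (auto intro: continuous_on_cis continuous_on_id)
  then show ?thesis unfolding rcis_def by measurable
qed

lemmas lborel_Fubini = pair_sigma_finite.Fubini'[OF lborel_pair.pair_sigma_finite_axioms]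

abbreviation turn :: "real set" where
  "turn \<equiv> {0..<2 * pi}"

lemma nn_integral_polar:
  assumes [measurable]: "f \<in> borel_measurable borel"
  shows "(\<integral>\<^sup>+x. f x \<partial>polar_intensity r)
    = (\<integral>\<^sup>+\<theta>. \<integral>\<^sup>+\<rho>. indicator turn \<theta> * (indicator {r<..} \<rho> * f (rcis \<rho> \<theta>)) \<partial>lborel \<partial>lborel)"
proof -
  have "(\<lambda>(\<rho>, \<theta>). rcis \<rho> \<theta>) \<in> borel_measurable (borel :: (real \<times> real) measure)"
    unfolding borel_prod[symmetric] by measurable
  then have m: "(\<lambda>(\<rho>, \<theta>). rcis \<rho> \<theta>) \<in> borel_measurable (density lborel (indicator ({r<..} \<times> turn)))"
    by simp
  have S: "{r<..} \<times> turn \<in> sets (borel :: (real \<times> real) measure)"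
    unfolding borel_prod[symmetric] by auto
  have "(\<integral>\<^sup>+x. f x \<partial>polar_intensity r)
    = (\<integral>\<^sup>+p. indicator ({r<..} \<times> turn) p * f (case p of (\<rho>, \<theta>) \<Rightarrow> rcis \<rho> \<theta>) \<partial>lborel)"
    unfolding polar_intensity_def using S m
    by (subst nn_integral_distr) (auto simp: nn_integral_density)
  also have "\<dots> = (\<integral>\<^sup>+p. indicator turn (snd p) * (indicator {r<..} (fst p) * f (rcis (fst p) (snd p))) \<partial>(lborel \<Otimes>\<^sub>M lborel))"
    unfolding lborel_prod by (intro nn_integral_cong) (auto simp: indicator_def split: prod.splits)
  also have "\<dots> = (\<integral>\<^sup>+\<theta>. \<integral>\<^sup>+\<rho>. indicator turn \<theta> * (indicator {r<..} \<rho> * f (rcis \<rho> \<theta>)) \<partial>lborel \<partial>lborel)"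
    by (subst lborel_pair.nn_integral_snd[symmetric]) simp_all
  finally show ?thesis .
qed

lemma nn_integral_shift:
  fixes f :: "real \<Rightarrow> ennreal"
  assumes "f \<in> borel_measurable borel"
  shows "(\<integral>\<^sup>+x. f (x + c) \<partial>lborel) = (\<integral>\<^sup>+x. f x \<partial>lborel)"
  using nn_integral_real_affine[OF assms, of 1 c] by (simp add: add.commute)

lemma nn_integral_periodic:
  fixes f :: "real \<Rightarrow> ennreal"
  assumes [measurable]: "f \<in> borel_measurable borel" and p: "\<And>x. f (x + 2 * pi) = f x"
  shows "(\<integral>\<^sup>+x. indicator {a..<a + 2 * pi} x * f x \<partial>lborel) = (\<integral>\<^sup>+x. indicator turn x * f x \<partial>lborel)"
proof -
  define F where "F a = (\<integral>\<^sup>+x. indicator {a..<a + 2 * pi} x * f x \<partial>lborel)" for a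
  \<comment> \<open>A shift by at most one period cuts off a piece on the left and adds its
    translate on the right.\<close>
  have step: "F (a + c) = F a" if c: "0 \<le> c" "c \<le> 2 * pi" for a c
  proof -
    have "F (a + c) = (\<integral>\<^sup>+x. indicator {a + c..<a + 2 * pi} x * f x + indicator {a + 2 * pi..<a + c + 2 * pi} x * f x \<partial>lborel)"
      unfolding F_def using c by (intro nn_integral_cong) (auto simp: indicator_def)
    also have "\<dots> = (\<integral>\<^sup>+x. indicator {a + c..<a + 2 * pi} x * f x \<partial>lborel) + (\<integral>\<^sup>+x. indicator {a + 2 * pi..<a + c + 2 * pi} x * f x \<partial>lborel)"
      by (intro nn_integral_add) auto
    also have "(\<integral>\<^sup>+x. indicator {a + 2 * pi..<a + c + 2 * pi} x * f x \<partial>lborel)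
        = (\<integral>\<^sup>+x. indicator {a + 2 * pi..<a + c + 2 * pi} (x + 2 * pi) * f (x + 2 * pi) \<partial>lborel)"
      by (rule nn_integral_shift[symmetric]) measurable
    also have "\<dots> = (\<integral>\<^sup>+x. indicator {a..<a + c} x * f x \<partial>lborel)"
      by (intro nn_integral_cong) (auto simp: indicator_def p)
    also have "(\<integral>\<^sup>+x. indicator {a + c..<a + 2 * pi} x * f x \<partial>lborel) + (\<integral>\<^sup>+x. indicator {a..<a + c} x * f x \<partial>lborel)
        = (\<integral>\<^sup>+x. indicator {a + c..<a + 2 * pi} x * f x + indicator {a..<a + c} x * f x \<partial>lborel)"
      by (intro nn_integral_add[symmetric]) auto
    also have "\<dots> = F a"
      unfolding F_def using c by (intro nn_integral_cong) (auto simp: indicator_def)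
    finally show ?thesis .
  qed
  have steps: "F (a + real n * c) = F a" if "0 \<le> c" "c \<le> 2 * pi" for a c n
  proof (induction n)
    case (Suc n)
    have "F (a + real (Suc n) * c) = F ((a + real n * c) + c)" by (simp add: algebra_simps)
    then show ?case using step[OF that] Suc by simp
  qed simp
  \<comment> \<open>A longer shift is split into \<open>n\<close> equal shifts, each of at most one
    period.\<close>
  have pos: "F (a + c) = F a" if "0 \<le> c" for a c
  proof -
    obtain n where n: "c / (2 * pi) < real n" using reals_Archimedean2 by blast
    moreover have "0 \<le> c / (2 * pi)" using that by simp
    ultimately have n0: "real n > 0" by linarith
    have "c / real n \<le> 2 * pi" using n n0 by (simp add: field_simps)
    then show ?thesis using steps[of "c / real n" a n] that n0 by simp
  qed
  have "F a = F 0" using pos[of a 0] pos[of "-a" a] by (cases "a \<ge> 0") auto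
  then show ?thesis by (simp add: F_def)
qed

lemma nn_integral_periodic_shift:
  fixes f :: "real \<Rightarrow> ennreal"
  assumes [measurable]: "f \<in> borel_measurable borel" and p: "\<And>x. f (x + 2 * pi) = f x"
  shows "(\<integral>\<^sup>+x. indicator turn x * f (x + c) \<partial>lborel) = (\<integral>\<^sup>+x. indicator turn x * f x \<partial>lborel)"
proof -
  have "(\<integral>\<^sup>+x. indicator turn x * f (x + c) \<partial>lborel)
     = (\<integral>\<^sup>+x. indicator {c..<c + 2 * pi} (x + c) * f (x + c) \<partial>lborel)"
    by (intro nn_integral_cong) (auto simp: indicator_def)
  also have "\<dots> = (\<integral>\<^sup>+x. indicator {c..<c + 2 * pi} x * f x \<partial>lborel)"
    by (rule nn_integral_shift) measurable
  also have "\<dots> = (\<integral>\<^sup>+x. indicator turn x * f x \<partial>lborel)"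
    by (rule nn_integral_periodic[OF assms])
  finally show ?thesis .
qed

section \<open>Two crossing lines in coordinates of their crossing point\<close>

lemma rcis_periodic [simp]: "rcis \<rho> (\<theta> + 2 * pi) = rcis \<rho> \<theta>"
  by (simp add: rcis_def cis.ctr)

lemma inner_rcis: "inner (rcis a \<phi>) (rcis b \<theta>) = a * b * cos (\<theta> - \<phi>)"
  by (simp add: inner_complex_def cos_diff algebra_simps)

lemma Im_cnj_rcis: "Im (cnj (rcis a \<phi>) * rcis b \<theta>) = a * b * sin (\<theta> - \<phi>)"
  by (simp add: sin_diff algebra_simps)

text \<open>Converts the position \<tau> along a line into polar coordinates of the point: from a
  foot at distance \<rho>, the point is at distance R = \<rho> sqrt(1 + \<tau>^2) and turned by
  arctan \<tau>.\<close>

lemma cis_arctan: "rcis R (\<theta> + arctan \<tau>) = of_real (R / sqrt (1 + \<tau>\<^sup>2)) * (1 + \<i> * of_real \<tau>) * cis \<theta>"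
  by (simp add: complex_eq_iff cos_add sin_add cos_arctan sin_arctan algebra_simps add_divide_distrib diff_divide_distrib)

text \<open>The condition on \<rho>' says that the line with normal direction \<theta> + \<delta>
  passes through the given point of the first line, so this point satisfies both line
  equations.\<close>

lemma meet_rcis:
  assumes "\<rho> > 0" "\<rho>' > 0" "sin \<delta> \<noteq> 0" and \<rho>': "\<rho>' = \<rho> * (cos \<delta> + \<tau> * sin \<delta>)"
  shows "meet (rcis \<rho> \<theta>) (rcis \<rho>' (\<theta> + \<delta>)) = of_real \<rho> * (1 + \<i> * of_real \<tau>) * cis \<theta>"
proof -
  let ?v = "of_real \<rho> * (1 + \<i> * of_real \<tau>) * cis \<theta>"
  have c: "cos \<theta> * cos \<theta> + sin \<theta> * sin \<theta> = 1"
    using sin_cos_squared_add3[of \<theta>] by simp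
  have "inner ?v (rcis \<rho> \<theta>) = \<rho> * \<rho> * (cos \<theta> * cos \<theta> + sin \<theta> * sin \<theta>)"
    by (simp add: inner_complex_def algebra_simps del: sin_cos_squared_add3)
  then have 1: "inner ?v (rcis \<rho> \<theta>) = inner (rcis \<rho> \<theta>) (rcis \<rho> \<theta>)" unfolding c inner_rcis by simp
  have "inner ?v (rcis \<rho>' (\<theta> + \<delta>)) = \<rho> * \<rho>' * (cos \<delta> + \<tau> * sin \<delta>) * (cos \<theta> * cos \<theta> + sin \<theta> * sin \<theta>)"
    by (simp add: inner_complex_def cos_add sin_add algebra_simps del: sin_cos_squared_add3)
  then have 2: "inner ?v (rcis \<rho>' (\<theta> + \<delta>)) = inner (rcis \<rho>' (\<theta> + \<delta>)) (rcis \<rho>' (\<theta> + \<delta>))"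
    unfolding c inner_rcis by (simp add: \<rho>')
  have "Im (cnj (rcis \<rho> \<theta>) * rcis \<rho>' (\<theta> + \<delta>)) \<noteq> 0"
    unfolding Im_cnj_rcis using assms(1-3) by simp
  from meet_iff[OF this, of ?v] 1 2 show ?thesis by simp
qed

lemma sin_pos_iff:
  assumes "0 \<le> \<delta>" "\<delta> < 2 * pi" shows "sin \<delta> > 0 \<longleftrightarrow> 0 < \<delta> \<and> \<delta> < pi"
proof
  assume "sin \<delta> > 0"
  then have "\<delta> \<noteq> 0" by auto
  moreover have "\<delta> < pi"
  proof (rule ccontr)
    assume "\<not> \<delta> < pi"
    then have "sin (\<delta> - pi) \<ge> 0" using assms by (intro sin_ge_zero) auto
    then show False using \<open>sin \<delta> > 0\<close> by (simp add: sin_diff)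
  qed
  ultimately show "0 < \<delta> \<and> \<delta> < pi" using assms by auto
qed (auto intro: sin_gt_zero)

text \<open>The second line makes the angle \<open>\<delta>\<close> with the first one, whose foot is \<open>(\<rho>, \<theta>)\<close>, and they
  meet at distance \<open>\<rho> \<bar>\<tau>\<bar>\<close> from that foot. In these coordinates all changes of variables are affine.\<close>

lemma nn_integral_second_line:
  fixes H :: "complex \<Rightarrow> ennreal"
  assumes [measurable]: "H \<in> borel_measurable borel" and r: "r > 0" "\<rho> > r"
  shows "(\<integral>\<^sup>+y. (if Im (cnj (rcis \<rho> \<theta>) * y) > 0 then H (meet (rcis \<rho> \<theta>) y) else 0) \<partial>polar_intensity r)
    = (\<integral>\<^sup>+\<delta>. \<integral>\<^sup>+\<tau>. ennreal (if 0 < \<delta> \<and> \<delta> < pi \<and> \<rho> * (cos \<delta> + \<tau> * sin \<delta>) > r then \<rho> * sin \<delta> else 0)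
        * H (of_real \<rho> * (1 + \<i> * of_real \<tau>) * cis \<theta>) \<partial>lborel \<partial>lborel)"
proof -
  let ?F = "\<lambda>y. if Im (cnj (rcis \<rho> \<theta>) * y) > 0 then H (meet (rcis \<rho> \<theta>) y) else 0"
  define G where "G \<delta> = (\<integral>\<^sup>+\<rho>'. indicator {r<..} \<rho>' * ?F (rcis \<rho>' \<delta>) \<partial>lborel)" for \<delta>
  have [measurable]: "G \<in> borel_measurable borel" unfolding G_def by measurable
  have "(\<integral>\<^sup>+y. ?F y \<partial>polar_intensity r)
     = (\<integral>\<^sup>+\<theta>'. \<integral>\<^sup>+\<rho>'. indicator turn \<theta>' * (indicator {r<..} \<rho>' * ?F (rcis \<rho>' \<theta>')) \<partial>lborel \<partial>lborel)"
    by (rule nn_integral_polar) measurable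
  also have "\<dots> = (\<integral>\<^sup>+\<theta>'. indicator turn \<theta>' * G \<theta>' \<partial>lborel)"
    unfolding G_def by (intro nn_integral_cong nn_integral_cmult) measurable
  also have "\<dots> = (\<integral>\<^sup>+\<delta>. indicator turn \<delta> * G (\<delta> + \<theta>) \<partial>lborel)"
    by (rule nn_integral_periodic_shift[symmetric]) (measurable, simp only: G_def rcis_periodic)
  also have "\<dots> = (\<integral>\<^sup>+\<delta>. \<integral>\<^sup>+\<tau>. ennreal (if 0 < \<delta> \<and> \<delta> < pi \<and> \<rho> * (cos \<delta> + \<tau> * sin \<delta>) > r then \<rho> * sin \<delta> else 0)
        * H (of_real \<rho> * (1 + \<i> * of_real \<tau>) * cis \<theta>) \<partial>lborel \<partial>lborel)"
  proof (rule nn_integral_cong)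
    fix \<delta>
    show "indicator turn \<delta> * G (\<delta> + \<theta>) = (\<integral>\<^sup>+\<tau>. ennreal (if 0 < \<delta> \<and> \<delta> < pi \<and> \<rho> * (cos \<delta> + \<tau> * sin \<delta>) > r then \<rho> * sin \<delta> else 0)
        * H (of_real \<rho> * (1 + \<i> * of_real \<tau>) * cis \<theta>) \<partial>lborel)"
    proof (cases "0 < \<delta> \<and> \<delta> < pi")
      case False
      have zero: "indicator turn \<delta> * (indicator {r<..} \<rho>' * ?F (rcis \<rho>' (\<delta> + \<theta>))) = 0" for \<rho>'
      proof (cases "\<delta> \<in> turn \<and> \<rho>' > r")
        case True
        then have "\<not> sin \<delta> > 0" using False sin_pos_iff[of \<delta>] by auto
        then have "\<not> Im (cnj (rcis \<rho> \<theta>) * rcis \<rho>' (\<delta> + \<theta>)) > 0"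
          unfolding Im_cnj_rcis not_less using True r by (intro mult_nonneg_nonpos) auto
        then show ?thesis by (simp del: complex_mult_cnj)
      qed auto
      have "indicator turn \<delta> * G (\<delta> + \<theta>)
        = (\<integral>\<^sup>+\<rho>'. indicator turn \<delta> * (indicator {r<..} \<rho>' * ?F (rcis \<rho>' (\<delta> + \<theta>))) \<partial>lborel)"
        unfolding G_def by (rule nn_integral_cmult[symmetric]) measurable
      also have "\<dots> = 0" unfolding zero by simp
      finally have "indicator turn \<delta> * G (\<delta> + \<theta>) = 0" .
      then show ?thesis using False by auto
    next
      case True
      then have s: "sin \<delta> > 0" by (simp add: sin_gt_zero)
      have c: "\<rho> * sin \<delta> \<noteq> 0" "\<rho> * sin \<delta> \<ge> 0" using s r by auto
      \<comment> \<open>For fixed \<delta> the distance \<rho>' of the second line is affine in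
        \<tau> with slope \<open>\<rho> * sin \<delta>\<close>; this slope is the Jacobian.\<close>
      have "G (\<delta> + \<theta>) = \<bar>\<rho> * sin \<delta>\<bar> * (\<integral>\<^sup>+\<tau>. indicator {r<..} (\<rho> * cos \<delta> + \<rho> * sin \<delta> * \<tau>) * ?F (rcis (\<rho> * cos \<delta> + \<rho> * sin \<delta> * \<tau>) (\<delta> + \<theta>)) \<partial>lborel)"
        unfolding G_def by (rule nn_integral_real_affine[OF _ c(1)]) measurable
      also have "\<dots> = (\<integral>\<^sup>+\<tau>. ennreal (\<rho> * sin \<delta>) * (indicator {r<..} (\<rho> * cos \<delta> + \<rho> * sin \<delta> * \<tau>) * ?F (rcis (\<rho> * cos \<delta> + \<rho> * sin \<delta> * \<tau>) (\<delta> + \<theta>))) \<partial>lborel)"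
        using c by (subst nn_integral_cmult) auto
      also have "\<dots> = (\<integral>\<^sup>+\<tau>. ennreal (if 0 < \<delta> \<and> \<delta> < pi \<and> \<rho> * (cos \<delta> + \<tau> * sin \<delta>) > r then \<rho> * sin \<delta> else 0)
        * H (of_real \<rho> * (1 + \<i> * of_real \<tau>) * cis \<theta>) \<partial>lborel)"
      proof (rule nn_integral_cong)
        fix \<tau> :: real
        define \<rho>' where "\<rho>' = \<rho> * (cos \<delta> + \<tau> * sin \<delta>)"
        have \<rho>'_eq: "\<rho> * cos \<delta> + \<rho> * sin \<delta> * \<tau> = \<rho>'" by (simp add: \<rho>'_def algebra_simps)
        show "ennreal (\<rho> * sin \<delta>) * (indicator {r<..} (\<rho> * cos \<delta> + \<rho> * sin \<delta> * \<tau>) * ?F (rcis (\<rho> * cos \<delta> + \<rho> * sin \<delta> * \<tau>) (\<delta> + \<theta>)))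
          = ennreal (if 0 < \<delta> \<and> \<delta> < pi \<and> \<rho> * (cos \<delta> + \<tau> * sin \<delta>) > r then \<rho> * sin \<delta> else 0)
           * H (of_real \<rho> * (1 + \<i> * of_real \<tau>) * cis \<theta>)"
        proof (cases "\<rho>' > r")
          case gt: True
          have "Im (cnj (rcis \<rho> \<theta>) * rcis \<rho>' (\<delta> + \<theta>)) > 0"
            unfolding Im_cnj_rcis using r gt s by simp
          moreover have "meet (rcis \<rho> \<theta>) (rcis \<rho>' (\<delta> + \<theta>)) = of_real \<rho> * (1 + \<i> * of_real \<tau>) * cis \<theta>"
            using meet_rcis[of \<rho> \<rho>' \<delta> \<tau> \<theta>] r gt s by (simp add: \<rho>'_def add.commute)
          ultimately show ?thesis
            unfolding \<rho>'_eq \<rho>'_def[symmetric] using True gt by simp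
        next
          case False
          then show ?thesis unfolding \<rho>'_eq \<rho>'_def[symmetric] by simp
        qed
      qed
      finally show ?thesis using True by simp
    qed
  qed
  finally show ?thesis .
qed

text \<open>With \<open>\<alpha> = arccos (r / R)\<close>, the directions of the lines at distance more than \<open>r\<close> through a
  point at distance \<open>R\<close> fill an interval of length \<open>2\<alpha>\<close>; \<open>vertex_angle\<close> is the tangent of \<open>\<alpha>\<close>.\<close>

definition vertex_tan :: "real \<Rightarrow> real \<Rightarrow> real" where
  "vertex_tan r R = sqrt ((R / r)\<^sup>2 - 1)"

text \<open>R times the integral of sin(b - a) over directions -\<alpha> < a < b < \<alpha>. The
  factor sin(b - a) is the density of crossing points for two lines at that angle, so this is the
  density of ordered crossings at distance R, before weighting by the void probability.\<close>

abbreviation vertex_weight :: "real \<Rightarrow> real \<Rightarrow> real" where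
  "vertex_weight r R \<equiv> R * (2 * arctan (vertex_tan r R) - sin (2 * arctan (vertex_tan r R)))"

lemma vertex_tan:
  assumes "r > 0" "R > r"
  shows "vertex_tan r R > 0" "cos (arctan (vertex_tan r R)) = r / R"
    "sin (arctan (vertex_tan r R)) = vertex_tan r R * r / R"
    "0 < arctan (vertex_tan r R)" "arctan (vertex_tan r R) < pi / 2"
proof -
  have R: "R / r > 1" using assms by simp
  then have sq: "(R / r)\<^sup>2 > 1" by (simp add: one_less_power)
  then show pos: "vertex_tan r R > 0" by (simp add: vertex_tan_def)
  have "sqrt (1 + (vertex_tan r R)\<^sup>2) = R / r" using sq R assms by (simp add: vertex_tan_def real_sqrt_abs)
  then show "cos (arctan (vertex_tan r R)) = r / R" "sin (arctan (vertex_tan r R)) = vertex_tan r R * r / R"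
    by (simp_all add: cos_arctan sin_arctan)
  show "0 < arctan (vertex_tan r R)" using pos by simp
  show "arctan (vertex_tan r R) < pi / 2" by (rule arctan_ubound)
qed

text \<open>Beyond \<pi> and up to 3\<pi>/2 the cosine is at most 0, hence below cos \<alpha>; on
  [0, \<pi>] it is decreasing. The wide range covers differences of two angles without reduction to
  one period.\<close>

lemma cos_gt_cos_iff:
  assumes "0 < \<alpha>" "\<alpha> < pi / 2" "- (3 * pi / 2) < x" "x < 3 * pi / 2"
  shows "cos x > cos \<alpha> \<longleftrightarrow> \<bar>x\<bar> < \<alpha>"
proof -
  have "cos \<bar>x\<bar> > cos \<alpha> \<longleftrightarrow> \<bar>x\<bar> < \<alpha>"
  proof (cases "\<bar>x\<bar> \<le> pi")
    case True
    then show ?thesis using assms cos_mono_less_eq[of \<alpha> "\<bar>x\<bar>"] by simp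
  next
    case False
    have "\<bar>x\<bar> < 3 * pi / 2" using assms by linarith
    then have "sin (\<bar>x\<bar> - pi / 2) \<ge> 0" using False by (intro sin_ge_zero) auto
    then have "cos \<bar>x\<bar> \<le> 0" by (simp add: sin_diff)
    moreover have "cos \<alpha> > 0" using assms by (intro cos_gt_zero) auto
    ultimately show ?thesis using False assms by linarith
  qed
  then show ?thesis by simp
qed

text \<open>With \<beta> = arctan \<tau>, the first line is farther than r from the origin iff
  |\<beta>| < \<alpha>, and then the second one is iff \<delta> < \<alpha> + \<beta>. The region is
  thus elementary and both integrals have antiderivatives.\<close>

lemma nn_integral_angles:
  assumes r: "r > 0" "R > r"
  shows "(\<integral>\<^sup>+\<tau>. \<integral>\<^sup>+\<delta>. ennreal (if 0 < \<delta> \<and> \<delta> < pi \<and> R / sqrt (1 + \<tau>\<^sup>2) > r \<and>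
       R / sqrt (1 + \<tau>\<^sup>2) * (cos \<delta> + \<tau> * sin \<delta>) > r then R / (1 + \<tau>\<^sup>2) * sin \<delta> else 0) \<partial>lborel \<partial>lborel)
     = ennreal (vertex_weight r R)"
proof -
  define \<sigma> where "\<sigma> = vertex_tan r R"
  define \<alpha> where "\<alpha> = arctan \<sigma>"
  have \<alpha>: "0 < \<alpha>" "\<alpha> < pi / 2" and cos\<alpha>: "cos \<alpha> = r / R" and tan\<alpha>: "tan \<alpha> = \<sigma>"
    using vertex_tan[OF r] by (simp_all add: \<alpha>_def \<sigma>_def tan_arctan)
  have \<sigma>: "\<sigma> > 0" using vertex_tan(1)[OF r] by (simp add: \<sigma>_def)
  have R: "R > 0" using r by simp
  have nz: "1 + t\<^sup>2 \<noteq> 0" for t :: real using zero_le_power2[of t] by linarith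
  have inner: "(\<integral>\<^sup>+\<delta>. ennreal (if 0 < \<delta> \<and> \<delta> < pi \<and> R / sqrt (1 + \<tau>\<^sup>2) > r \<and>
       R / sqrt (1 + \<tau>\<^sup>2) * (cos \<delta> + \<tau> * sin \<delta>) > r then R / (1 + \<tau>\<^sup>2) * sin \<delta> else 0) \<partial>lborel)
     = ennreal (R / (1 + \<tau>\<^sup>2) * (1 - cos (\<alpha> + arctan \<tau>))) * indicator {-\<sigma><..<\<sigma>} \<tau>" for \<tau>
  proof -
    define \<beta> where "\<beta> = arctan \<tau>"
    have \<beta>: "- (pi / 2) < \<beta>" "\<beta> < pi / 2" using arctan_bounded by (auto simp: \<beta>_def)
    have k: "R / sqrt (1 + \<tau>\<^sup>2) = R * cos \<beta>" by (simp add: \<beta>_def cos_arctan)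
    have "R / sqrt (1 + \<tau>\<^sup>2) > r \<longleftrightarrow> cos \<beta> > cos \<alpha>"
      unfolding k cos\<alpha> using R by (simp add: field_simps)
    also have "\<dots> \<longleftrightarrow> \<bar>\<beta>\<bar> < \<alpha>" using \<alpha> \<beta> by (intro cos_gt_cos_iff) auto
    finally have c1: "R / sqrt (1 + \<tau>\<^sup>2) > r \<longleftrightarrow> \<bar>\<beta>\<bar> < \<alpha>" .
    have "\<bar>\<beta>\<bar> < \<alpha> \<longleftrightarrow> \<tau> \<in> {-\<sigma><..<\<sigma>}"
      using arctan_less_iff[of \<tau> \<sigma>] arctan_less_iff[of "-\<sigma>" \<tau>] by (auto simp: \<beta>_def \<alpha>_def abs_less_iff arctan_minus)
    note c1 = c1 this
    have c2: "R / sqrt (1 + \<tau>\<^sup>2) * (cos \<delta> + \<tau> * sin \<delta>) > r \<longleftrightarrow> \<delta> < \<alpha> + \<beta>" if "0 < \<delta>" "\<delta> < pi" "\<bar>\<beta>\<bar> < \<alpha>" for \<delta>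
    proof -
      have "\<tau> * cos \<beta> = sin \<beta>" by (simp add: \<beta>_def cos_arctan sin_arctan)
      then have "R / sqrt (1 + \<tau>\<^sup>2) * (cos \<delta> + \<tau> * sin \<delta>) = R * cos (\<delta> - \<beta>)"
        unfolding k by (simp add: cos_diff algebra_simps)
      then have "R / sqrt (1 + \<tau>\<^sup>2) * (cos \<delta> + \<tau> * sin \<delta>) > r \<longleftrightarrow> cos (\<delta> - \<beta>) > cos \<alpha>"
        unfolding cos\<alpha> using R by (simp add: field_simps)
      also have "\<dots> \<longleftrightarrow> \<bar>\<delta> - \<beta>\<bar> < \<alpha>" using \<alpha> \<beta> that by (intro cos_gt_cos_iff) auto
      also have "\<dots> \<longleftrightarrow> \<delta> < \<alpha> + \<beta>" using that by auto
      finally show ?thesis .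
    qed
    show ?thesis
    proof (cases "\<bar>\<beta>\<bar> < \<alpha>")
      case False
      then have "\<not> R / sqrt (1 + \<tau>\<^sup>2) > r" "\<tau> \<notin> {-\<sigma><..<\<sigma>}" using c1 by blast+
      then show ?thesis by simp
    next
      case True
      have "(\<integral>\<^sup>+\<delta>. ennreal (if 0 < \<delta> \<and> \<delta> < pi \<and> R / sqrt (1 + \<tau>\<^sup>2) > r \<and>
         R / sqrt (1 + \<tau>\<^sup>2) * (cos \<delta> + \<tau> * sin \<delta>) > r then R / (1 + \<tau>\<^sup>2) * sin \<delta> else 0) \<partial>lborel)
        = (\<integral>\<^sup>+\<delta>. ennreal (R / (1 + \<tau>\<^sup>2) * sin \<delta>) * indicator {0..\<alpha> + \<beta>} \<delta> \<partial>lborel)"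
      proof (rule nn_integral_cong_AE)
        have "AE \<delta> in lborel. \<delta> \<noteq> \<alpha> + \<beta>" by (rule AE_lborel_singleton)
        moreover have "AE \<delta> in lborel. \<delta> \<noteq> 0" by (rule AE_lborel_singleton)
        ultimately show "AE \<delta> in lborel. ennreal (if 0 < \<delta> \<and> \<delta> < pi \<and> R / sqrt (1 + \<tau>\<^sup>2) > r \<and>
         R / sqrt (1 + \<tau>\<^sup>2) * (cos \<delta> + \<tau> * sin \<delta>) > r then R / (1 + \<tau>\<^sup>2) * sin \<delta> else 0)
           = ennreal (R / (1 + \<tau>\<^sup>2) * sin \<delta>) * indicator {0..\<alpha> + \<beta>} \<delta>"
        proof eventually_elim
          case (elim \<delta>)
          show ?case
          proof (cases "0 < \<delta> \<and> \<delta> < pi")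
            case d: True
            then show ?thesis using c1 c2[of \<delta>] True elim by (auto simp: indicator_def)
          next
            case False
            then have "\<delta> \<notin> {0..\<alpha> + \<beta>}" using elim \<alpha> \<beta> True by auto
            then show ?thesis using False by auto
          qed
        qed
      qed
      also have "\<dots> = ennreal (- (R / (1 + \<tau>\<^sup>2) * cos (\<alpha> + \<beta>)) - - (R / (1 + \<tau>\<^sup>2) * cos 0))"
      proof (rule nn_integral_FTC_Icc)
        fix x assume x: "x \<in> {0..\<alpha> + \<beta>}"
        show "((\<lambda>x. - (R / (1 + \<tau>\<^sup>2) * cos x)) has_real_derivative R / (1 + \<tau>\<^sup>2) * sin x) (at x)"
          by (auto intro!: derivative_eq_intros simp: nz)
        have "0 \<le> sin x" using x \<alpha> \<beta> by (intro sin_ge_zero) auto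
        then show "0 \<le> R / (1 + \<tau>\<^sup>2) * sin x" using R by simp
      qed (use True in auto)
      also have "- (R / (1 + \<tau>\<^sup>2) * cos (\<alpha> + \<beta>)) - - (R / (1 + \<tau>\<^sup>2) * cos 0) = R / (1 + \<tau>\<^sup>2) * (1 - cos (\<alpha> + \<beta>))"
        by (simp add: algebra_simps diff_divide_distrib)
      finally show ?thesis using c1 True by (simp add: \<beta>_def)
    qed
  qed
  have "(\<integral>\<^sup>+\<tau>. ennreal (R / (1 + \<tau>\<^sup>2) * (1 - cos (\<alpha> + arctan \<tau>))) * indicator {-\<sigma><..<\<sigma>} \<tau> \<partial>lborel)
     = (\<integral>\<^sup>+\<tau>. ennreal (R / (1 + \<tau>\<^sup>2) * (1 - cos (\<alpha> + arctan \<tau>))) * indicator {-\<sigma>..\<sigma>} \<tau> \<partial>lborel)"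
  proof (rule nn_integral_cong_AE)
    have "AE \<tau> in lborel. \<tau> \<noteq> \<sigma>" by (rule AE_lborel_singleton)
    moreover have "AE \<tau> in lborel. \<tau> \<noteq> -\<sigma>" by (rule AE_lborel_singleton)
    ultimately show "AE \<tau> in lborel. ennreal (R / (1 + \<tau>\<^sup>2) * (1 - cos (\<alpha> + arctan \<tau>))) * indicator {-\<sigma><..<\<sigma>} \<tau>
        = ennreal (R / (1 + \<tau>\<^sup>2) * (1 - cos (\<alpha> + arctan \<tau>))) * indicator {-\<sigma>..\<sigma>} \<tau>"
      by eventually_elim (auto simp: indicator_def)
  qed
  \<comment> \<open>The weight R / (1 + \<tau>^2) is R times the derivative of arctan, so the
    integrand is the derivative of R (\<beta> - sin(\<alpha> + \<beta>)) composed with \<beta> =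
    arctan \<tau>.\<close>
  also have "\<dots> = ennreal (R * (arctan \<sigma> - sin (\<alpha> + arctan \<sigma>)) - R * (arctan (-\<sigma>) - sin (\<alpha> + arctan (-\<sigma>))))"
  proof (rule nn_integral_FTC_Icc)
    fix x
    have "((\<lambda>x. R * (arctan x - sin (\<alpha> + arctan x))) has_real_derivative
        R * (inverse (1 + x\<^sup>2) - cos (\<alpha> + arctan x) * inverse (1 + x\<^sup>2))) (at x)"
      by (auto intro!: derivative_eq_intros)
    then show "((\<lambda>x. R * (arctan x - sin (\<alpha> + arctan x))) has_real_derivative R / (1 + x\<^sup>2) * (1 - cos (\<alpha> + arctan x))) (at x)"
      by (simp add: divide_inverse algebra_simps)
    show "0 \<le> R / (1 + x\<^sup>2) * (1 - cos (\<alpha> + arctan x))" using R by simp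
  qed (use \<sigma> in auto)
  also have "R * (arctan \<sigma> - sin (\<alpha> + arctan \<sigma>)) - R * (arctan (-\<sigma>) - sin (\<alpha> + arctan (-\<sigma>))) = R * (2 * \<alpha> - sin (2 * \<alpha>))"
    by (simp add: arctan_minus \<alpha>_def[symmetric] algebra_simps)
  finally show ?thesis unfolding inner by (simp add: \<alpha>_def \<sigma>_def)
qed

text \<open>The intensity of the feet that cut off a point at distance R: the integral of R cos t -
  r over |t| <= \<alpha> is 2 (R sin \<alpha> - r \<alpha>), and R sin \<alpha> = r tan
  \<alpha>.\<close>

definition cut_measure :: "real \<Rightarrow> real \<Rightarrow> real" where
  "cut_measure r R = 2 * r * (vertex_tan r R - arctan (vertex_tan r R))"

lemma borel_measurable_vertex_tan [measurable]:
  assumes [measurable]: "f \<in> borel_measurable M" shows "(\<lambda>x. vertex_tan r (f x)) \<in> borel_measurable M"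
  unfolding vertex_tan_def by measurable

lemma borel_measurable_cut_measure [measurable]:
  assumes [measurable]: "f \<in> borel_measurable M" shows "(\<lambda>x. cut_measure r (f x)) \<in> borel_measurable M"
  unfolding cut_measure_def by measurable

text \<open>For fixed \<delta> and \<tau> the passage from the first foot to the crossing point is a
  dilation and a rotation. Moving these two integrations outside reduces the change of variables to
  a linear one in \<rho> and a shift of a periodic variable; afterwards R can be moved
  outermost.\<close>

lemma nn_integral_pairs:
  fixes H :: "complex \<Rightarrow> ennreal"
  assumes H [measurable]: "H \<in> borel_measurable borel" and r: "r > 0"
  shows "(\<integral>\<^sup>+x. \<integral>\<^sup>+y. (if Im (cnj x * y) > 0 then H (meet x y) else 0) \<partial>polar_intensity r \<partial>polar_intensity r)
    = (\<integral>\<^sup>+R. indicator {r<..} R * ennreal (vertex_weight r R) *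
        (\<integral>\<^sup>+\<theta>. indicator turn \<theta> * H (rcis R \<theta>) \<partial>lborel) \<partial>lborel)"
proof -
  define w where "w \<delta> \<tau> \<rho> = (if 0 < \<delta> \<and> \<delta> < pi \<and> \<rho> > r \<and> \<rho> * (cos \<delta> + \<tau> * sin \<delta>) > r then \<rho> * sin \<delta> else 0)"
    for \<delta> \<tau> \<rho> :: real
  define u where "u \<delta> \<tau> R = (if 0 < \<delta> \<and> \<delta> < pi \<and> R / sqrt (1 + \<tau>\<^sup>2) > r \<and>
       R / sqrt (1 + \<tau>\<^sup>2) * (cos \<delta> + \<tau> * sin \<delta>) > r then R / (1 + \<tau>\<^sup>2) * sin \<delta> else 0)"
    for \<delta> \<tau> R :: real
  define F where "F \<theta> \<rho> \<delta> \<tau> = indicator turn \<theta> * (ennreal (w \<delta> \<tau> \<rho>) * H (of_real \<rho> * (1 + \<i> * of_real \<tau>) * cis \<theta>))"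
    for \<theta> \<rho> \<delta> \<tau> :: real
  define Hbar where "Hbar R = (\<integral>\<^sup>+\<theta>. indicator turn \<theta> * H (rcis R \<theta>) \<partial>lborel)" for R
  have [measurable]: "Hbar \<in> borel_measurable borel" unfolding Hbar_def by measurable
  have cism [measurable]: "(\<lambda>x. cis (f x)) \<in> borel_measurable N" if [measurable]: "f \<in> borel_measurable N" for f :: "'z \<Rightarrow> real" and N
    using borel_measurable_rcis[of "\<lambda>_. 1" N f] by (simp add: cis_rcis_eq)
  have [measurable]: "(\<lambda>x. F (a x) (b x) (c x) (d x)) \<in> borel_measurable N"
    if [measurable]: "a \<in> borel_measurable N" "b \<in> borel_measurable N" "c \<in> borel_measurable N" "d \<in> borel_measurable N"
    for a b c d :: "'z \<Rightarrow> real" and N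
    unfolding F_def w_def by measurable
  have [measurable]: "(\<lambda>x. u (a x) (b x) (c x)) \<in> borel_measurable N"
    if [measurable]: "a \<in> borel_measurable N" "b \<in> borel_measurable N" "c \<in> borel_measurable N"
    for a b c :: "'z \<Rightarrow> real" and N
    unfolding u_def by measurable
  let ?f = "\<lambda>x. \<integral>\<^sup>+y. (if Im (cnj x * y) > 0 then H (meet x y) else 0) \<partial>polar_intensity r"
  have [measurable]: "?f \<in> borel_measurable borel"
    by (subst nn_integral_polar) measurable
  have "(\<integral>\<^sup>+x. ?f x \<partial>polar_intensity r)
    = (\<integral>\<^sup>+\<theta>. \<integral>\<^sup>+\<rho>. indicator turn \<theta> * (indicator {r<..} \<rho> * ?f (rcis \<rho> \<theta>)) \<partial>lborel \<partial>lborel)"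
    by (rule nn_integral_polar) measurable
  also have "\<dots> = (\<integral>\<^sup>+\<theta>. \<integral>\<^sup>+\<rho>. \<integral>\<^sup>+\<delta>. \<integral>\<^sup>+\<tau>. F \<theta> \<rho> \<delta> \<tau> \<partial>lborel \<partial>lborel \<partial>lborel \<partial>lborel)"
  proof (intro nn_integral_cong)
    fix \<theta> \<rho>
    show "indicator turn \<theta> * (indicator {r<..} \<rho> * ?f (rcis \<rho> \<theta>)) = (\<integral>\<^sup>+\<delta>. \<integral>\<^sup>+\<tau>. F \<theta> \<rho> \<delta> \<tau> \<partial>lborel \<partial>lborel)"
    proof (cases "\<rho> > r")
      case True
      have "?f (rcis \<rho> \<theta>) = (\<integral>\<^sup>+\<delta>. \<integral>\<^sup>+\<tau>. ennreal (w \<delta> \<tau> \<rho>) * H (of_real \<rho> * (1 + \<i> * of_real \<tau>) * cis \<theta>) \<partial>lborel \<partial>lborel)"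
        using nn_integral_second_line[OF H r True, of \<theta>] True by (simp add: w_def)
      moreover have "indicator turn \<theta> * (\<integral>\<^sup>+\<delta>. \<integral>\<^sup>+\<tau>. ennreal (w \<delta> \<tau> \<rho>) * H (of_real \<rho> * (1 + \<i> * of_real \<tau>) * cis \<theta>) \<partial>lborel \<partial>lborel)
          = (\<integral>\<^sup>+\<delta>. \<integral>\<^sup>+\<tau>. F \<theta> \<rho> \<delta> \<tau> \<partial>lborel \<partial>lborel)"
        by (auto simp: F_def indicator_def)
      ultimately show ?thesis using True by simp
    next
      case False
      then show ?thesis by (simp add: F_def w_def)
    qed
  qed
  also have "\<dots> = (\<integral>\<^sup>+\<theta>. \<integral>\<^sup>+\<delta>. \<integral>\<^sup>+\<rho>. \<integral>\<^sup>+\<tau>. F \<theta> \<rho> \<delta> \<tau> \<partial>lborel \<partial>lborel \<partial>lborel \<partial>lborel)"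
    by (rule nn_integral_cong) (rule lborel_Fubini, measurable)
  also have "\<dots> = (\<integral>\<^sup>+\<theta>. \<integral>\<^sup>+\<delta>. \<integral>\<^sup>+\<tau>. \<integral>\<^sup>+\<rho>. F \<theta> \<rho> \<delta> \<tau> \<partial>lborel \<partial>lborel \<partial>lborel \<partial>lborel)"
    by (rule nn_integral_cong, rule nn_integral_cong) (rule lborel_Fubini, measurable)
  also have "\<dots> = (\<integral>\<^sup>+\<delta>. \<integral>\<^sup>+\<theta>. \<integral>\<^sup>+\<tau>. \<integral>\<^sup>+\<rho>. F \<theta> \<rho> \<delta> \<tau> \<partial>lborel \<partial>lborel \<partial>lborel \<partial>lborel)"
    by (rule lborel_Fubini) measurable
  also have "\<dots> = (\<integral>\<^sup>+\<delta>. \<integral>\<^sup>+\<tau>. \<integral>\<^sup>+\<theta>. \<integral>\<^sup>+\<rho>. F \<theta> \<rho> \<delta> \<tau> \<partial>lborel \<partial>lborel \<partial>lborel \<partial>lborel)"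
    by (rule nn_integral_cong) (rule lborel_Fubini, measurable)
  also have "\<dots> = (\<integral>\<^sup>+\<delta>. \<integral>\<^sup>+\<tau>. \<integral>\<^sup>+R. ennreal (u \<delta> \<tau> R) * Hbar R \<partial>lborel \<partial>lborel \<partial>lborel)"
  proof (rule nn_integral_cong, rule nn_integral_cong)
    fix \<delta> \<tau> :: real
    \<comment> \<open>The crossing point is at distance R = \<rho> / k. The weight is proportional
      to \<rho> = k R and the substitution contributes another k, whence R / (1 + \<tau>^2) in
      \<open>u\<close>.\<close>
    define k where "k = 1 / sqrt (1 + \<tau>\<^sup>2)"
    have "0 < 1 + \<tau>\<^sup>2" by (simp add: add_pos_nonneg)
    then have k: "k > 0" "k * k = 1 / (1 + \<tau>\<^sup>2)" by (simp_all add: k_def)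
    have kw: "k * w \<delta> \<tau> (k * R) = u \<delta> \<tau> R" for R
    proof -
      have e: "R / sqrt (1 + \<tau>\<^sup>2) = k * R" "R / (1 + \<tau>\<^sup>2) = k * (k * R)"
        using k(2) by (simp_all add: k_def flip: mult.assoc)
      show ?thesis unfolding w_def u_def e by simp
    qed
    have kF: "ennreal k * F \<theta> (0 + k * R) \<delta> \<tau> = indicator turn \<theta> * (ennreal (u \<delta> \<tau> R) * H (rcis R (\<theta> + arctan \<tau>)))" for \<theta> R
    proof -
      have "ennreal k * ennreal (w \<delta> \<tau> (k * R)) = ennreal (u \<delta> \<tau> R)"
        using k kw[of R] by (metis ennreal_mult' less_imp_le)
      moreover have "rcis R (\<theta> + arctan \<tau>) = of_real (k * R) * (1 + \<i> * of_real \<tau>) * cis \<theta>"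
        unfolding cis_arctan k_def by simp
      ultimately show ?thesis unfolding F_def by (simp add: mult.left_commute flip: mult.assoc[of "ennreal k"])
    qed
    have "(\<integral>\<^sup>+\<theta>. \<integral>\<^sup>+\<rho>. F \<theta> \<rho> \<delta> \<tau> \<partial>lborel \<partial>lborel)
      = (\<integral>\<^sup>+\<theta>. \<integral>\<^sup>+R. indicator turn \<theta> * (ennreal (u \<delta> \<tau> R) * H (rcis R (\<theta> + arctan \<tau>))) \<partial>lborel \<partial>lborel)"
    proof (rule nn_integral_cong)
      fix \<theta>
      have "(\<integral>\<^sup>+\<rho>. F \<theta> \<rho> \<delta> \<tau> \<partial>lborel) = ennreal \<bar>k\<bar> * (\<integral>\<^sup>+R. F \<theta> (0 + k * R) \<delta> \<tau> \<partial>lborel)"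
        using k by (intro nn_integral_real_affine) auto
      also have "\<dots> = (\<integral>\<^sup>+R. ennreal k * F \<theta> (0 + k * R) \<delta> \<tau> \<partial>lborel)"
        using k by (subst nn_integral_cmult) auto
      finally show "(\<integral>\<^sup>+\<rho>. F \<theta> \<rho> \<delta> \<tau> \<partial>lborel) = (\<integral>\<^sup>+R. indicator turn \<theta> * (ennreal (u \<delta> \<tau> R) * H (rcis R (\<theta> + arctan \<tau>))) \<partial>lborel)"
        unfolding kF .
    qed
    also have "\<dots> = (\<integral>\<^sup>+R. \<integral>\<^sup>+\<theta>. indicator turn \<theta> * (ennreal (u \<delta> \<tau> R) * H (rcis R (\<theta> + arctan \<tau>))) \<partial>lborel \<partial>lborel)"
      by (rule lborel_Fubini) measurable
    also have "\<dots> = (\<integral>\<^sup>+R. ennreal (u \<delta> \<tau> R) * Hbar R \<partial>lborel)"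
    proof (rule nn_integral_cong)
      fix R
      have "(\<integral>\<^sup>+\<theta>. indicator turn \<theta> * (ennreal (u \<delta> \<tau> R) * H (rcis R (\<theta> + arctan \<tau>))) \<partial>lborel)
        = (\<integral>\<^sup>+\<theta>. ennreal (u \<delta> \<tau> R) * (indicator turn \<theta> * H (rcis R (\<theta> + arctan \<tau>))) \<partial>lborel)"
        by (intro nn_integral_cong) (rule mult.left_commute)
      also have "\<dots> = ennreal (u \<delta> \<tau> R) * (\<integral>\<^sup>+\<theta>. indicator turn \<theta> * H (rcis R (\<theta> + arctan \<tau>)) \<partial>lborel)"
        by (rule nn_integral_cmult) measurable
      also have "(\<integral>\<^sup>+\<theta>. indicator turn \<theta> * H (rcis R (\<theta> + arctan \<tau>)) \<partial>lborel) = Hbar R"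
      proof -
        have m: "(\<lambda>\<theta>. H (rcis R \<theta>)) \<in> borel_measurable borel" by measurable
        show ?thesis unfolding Hbar_def by (rule nn_integral_periodic_shift[OF m]) (simp only: rcis_periodic)
      qed
      finally show "(\<integral>\<^sup>+\<theta>. indicator turn \<theta> * (ennreal (u \<delta> \<tau> R) * H (rcis R (\<theta> + arctan \<tau>))) \<partial>lborel)
        = ennreal (u \<delta> \<tau> R) * Hbar R" .
    qed
    finally show "(\<integral>\<^sup>+\<theta>. \<integral>\<^sup>+\<rho>. F \<theta> \<rho> \<delta> \<tau> \<partial>lborel \<partial>lborel) = (\<integral>\<^sup>+R. ennreal (u \<delta> \<tau> R) * Hbar R \<partial>lborel)" .
  qed
  also have "\<dots> = (\<integral>\<^sup>+\<delta>. \<integral>\<^sup>+R. \<integral>\<^sup>+\<tau>. ennreal (u \<delta> \<tau> R) * Hbar R \<partial>lborel \<partial>lborel \<partial>lborel)"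
    by (rule nn_integral_cong) (rule lborel_Fubini, measurable)
  also have "\<dots> = (\<integral>\<^sup>+R. \<integral>\<^sup>+\<delta>. \<integral>\<^sup>+\<tau>. ennreal (u \<delta> \<tau> R) * Hbar R \<partial>lborel \<partial>lborel \<partial>lborel)"
    by (rule lborel_Fubini) measurable
  also have "\<dots> = (\<integral>\<^sup>+R. \<integral>\<^sup>+\<tau>. \<integral>\<^sup>+\<delta>. ennreal (u \<delta> \<tau> R) * Hbar R \<partial>lborel \<partial>lborel \<partial>lborel)"
    by (rule nn_integral_cong) (rule lborel_Fubini, measurable)
  also have "\<dots> = (\<integral>\<^sup>+R. (\<integral>\<^sup>+\<tau>. \<integral>\<^sup>+\<delta>. ennreal (u \<delta> \<tau> R) \<partial>lborel \<partial>lborel) * Hbar R \<partial>lborel)"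
  proof (rule nn_integral_cong)
    fix R
    have "(\<integral>\<^sup>+\<tau>. \<integral>\<^sup>+\<delta>. ennreal (u \<delta> \<tau> R) * Hbar R \<partial>lborel \<partial>lborel) = (\<integral>\<^sup>+\<tau>. (\<integral>\<^sup>+\<delta>. ennreal (u \<delta> \<tau> R) \<partial>lborel) * Hbar R \<partial>lborel)"
      by (rule nn_integral_cong) (rule nn_integral_multc, measurable)
    also have "\<dots> = (\<integral>\<^sup>+\<tau>. \<integral>\<^sup>+\<delta>. ennreal (u \<delta> \<tau> R) \<partial>lborel \<partial>lborel) * Hbar R"
      by (rule nn_integral_multc) measurable
    finally show "(\<integral>\<^sup>+\<tau>. \<integral>\<^sup>+\<delta>. ennreal (u \<delta> \<tau> R) * Hbar R \<partial>lborel \<partial>lborel)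
      = (\<integral>\<^sup>+\<tau>. \<integral>\<^sup>+\<delta>. ennreal (u \<delta> \<tau> R) \<partial>lborel \<partial>lborel) * Hbar R" .
  qed
  also have "\<dots> = (\<integral>\<^sup>+R. indicator {r<..} R * ennreal (vertex_weight r R) * Hbar R \<partial>lborel)"
  proof (intro nn_integral_cong arg_cong2[where f="(*)"] refl)
    fix R
    show "(\<integral>\<^sup>+\<tau>. \<integral>\<^sup>+\<delta>. ennreal (u \<delta> \<tau> R) \<partial>lborel \<partial>lborel)
       = indicator {r<..} R * ennreal (vertex_weight r R)"
    proof (cases "R > r")
      case True
      then show ?thesis unfolding u_def nn_integral_angles[OF r True] by simp
    next
      case False
      \<comment> \<open>A foot is no farther out than a point on its line, so lines at distance more
        than r cannot cross within distance r.\<close>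
      have "R / sqrt (1 + \<tau>\<^sup>2) \<le> r" for \<tau>
      proof (cases "R \<ge> 0")
        case True
        then have "R / sqrt (1 + \<tau>\<^sup>2) \<le> R / 1" by (intro divide_left_mono) (auto simp: add_pos_nonneg)
        then show ?thesis using False by simp
      next
        case neg: False
        then have "R / sqrt (1 + \<tau>\<^sup>2) \<le> 0" by (intro divide_nonpos_nonneg) auto
        then show ?thesis using r by simp
      qed
      then have "u \<delta> \<tau> R = 0" for \<delta> \<tau> unfolding u_def by (simp add: not_less[symmetric])
      then show ?thesis using False by simp
    qed
  qed
  finally show ?thesis unfolding Hbar_def .
qed

section \<open>The intensity of the disk of separating lines\<close>

lemma nn_integral_cos_excess:
  assumes r: "r > 0" "R > r"
  shows "(\<integral>\<^sup>+\<theta>. indicator turn \<theta> * ennreal (R * cos (\<theta> + c) - r) \<partial>lborel) = ennreal (cut_measure r R)"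
proof -
  define \<alpha> where "\<alpha> = arctan (vertex_tan r R)"
  have \<alpha>: "0 < \<alpha>" "\<alpha> < pi / 2" and cos\<alpha>: "cos \<alpha> = r / R" and sin\<alpha>: "sin \<alpha> = vertex_tan r R * r / R"
    using vertex_tan[OF r] by (simp_all add: \<alpha>_def)
  have R: "R > 0" using r by simp
  have "(\<integral>\<^sup>+\<theta>. indicator turn \<theta> * ennreal (R * cos (\<theta> + c) - r) \<partial>lborel)
    = (\<integral>\<^sup>+\<theta>. indicator turn \<theta> * ennreal (R * cos \<theta> - r) \<partial>lborel)"
    by (rule nn_integral_periodic_shift[of "\<lambda>\<theta>. ennreal (R * cos \<theta> - r)"]) simp_all
  \<comment> \<open>A period centred at 0 keeps the support [-\<alpha>, \<alpha>] of the positive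
    part in one piece; \<open>ennreal\<close> truncates the negative values elsewhere.\<close>
  also have "\<dots> = (\<integral>\<^sup>+\<theta>. indicator {-pi..<-pi + 2 * pi} \<theta> * ennreal (R * cos \<theta> - r) \<partial>lborel)"
    by (rule nn_integral_periodic[symmetric]) simp_all
  also have "\<dots> = (\<integral>\<^sup>+\<theta>. ennreal (R * cos \<theta> - r) * indicator {-\<alpha>..\<alpha>} \<theta> \<partial>lborel)"
  proof (rule nn_integral_cong)
    fix \<theta>
    have "\<bar>\<theta>\<bar> < \<alpha> \<longleftrightarrow> cos \<theta> > cos \<alpha>" if "- pi \<le> \<theta>" "\<theta> < pi"
      using cos_gt_cos_iff[of \<alpha> \<theta>] \<alpha> that pi_gt_zero by auto
    then have "\<bar>\<theta>\<bar> < \<alpha> \<longleftrightarrow> R * cos \<theta> - r > 0" if "- pi \<le> \<theta>" "\<theta> < pi"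
      using that R by (simp add: cos\<alpha> field_simps)
    then have neg: "ennreal (R * cos \<theta> - r) = 0" if "- pi \<le> \<theta>" "\<theta> < pi" "\<theta> \<notin> {-\<alpha>..\<alpha>}"
      using that by (intro ennreal_neg) force
    have "R * cos \<alpha> - r = 0" using R by (simp add: cos\<alpha>)
    show "indicator {-pi..<-pi + 2 * pi} \<theta> * ennreal (R * cos \<theta> - r) = ennreal (R * cos \<theta> - r) * indicator {-\<alpha>..\<alpha>} \<theta>"
    proof (cases "\<theta> \<in> {-\<alpha>..\<alpha>}")
      case True
      then have "\<theta> \<in> {-pi..<-pi + 2 * pi}" using \<alpha> pi_gt_zero by auto
      then show ?thesis using True by simp
    next
      case False
      then show ?thesis using neg by (cases "- pi \<le> \<theta> \<and> \<theta> < pi") auto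
    qed
  qed
  also have "\<dots> = ennreal ((R * sin \<alpha> - r * \<alpha>) - (R * sin (- \<alpha>) - r * (- \<alpha>)))"
  proof (rule nn_integral_FTC_Icc)
    fix x assume x: "x \<in> {-\<alpha>..\<alpha>}"
    show "((\<lambda>x. R * sin x - r * x) has_real_derivative R * cos x - r) (at x)"
      by (auto intro!: derivative_eq_intros)
    have "cos \<alpha> \<le> cos \<bar>x\<bar>" using x \<alpha> by (intro cos_monotone_0_pi_le) auto
    then show "0 \<le> R * cos x - r" using R by (simp add: cos\<alpha> field_simps)
  qed (use \<alpha> in auto)
  also have "(R * sin \<alpha> - r * \<alpha>) - (R * sin (- \<alpha>) - r * (- \<alpha>)) = cut_measure r R"
  proof -
    have "R * sin \<alpha> = r * vertex_tan r R" using R by (simp add: sin\<alpha>)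
    then show ?thesis unfolding cut_measure_def \<alpha>_def[symmetric] by (simp add: algebra_simps)
  qed
  finally show ?thesis .
qed

lemma sets_polar_intensity [measurable_cong, simp]: "sets (polar_intensity r) = sets borel"
  by (simp add: polar_intensity_def)

text \<open>The ray in direction \<theta> meets the disk beyond distance r in an interval from r to
  R cos(\<theta> - \<phi>), if that is nonempty. Closing the disk adds one endpoint per ray, hence
  no measure.\<close>

lemma measure_cut_disk:
  assumes r: "r > 0" "R > r"
  shows "measure (polar_intensity r) (cut_disk (rcis R \<phi>)) = cut_measure r R"
    and "measure (polar_intensity r) (closed_cut_disk (rcis R \<phi>)) = cut_measure r R"
proof -
  have pos: "cut_measure r R \<ge> 0"
  proof -
    have "arctan (vertex_tan r R) \<le> vertex_tan r R"
      using vertex_tan(1)[OF r] by (intro arctan_le_self) simp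
    then show ?thesis using r by (simp add: cut_measure_def)
  qed
  have main: "emeasure (polar_intensity r) D = ennreal (cut_measure r R)"
    if D [measurable]: "D \<in> sets borel" and int: "\<And>\<theta>. (\<integral>\<^sup>+\<rho>. indicator {r<..} \<rho> * indicator D (rcis \<rho> \<theta>) \<partial>lborel) = ennreal (R * cos (\<theta> - \<phi>) - r)"
    for D
  proof -
    have "emeasure (polar_intensity r) D = (\<integral>\<^sup>+x. indicator D x \<partial>polar_intensity r)" by simp
    also have "\<dots> = (\<integral>\<^sup>+\<theta>. \<integral>\<^sup>+\<rho>. indicator turn \<theta> * (indicator {r<..} \<rho> * indicator D (rcis \<rho> \<theta>)) \<partial>lborel \<partial>lborel)"
      by (rule nn_integral_polar) measurable
    also have "\<dots> = (\<integral>\<^sup>+\<theta>. indicator turn \<theta> * (\<integral>\<^sup>+\<rho>. indicator {r<..} \<rho> * indicator D (rcis \<rho> \<theta>) \<partial>lborel) \<partial>lborel)"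
      by (intro nn_integral_cong nn_integral_cmult) measurable
    also have "\<dots> = ennreal (cut_measure r R)"
      unfolding int using nn_integral_cos_excess[OF r, of "-\<phi>"] by simp
    finally show ?thesis .
  qed
  have "(\<integral>\<^sup>+\<rho>. indicator {r<..} \<rho> * indicator (cut_disk (rcis R \<phi>)) (rcis \<rho> \<theta>) \<partial>lborel) = ennreal (R * cos (\<theta> - \<phi>) - r)" for \<theta>
  proof -
    have "(\<integral>\<^sup>+\<rho>. indicator {r<..} \<rho> * indicator (cut_disk (rcis R \<phi>)) (rcis \<rho> \<theta>) \<partial>lborel)
       = (\<integral>\<^sup>+\<rho>. indicator {r<..<R * cos (\<theta> - \<phi>)} \<rho> \<partial>lborel)"
      using r by (intro nn_integral_cong) (auto simp: cut_disk_def inner_rcis indicator_def mult.assoc mult.left_commute)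
    also have "\<dots> = ennreal (R * cos (\<theta> - \<phi>) - r)"
      by (cases "r \<le> R * cos (\<theta> - \<phi>)") (auto simp: ennreal_neg)
    finally show ?thesis .
  qed
  from main[OF measurable_cut_disk(1) this] show "measure (polar_intensity r) (cut_disk (rcis R \<phi>)) = cut_measure r R"
    using pos by (simp add: measure_def)
  have "(\<integral>\<^sup>+\<rho>. indicator {r<..} \<rho> * indicator (closed_cut_disk (rcis R \<phi>)) (rcis \<rho> \<theta>) \<partial>lborel) = ennreal (R * cos (\<theta> - \<phi>) - r)" for \<theta>
  proof -
    have "(\<integral>\<^sup>+\<rho>. indicator {r<..} \<rho> * indicator (closed_cut_disk (rcis R \<phi>)) (rcis \<rho> \<theta>) \<partial>lborel)
       = (\<integral>\<^sup>+\<rho>. indicator {r<..R * cos (\<theta> - \<phi>)} \<rho> \<partial>lborel)"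
      using r by (intro nn_integral_cong) (auto simp: closed_cut_disk_def inner_rcis indicator_def mult.assoc mult.left_commute)
    also have "\<dots> = ennreal (R * cos (\<theta> - \<phi>) - r)"
      by (cases "r \<le> R * cos (\<theta> - \<phi>)") (auto simp: ennreal_neg)
    finally show ?thesis .
  qed
  from main[OF measurable_cut_disk(2) this] show "measure (polar_intensity r) (closed_cut_disk (rcis R \<phi>)) = cut_measure r R"
    using pos by (simp add: measure_def)
qed

lemma measure_cut_disk_norm:
  assumes "r > 0" "norm v > r"
  shows "measure (polar_intensity r) (cut_disk v) = cut_measure r (norm v)"
    and "measure (polar_intensity r) (closed_cut_disk v) = cut_measure r (norm v)"
  using measure_cut_disk[OF assms, of "Arg v"] by (simp_all add: rcis_cmod_Arg)

lemma AE_polar_intensity: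
  assumes r: "r > 0" shows "AE x in polar_intensity r. norm x > r"
proof (rule AE_I')
  have [measurable]: "cball 0 r \<in> sets (borel :: complex measure)" by simp
  have "emeasure (polar_intensity r) (cball 0 r) = (\<integral>\<^sup>+x. indicator (cball 0 r) x \<partial>polar_intensity r)" by simp
  also have "\<dots> = (\<integral>\<^sup>+\<theta>. \<integral>\<^sup>+\<rho>. indicator turn \<theta> * (indicator {r<..} \<rho> * indicator (cball 0 r) (rcis \<rho> \<theta>)) \<partial>lborel \<partial>lborel)"
    by (rule nn_integral_polar) measurable
  also have "\<dots> = 0"
  proof -
    have zero: "indicator turn \<theta> * (indicator {r<..} \<rho> * indicator (cball 0 r) (rcis \<rho> \<theta>)) = (0::ennreal)" for \<theta> \<rho>
      using r by (auto simp: indicator_def)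
    show ?thesis unfolding zero by simp
  qed
  finally show "cball 0 r \<in> null_sets (polar_intensity r)" by (intro null_setsI) auto
qed auto

locale polar_poisson_process = poisson_process M "polar_intensity r" \<Phi>
  for M :: "'w measure" and r \<Phi> +
  assumes r_pos: "r > 0"
begin

text \<open>The upper bound with the open disk and the lower bound with the closed disk coincide by
  \<open>measure_cut_disk_norm\<close>, which also disposes of concurrent lines.\<close>

lemma expected_vertices:
  assumes B [measurable]: "B \<in> sets borel"
  shows "(\<integral>\<^sup>+\<omega>. ecard (vertices (\<Phi> \<omega>) \<inter> B) \<partial>M)
    = (\<integral>\<^sup>+R. indicator {r<..} R * ennreal (vertex_weight r R) *
        (ennreal (exp (- cut_measure r R)) * (\<integral>\<^sup>+\<theta>. indicator turn \<theta> * indicator B (rcis R \<theta>) \<partial>lborel)) \<partial>lborel)"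
    (is "_ = ?rhs")
proof -
  define H where "H v = indicator B v * ennreal (exp (- cut_measure r (norm v)))" for v :: complex
  have [measurable]: "H \<in> borel_measurable borel" unfolding H_def by measurable
  have rhs: "?rhs = (\<integral>\<^sup>+x. \<integral>\<^sup>+y. (if Im (cnj x * y) > 0 then H (meet x y) else 0) \<partial>polar_intensity r \<partial>polar_intensity r)"
    unfolding nn_integral_pairs[OF \<open>H \<in> borel_measurable borel\<close> r_pos]
  proof (rule nn_integral_cong)
    fix R
    have "(\<integral>\<^sup>+\<theta>. indicator turn \<theta> * H (rcis R \<theta>) \<partial>lborel)
      = ennreal (exp (- cut_measure r R)) * (\<integral>\<^sup>+\<theta>. indicator turn \<theta> * indicator B (rcis R \<theta>) \<partial>lborel)" if "R > r"
      using r_pos that by (subst nn_integral_cmult[symmetric]) (auto intro!: nn_integral_cong simp: H_def mult_ac)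
    then show "indicator {r<..} R * ennreal (vertex_weight r R) *
        (ennreal (exp (- cut_measure r R)) * (\<integral>\<^sup>+\<theta>. indicator turn \<theta> * indicator B (rcis R \<theta>) \<partial>lborel))
      = indicator {r<..} R * ennreal (vertex_weight r R) *
        (\<integral>\<^sup>+\<theta>. indicator turn \<theta> * H (rcis R \<theta>) \<partial>lborel)"
      by (cases "R > r") auto
  qed
  have norm_meet: "norm (meet x y) > r" if "norm x > r" "Im (cnj x * y) > 0" for x y
    using norm_le_of_on_line[of "meet x y" x] meet_iff[of x y "meet x y"] that by auto
  show ?thesis
  proof (rule antisym)
    have "(\<integral>\<^sup>+\<omega>. ecard (vertices (\<Phi> \<omega>) \<inter> B) \<partial>M)
      \<le> (\<integral>\<^sup>+x. \<integral>\<^sup>+y. (if Im (cnj x * y) > 0 \<and> meet x y \<in> B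
          then ennreal (exp (- measure (polar_intensity r) (cut_disk (meet x y)))) else 0) \<partial>polar_intensity r \<partial>polar_intensity r)"
      by (rule expected_vertices_le[OF B])
    also have "\<dots> = ?rhs"
      unfolding rhs using AE_polar_intensity[OF r_pos]
      by (intro nn_integral_cong_AE, eventually_elim)
         (auto intro!: nn_integral_cong simp: H_def norm_meet measure_cut_disk_norm[OF r_pos] simp del: times_complex.sel)
    finally show "(\<integral>\<^sup>+\<omega>. ecard (vertices (\<Phi> \<omega>) \<inter> B) \<partial>M) \<le> ?rhs" .
    have "?rhs = (\<integral>\<^sup>+x. \<integral>\<^sup>+y. (if Im (cnj x * y) > 0 \<and> meet x y \<in> B
          then ennreal (exp (- measure (polar_intensity r) (closed_cut_disk (meet x y)))) else 0) \<partial>polar_intensity r \<partial>polar_intensity r)"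
      unfolding rhs using AE_polar_intensity[OF r_pos]
      by (intro nn_integral_cong_AE, eventually_elim)
         (auto intro!: nn_integral_cong simp: H_def norm_meet measure_cut_disk_norm[OF r_pos] simp del: times_complex.sel)
    also have "\<dots> \<le> (\<integral>\<^sup>+\<omega>. ecard (vertices (\<Phi> \<omega>) \<inter> B) \<partial>M)"
      by (rule expected_vertices_ge[OF B])
    finally show "?rhs \<le> (\<integral>\<^sup>+\<omega>. ecard (vertices (\<Phi> \<omega>) \<inter> B) \<partial>M)" .
  qed
qed

end

section \<open>Asymptotics of the vertex density\<close>

lemma le_of_nonneg_derivative:
  fixes g g' :: "real \<Rightarrow> real"
  assumes "a \<le> b" and "\<And>x. a \<le> x \<Longrightarrow> x \<le> b \<Longrightarrow> (g has_real_derivative g' x) (at x)"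
    and "\<And>x. a \<le> x \<Longrightarrow> x \<le> b \<Longrightarrow> g' x \<ge> 0"
  shows "g a \<le> g b"
proof (rule DERIV_nonneg_imp_nondecreasing[OF assms(1)])
  fix x assume "a \<le> x" "x \<le> b"
  then show "\<exists>y. (g has_real_derivative y) (at x) \<and> 0 \<le> y"
    using assms(2,3) by (intro exI[of _ "g' x"]) simp
qed

lemma nn_integral_substitution_atLeast:
  fixes f :: "real \<Rightarrow> ennreal" and g g' :: "real \<Rightarrow> real"
  assumes f [measurable]: "f \<in> borel_measurable borel"
    and g [measurable]: "g \<in> borel_measurable borel" "g' \<in> borel_measurable borel"
    and deriv: "\<And>x. x \<ge> 0 \<Longrightarrow> (g has_real_derivative g' x) (at x)"
    and cont: "continuous_on {0..} g'" and nonneg: "\<And>x. x \<ge> 0 \<Longrightarrow> g' x \<ge> 0"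
    and lim: "filterlim g at_top at_top"
  shows "(\<integral>\<^sup>+x. f x * indicator {g 0..} x \<partial>lborel) = (\<integral>\<^sup>+x. f (g x) * ennreal (g' x) * indicator {0..} x \<partial>lborel)"
proof -
  have mono: "g x \<le> g y" if "0 \<le> x" "x \<le> y" for x y
    using that deriv nonneg by (intro le_of_nonneg_derivative[of x y g g']) simp_all
  \<comment> \<open>\<open>Suc n\<close> keeps the intervals nondegenerate; they exhaust the
    half-line because \<open>g\<close> tends to infinity.\<close>
  have sub: "(\<integral>\<^sup>+x. f x * indicator {g 0..g (real (Suc n))} x \<partial>lborel)
     = (\<integral>\<^sup>+x. f (g x) * ennreal (g' x) * indicator {0..real (Suc n)} x \<partial>lborel)" for n
    by (rule nn_integral_substitution_aux) (use deriv nonneg continuous_on_subset[OF cont] in auto)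
  have "(\<integral>\<^sup>+x. f x * indicator {g 0..} x \<partial>lborel) = (\<integral>\<^sup>+x. (SUP n. f x * indicator {g 0..g (real (Suc n))} x) \<partial>lborel)"
  proof (intro nn_integral_cong antisym SUP_least)
    fix x
    have "\<forall>\<^sub>F n in sequentially. g (real (Suc n)) \<ge> x"
      using filterlim_compose[OF lim filterlim_compose[OF filterlim_real_sequentially filterlim_Suc]]
      unfolding filterlim_at_top by blast
    then obtain n where "g (real (Suc n)) \<ge> x" by (auto simp: eventually_sequentially)
    then show "f x * indicator {g 0..} x \<le> (SUP n. f x * indicator {g 0..g (real (Suc n))} x)"
      by (intro SUP_upper2[of n]) (auto simp: indicator_def)
  qed (auto simp: indicator_def)
  also have "\<dots> = (SUP n. \<integral>\<^sup>+x. f x * indicator {g 0..g (real (Suc n))} x \<partial>lborel)"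
  proof (intro nn_integral_monotone_convergence_SUP incseq_SucI le_funI)
    fix n x
    have "g (real (Suc n)) \<le> g (real (Suc (Suc n)))" by (rule mono) auto
    then show "f x * indicator {g 0..g (real (Suc n))} x \<le> f x * indicator {g 0..g (real (Suc (Suc n)))} x"
      by (auto simp: indicator_def)
  qed auto
  also have "\<dots> = (SUP n. \<integral>\<^sup>+x. f (g x) * ennreal (g' x) * indicator {0..real (Suc n)} x \<partial>lborel)"
    unfolding sub ..
  also have "\<dots> = (\<integral>\<^sup>+x. (SUP n. f (g x) * ennreal (g' x) * indicator {0..real (Suc n)} x) \<partial>lborel)"
    by (intro nn_integral_monotone_convergence_SUP[symmetric] incseq_SucI le_funI) (auto simp: indicator_def)
  also have "\<dots> = (\<integral>\<^sup>+x. f (g x) * ennreal (g' x) * indicator {0..} x \<partial>lborel)"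
  proof (intro nn_integral_cong antisym SUP_least)
    fix x :: real
    obtain n where "x \<le> real n" using real_arch_simple by blast
    then show "f (g x) * ennreal (g' x) * indicator {0..} x \<le> (SUP n. f (g x) * ennreal (g' x) * indicator {0..real (Suc n)} x)"
      by (intro SUP_upper2[of n]) (auto simp: indicator_def)
  qed (auto simp: indicator_def)
  finally show ?thesis .
qed

lemma one_plus_square_pos: "(1::real) + x\<^sup>2 > 0"
  by (simp add: add_pos_nonneg)

text \<open>The derivative 2 x^2 / (1 + x^2)^2 lies between 0 and 2 x^2. The cubic upper bound has
  the exact leading coefficient at 0.\<close>

lemma arctan_minus_bounds:
  assumes "s \<ge> 0"
  shows "0 \<le> arctan s - s / (1 + s\<^sup>2)" "arctan s - s / (1 + s\<^sup>2) \<le> 2 / 3 * s ^ 3"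
proof -
  have nz: "1 + x\<^sup>2 \<noteq> 0" for x :: real using one_plus_square_pos[of x] by simp
  have d: "((\<lambda>x. arctan x - x / (1 + x\<^sup>2)) has_real_derivative 2 * x\<^sup>2 / (1 + x\<^sup>2)\<^sup>2) (at x)" for x :: real
  proof -
    have "((\<lambda>x. arctan x - x / (1 + x\<^sup>2)) has_real_derivative
        inverse (1 + x\<^sup>2) - ((1 + x\<^sup>2) - x * (2 * x)) / (1 + x\<^sup>2)\<^sup>2) (at x)"
      using nz[of x] by (auto intro!: derivative_eq_intros simp: power2_eq_square)
    also have "inverse (1 + x\<^sup>2) - ((1 + x\<^sup>2) - x * (2 * x)) / (1 + x\<^sup>2)\<^sup>2 = 2 * x\<^sup>2 / (1 + x\<^sup>2)\<^sup>2"
    proof -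
      have "inverse D - (D - a) / D\<^sup>2 = a / D\<^sup>2" if "D \<noteq> 0" for D a :: real
        using that by (simp add: field_simps power2_eq_square)
      from this[OF nz, of x "2 * x\<^sup>2"] show ?thesis by (simp add: power2_eq_square)
    qed
    finally show ?thesis .
  qed
  have "arctan 0 - 0 / (1 + 0\<^sup>2) \<le> arctan s - s / (1 + s\<^sup>2)"
    by (rule le_of_nonneg_derivative[OF assms d]) simp
  then show "0 \<le> arctan s - s / (1 + s\<^sup>2)" by simp
  have d2: "((\<lambda>x. 2 / 3 * x ^ 3 - (arctan x - x / (1 + x\<^sup>2))) has_real_derivative 2 * x\<^sup>2 - 2 * x\<^sup>2 / (1 + x\<^sup>2)\<^sup>2) (at x)" for x :: real
    by (intro DERIV_diff d) (auto intro!: derivative_eq_intros simp: power2_eq_square)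
  have nn: "2 * x\<^sup>2 - 2 * x\<^sup>2 / (1 + x\<^sup>2)\<^sup>2 \<ge> 0" for x :: real
  proof -
    have "1 \<le> (1 + x\<^sup>2)\<^sup>2" by (rule one_le_power) simp
    then have "2 * x\<^sup>2 / (1 + x\<^sup>2)\<^sup>2 \<le> 2 * x\<^sup>2 / 1" using nz[of x] by (intro divide_left_mono) auto
    then show ?thesis by simp
  qed
  have "2 / 3 * 0 ^ 3 - (arctan 0 - 0 / (1 + 0\<^sup>2)) \<le> 2 / 3 * s ^ 3 - (arctan s - s / (1 + s\<^sup>2))"
    by (rule le_of_nonneg_derivative[OF assms d2 nn])
  then show "arctan s - s / (1 + s\<^sup>2) \<le> 2 / 3 * s ^ 3" by simp
qed

text \<open>Two regimes of the exponent: cubic for small tangents, where the typical vertices lie,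
  and linear for large ones. The constants are not sharp; they only serve an integrable
  majorant.\<close>

lemma minus_arctan_bounds:
  shows "0 \<le> s \<Longrightarrow> s \<le> 1 \<Longrightarrow> s ^ 3 / 6 \<le> s - arctan s" and "1 \<le> s \<Longrightarrow> s / 6 \<le> s - arctan s"
proof -
  have main: "s ^ 3 / 6 \<le> s - arctan s" if s: "0 \<le> s" "s \<le> 1" for s :: real
  proof -
    have d: "((\<lambda>x. x - arctan x - x ^ 3 / 6) has_real_derivative 1 - inverse (1 + x\<^sup>2) - x\<^sup>2 / 2) (at x)" for x :: real
      by (auto intro!: derivative_eq_intros)
    have nn: "1 - inverse (1 + x\<^sup>2) - x\<^sup>2 / 2 \<ge> 0" if "0 \<le> x" "x \<le> s" for x :: real
    proof -
      have "x\<^sup>2 \<le> 1" using that s by (simp add: power_le_one)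
      have "1 - inverse (1 + x\<^sup>2) = x\<^sup>2 / (1 + x\<^sup>2)" using one_plus_square_pos[of x] by (simp add: field_simps)
      moreover have "x\<^sup>2 / 2 \<le> x\<^sup>2 / (1 + x\<^sup>2)" using \<open>x\<^sup>2 \<le> 1\<close> one_plus_square_pos[of x] by (intro divide_left_mono) auto
      ultimately show ?thesis by simp
    qed
    have "0 - arctan 0 - 0 ^ 3 / 6 \<le> s - arctan s - s ^ 3 / 6"
      by (rule le_of_nonneg_derivative[OF s(1) d nn])
    then show ?thesis by simp
  qed
  then show "0 \<le> s \<Longrightarrow> s \<le> 1 \<Longrightarrow> s ^ 3 / 6 \<le> s - arctan s" .
  show "s / 6 \<le> s - arctan s" if s: "1 \<le> s"
  proof -
    have d: "((\<lambda>x. x - arctan x - x / 6) has_real_derivative 1 - inverse (1 + x\<^sup>2) - 1 / 6) (at x)" for x :: real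
      by (auto intro!: derivative_eq_intros)
    have nn: "1 - inverse (1 + x\<^sup>2) - 1 / 6 \<ge> 0" if "1 \<le> x" for x :: real
    proof -
      have "2 \<le> 1 + x\<^sup>2" using that by (simp add: one_le_power)
      then have "inverse (1 + x\<^sup>2) \<le> inverse 2" by (intro le_imp_inverse_le) auto
      then show ?thesis by simp
    qed
    have "1 - arctan 1 - 1 / 6 \<le> s - arctan s - s / 6"
      by (rule le_of_nonneg_derivative[OF s d nn])
    \<comment> \<open>At 1 the cubic bound provides the starting value 1/6 for the linear
      one.\<close>
    then show ?thesis using main[of 1] by simp
  qed
qed

text \<open>Expected number of vertices per unit angle and unit tangent s. It is the void
  probability times \<open>vertex_weight\<close> times dR/ds for R = r sqrt(1 + s^2), where R dR/ds
  = r^2 s.\<close>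

definition vertex_density :: "real \<Rightarrow> real \<Rightarrow> real" where
  "vertex_density r s = exp (- (2 * r * (s - arctan s))) * (2 * r\<^sup>2 * s * (arctan s - s / (1 + s\<^sup>2)))"

text \<open>The typical scale of the tangent is \<open>r powr (-1/3)\<close>.\<close>

definition scaled_density :: "real \<Rightarrow> real \<Rightarrow> real" where
  "scaled_density r y = r powr (- 2 / 3) * vertex_density r (r powr (- 1 / 3) * y)"

text \<open>Inserting s - arctan s ~ s^3 / 3 and arctan s - s / (1 + s^2) ~ 2 s^3 / 3 at s =
  r^(-1/3) y makes all powers of r cancel.\<close>

definition limit_density :: "real \<Rightarrow> real" where
  "limit_density y = 4 / 3 * y ^ 4 * exp (- (2 / 3 * y ^ 3))"

lemma borel_measurable_densities [measurable]:
  "vertex_density r \<in> borel_measurable borel" "scaled_density r \<in> borel_measurable borel"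
  "limit_density \<in> borel_measurable borel"
proof -
  show [measurable]: "vertex_density r \<in> borel_measurable borel" for r
    unfolding vertex_density_def[abs_def] by measurable
  show "scaled_density r \<in> borel_measurable borel" unfolding scaled_density_def[abs_def] by measurable
  show "limit_density \<in> borel_measurable borel" unfolding limit_density_def[abs_def] by measurable
qed

lemma vertex_density_nonneg: "s \<ge> 0 \<Longrightarrow> vertex_density r s \<ge> 0"
  unfolding vertex_density_def using arctan_minus_bounds(1)[of s] by simp

lemma scaled_density_nonneg: "y \<ge> 0 \<Longrightarrow> scaled_density r y \<ge> 0"
  unfolding scaled_density_def by (simp add: vertex_density_nonneg)

text \<open>One majorant, independent of r, dominates every limit below. The exponent is at least y
  - 1 in both regimes of \<open>minus_arctan_bounds\<close>: it is at least y^3 / 3 in the cubic one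
  and r^(2/3) y / 3 in the linear one. The threshold 27 is a cube with 27^(2/3) = 9, more than the
  linear regime requires.\<close>

lemma scaled_density_bound:
  assumes "r \<ge> 27" "y \<ge> 0"
  shows "scaled_density r y \<le> 4 * exp 1 * (y ^ 4 * exp (- y))"
proof -
  define c where "c = r powr (- 1 / 3)"
  define s where "s = c * y"
  have r: "r > 0" using assms by simp
  have s: "s \<ge> 0" using assms by (simp add: s_def c_def)
  have c3: "r * c ^ 3 = 1"
  proof -
    have "r * c ^ 3 = r powr 1 * (r powr (- 1 / 3)) powr 3" using r by (simp add: c_def powr_numeral)
    also have "\<dots> = 1" unfolding powr_powr powr_add[symmetric] using r by simp
    finally show ?thesis .
  qed
  have rs3: "r * s ^ 3 = y ^ 3"
    using c3 by (simp add: s_def power_mult_distrib flip: mult.assoc)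
  have rs4: "r powr (- 2 / 3) * (r\<^sup>2 * s ^ 4) = y ^ 4"
  proof -
    have "r powr (- 2 / 3) * (r\<^sup>2 * c ^ 4) = r powr (- 2 / 3) * (r powr 2 * (r powr (- 1 / 3)) powr 4)"
      using r by (simp add: c_def powr_numeral)
    also have "\<dots> = 1" unfolding powr_powr powr_add[symmetric] using r by simp
    finally show ?thesis by (simp add: s_def power_mult_distrib flip: mult.assoc)
  qed
  have ex: "2 * r * (s - arctan s) \<ge> y - 1"
  proof (cases "s \<le> 1")
    case True
    have "2 * r * (s - arctan s) \<ge> 2 * r * (s ^ 3 / 6)"
      using minus_arctan_bounds(1)[OF s True] r by (intro mult_left_mono) auto
    also have "2 * r * (s ^ 3 / 6) = y ^ 3 / 3" using rs3 by simp
    finally have "2 * r * (s - arctan s) \<ge> y ^ 3 / 3" .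
    \<comment> \<open>The curve y^3 / 3 lies above its tangent y - 2/3 at y = 1, as the
      factorisation of the difference shows.\<close>
    moreover have "y ^ 3 / 3 - y + 1 \<ge> 0"
    proof -
      have "y ^ 3 / 3 - y + 1 = (y - 1)\<^sup>2 * (y + 2) / 3 + 1 / 3"
        by (simp add: power2_eq_square power3_eq_cube algebra_simps add_divide_distrib diff_divide_distrib)
      moreover have "(y - 1)\<^sup>2 * (y + 2) \<ge> 0" using assms(2) by simp
      ultimately show ?thesis by simp
    qed
    ultimately show ?thesis by linarith
  next
    case False
    have "2 * r * (s - arctan s) \<ge> 2 * r * (s / 6)"
      using minus_arctan_bounds(2)[of s] False r by (intro mult_left_mono) auto
    moreover have "r * s = r powr (2 / 3) * y"
    proof -
      have "r * r powr (- 1 / 3) = r powr 1 * r powr (- 1 / 3)" using r by simp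
      also have "\<dots> = r powr (2 / 3)" unfolding powr_add[symmetric] by simp
      finally show ?thesis by (simp add: s_def c_def flip: mult.assoc)
    qed
    moreover have "r powr (2 / 3) \<ge> 9"
    proof -
      have "(27::real) powr (2 / 3) = (3 powr 3) powr (2 / 3)" by (simp add: powr_numeral)
      also have "\<dots> = 3 powr 2" unfolding powr_powr by simp
      also have "\<dots> = 9" by (simp add: powr_numeral)
      finally show ?thesis using powr_mono2[of "2 / 3" 27 r] assms by simp
    qed
    ultimately show ?thesis using mult_right_mono[of 9 "r powr (2 / 3)" y] assms(2) by simp
  qed
  have "scaled_density r y = exp (- (2 * r * (s - arctan s))) * (r powr (- 2 / 3) * (2 * r\<^sup>2 * s * (arctan s - s / (1 + s\<^sup>2))))"
    by (simp add: scaled_density_def vertex_density_def s_def c_def)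
  also have "\<dots> \<le> exp (1 - y) * (r powr (- 2 / 3) * (2 * r\<^sup>2 * s * (2 / 3 * s ^ 3)))"
    using ex s arctan_minus_bounds[OF s] r by (intro mult_mono mult_left_mono) auto
  also have "\<dots> = exp (1 - y) * (4 / 3 * (r powr (- 2 / 3) * (r\<^sup>2 * s ^ 4)))"
    by (simp add: power3_eq_cube power4_eq_xxxx)
  also have "\<dots> = 4 / 3 * exp 1 * (y ^ 4 * exp (- y))"
    unfolding rs4 by (simp add: exp_diff exp_minus field_simps)
  also have "\<dots> \<le> 4 * exp 1 * (y ^ 4 * exp (- y))" by (intro mult_right_mono) auto
  finally show ?thesis .
qed

lemma scaled_density_tendsto:
  assumes "y \<ge> 0"
  shows "((\<lambda>r. scaled_density r y) \<longlongrightarrow> limit_density y) at_top"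
proof (cases "y = 0")
  case True
  then show ?thesis by (simp add: scaled_density_def vertex_density_def limit_density_def)
next
  case False
  then have y: "y > 0" using assms by simp
  have "((\<lambda>r. scaled_density r y) \<longlongrightarrow> exp (- (2 * (y * (y * y)) / 3)) * (2 * y * (y * y\<^sup>2 - y * (y * y) / 3))) at_top"
    unfolding scaled_density_def vertex_density_def using y by real_asymp
  also have "exp (- (2 * (y * (y * y)) / 3)) * (2 * y * (y * y\<^sup>2 - y * (y * y) / 3)) = limit_density y"
    by (simp add: limit_density_def power2_eq_square power3_eq_cube power4_eq_xxxx)
  finally show ?thesis .
qed

lemma integrable_power4_exp: "integrable lborel (\<lambda>y. indicator {0..} y * (4 * exp 1 * (y ^ 4 * exp (- y))) :: real)"
proof (rule integrableI_nonneg)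
  show "(\<lambda>y. indicator {0..} y * (4 * exp 1 * (y ^ 4 * exp (- y))) :: real) \<in> borel_measurable lborel"
    by measurable
  have "(\<integral>\<^sup>+ x. ennreal (indicator {0..} x * (4 * exp 1 * (x ^ 4 * exp (- x)))) \<partial>lborel)
    = (\<integral>\<^sup>+ x. ennreal (4 * exp 1) * (ennreal (x ^ 4 * exp (- x)) * indicator {0..} x) \<partial>lborel)"
    by (intro nn_integral_cong) (auto simp: indicator_def ennreal_mult[symmetric])
  also have "\<dots> = ennreal (4 * exp 1) * (\<integral>\<^sup>+ x. ennreal (x ^ 4 * exp (- x)) * indicator {0..} x \<partial>lborel)"
    by (rule nn_integral_cmult) measurable
  also have "\<dots> = ennreal (4 * exp 1) * ennreal (real_of_nat (fact 4))"
    by (subst nn_intergal_power_times_exp_Ici) simp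
  also have "\<dots> < \<infinity>" by (simp add: ennreal_mult_less_top)
  finally show "(\<integral>\<^sup>+ x. ennreal (indicator {0..} x * (4 * exp 1 * (x ^ 4 * exp (- x)))) \<partial>lborel) < \<infinity>" .
qed (auto simp: indicator_def)

section \<open>Limits under the integral and the constant\<close>

definition density_integral :: "real set \<Rightarrow> real \<Rightarrow> real" where
  "density_integral A r = (\<integral>y. indicator A y * scaled_density r y \<partial>lborel)"

definition limit_integral :: "real set \<Rightarrow> real" where
  "limit_integral A = (\<integral>y. indicator A y * limit_density y \<partial>lborel)"

lemma integrable_scaled_density:
  assumes [measurable]: "A \<in> sets borel" and "A \<subseteq> {0..}" "r \<ge> 27"
  shows "integrable lborel (\<lambda>y. indicator A y * scaled_density r y)"
proof (rule Bochner_Integration.integrable_bound[OF integrable_power4_exp])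
  show "AE x in lborel. norm (indicator A x * scaled_density r x) \<le> norm (indicator {0..} x * (4 * exp 1 * (x ^ 4 * exp (- x))))"
    using assms scaled_density_bound[OF assms(3)] scaled_density_nonneg[of _ r]
    by (intro always_eventually) (auto simp: indicator_def)
qed measurable

text \<open>The majorant is uniform in r and so passes to the pointwise limit.\<close>

lemma limit_density_bounds:
  assumes "y \<ge> 0" shows "0 \<le> limit_density y" "limit_density y \<le> 4 * exp 1 * (y ^ 4 * exp (- y))"
proof -
  show "0 \<le> limit_density y" using assms by (simp add: limit_density_def)
  show "limit_density y \<le> 4 * exp 1 * (y ^ 4 * exp (- y))"
    using scaled_density_bound[OF _ assms]
    by (intro tendsto_upperbound[OF scaled_density_tendsto[OF assms]] eventually_at_top_linorderI[of 27]) auto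
qed

lemma integrable_limit_density:
  assumes [measurable]: "A \<in> sets borel" and "A \<subseteq> {0..}"
  shows "integrable lborel (\<lambda>y. indicator A y * limit_density y)"
proof (rule Bochner_Integration.integrable_bound[OF integrable_power4_exp])
  show "AE x in lborel. norm (indicator A x * limit_density x) \<le> norm (indicator {0..} x * (4 * exp 1 * (x ^ 4 * exp (- x))))"
    using assms limit_density_bounds
    by (intro always_eventually) (auto simp: indicator_def)
qed measurable

lemma density_integral_tendsto:
  assumes [measurable]: "A \<in> sets borel" and A: "A \<subseteq> {0..}"
  shows "(density_integral A \<longlongrightarrow> limit_integral A) at_top"
  unfolding density_integral_def[abs_def] limit_integral_def
proof (rule integral_dominated_convergence_at_top[OF _ _ integrable_power4_exp])
  show "AE x in lborel. ((\<lambda>r. indicator A x * scaled_density r x) \<longlongrightarrow> indicator A x * limit_density x) at_top"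
  proof (intro always_eventually allI)
    fix x :: real
    show "((\<lambda>r. indicator A x * scaled_density r x) \<longlongrightarrow> indicator A x * limit_density x) at_top"
      using A scaled_density_tendsto[of x] by (cases "x \<in> A") auto
  qed
  show "\<forall>\<^sub>F r in at_top. AE x in lborel. norm (indicator A x * scaled_density r x) \<le> indicator {0..} x * (4 * exp 1 * (x ^ 4 * exp (- x)))"
    using A scaled_density_bound scaled_density_nonneg
    by (intro eventually_at_top_linorderI[of 27] always_eventually) (auto simp: indicator_def)
qed measurable

lemma limit_integral_tendsto:
  "((\<lambda>T. limit_integral {0..T}) \<longlongrightarrow> limit_integral {0..}) at_top"
  unfolding limit_integral_def
proof (rule integral_dominated_convergence_at_top[OF _ _ integrable_power4_exp])
  show "AE x in lborel. ((\<lambda>T. indicator {0..T} x * limit_density x) \<longlongrightarrow> indicator {0..} x * limit_density x) at_top"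
  proof (intro always_eventually allI)
    fix x :: real
    have "\<forall>\<^sub>F T in at_top. indicator {0..T} x * limit_density x = indicator {0..} x * limit_density x"
      using eventually_ge_at_top[of x] by eventually_elim (auto simp: indicator_def)
    then show "((\<lambda>T. indicator {0..T} x * limit_density x) \<longlongrightarrow> indicator {0..} x * limit_density x) at_top"
      by (rule tendsto_eventually)
  qed
  show "\<forall>\<^sub>F T in at_top. AE x in lborel. norm (indicator {0..T} x * limit_density x) \<le> indicator {0..} x * (4 * exp 1 * (x ^ 4 * exp (- x)))"
    using limit_density_bounds by (intro always_eventually allI) (auto simp: indicator_def)
qed measurable

text \<open>Substitute w = 2/3 y^3, dw = 2 y^2 dy. Of 4/3 y^4 this leaves 2/3 y^2 = C w^(2/3), and
  w^(2/3) = w^(5/3 - 1) is the power in the integral for Gamma(5/3).\<close>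

lemma limit_integral_eq: "2 * pi * limit_integral {0..} = a1'"
proof -
  have cube: "x\<^sup>2 = (3 / 2) powr (2 / 3) * (2 / 3 * x ^ 3) powr (2 / 3)" if "x \<ge> 0" for x :: real
  proof (cases "x = 0")
    case False
    then have x: "x > 0" using that by simp
    have "(3 / 2) powr (2 / 3) * (2 / 3 * x ^ 3) powr (2 / 3) = (x ^ 3) powr (2 / 3)"
      using x by (simp add: powr_mult[symmetric])
    also have "\<dots> = (x powr 3) powr (2 / 3)" using x by (simp add: powr_numeral)
    also have "\<dots> = x powr 2" unfolding powr_powr by simp
    finally show ?thesis using x by (simp add: powr_numeral)
  qed auto
  define f where "f w = ennreal (indicator {0..} w * w powr (5 / 3 - 1) / exp w)" for w :: real
  have [measurable]: "f \<in> borel_measurable borel" unfolding f_def by measurable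
  define C where "C = 2 / 3 * (3 / 2) powr (2 / 3 :: real)"
  have "ennreal (limit_integral {0..}) = (\<integral>\<^sup>+y. ennreal (indicator {0..} y * limit_density y) \<partial>lborel)"
    unfolding limit_integral_def using limit_density_bounds(1)
    by (intro nn_integral_eq_integral[symmetric] integrable_limit_density) (auto simp: indicator_def)
  also have "\<dots> = (\<integral>\<^sup>+y. ennreal C * (f (2 / 3 * y ^ 3) * ennreal (2 * y\<^sup>2) * indicator {0..} y) \<partial>lborel)"
  proof (rule nn_integral_cong)
    fix y :: real
    show "ennreal (indicator {0..} y * limit_density y) = ennreal C * (f (2 / 3 * y ^ 3) * ennreal (2 * y\<^sup>2) * indicator {0..} y)"
    proof (cases "y \<ge> 0")
      case True
      then have "limit_density y = C * ((2 / 3 * y ^ 3) powr (5 / 3 - 1) / exp (2 / 3 * y ^ 3) * (2 * y\<^sup>2))"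
        using cube[OF True] by (simp add: limit_density_def C_def exp_minus field_simps power4_eq_xxxx power2_eq_square)
      moreover have "0 \<le> C" by (simp add: C_def)
      moreover have "0 \<le> (2 / 3 * y ^ 3) powr (5 / 3 - 1) / exp (2 / 3 * y ^ 3)" by simp
      ultimately have "ennreal (limit_density y) =
          ennreal C * (ennreal ((2 / 3 * y ^ 3) powr (5 / 3 - 1) / exp (2 / 3 * y ^ 3)) * ennreal (2 * y\<^sup>2))"
        by (simp only: ennreal_mult')
      then show ?thesis using True by (simp add: f_def)
    qed auto
  qed
  also have "\<dots> = ennreal C * (\<integral>\<^sup>+y. f (2 / 3 * y ^ 3) * ennreal (2 * y\<^sup>2) * indicator {0..} y \<partial>lborel)"
    by (rule nn_integral_cmult) measurable
  also have "(\<integral>\<^sup>+y. f (2 / 3 * y ^ 3) * ennreal (2 * y\<^sup>2) * indicator {0..} y \<partial>lborel)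
     = (\<integral>\<^sup>+w. f w * indicator {2 / 3 * 0 ^ 3..} w \<partial>lborel)"
  proof (rule nn_integral_substitution_atLeast[symmetric, where g="\<lambda>y. 2 / 3 * y ^ 3"])
    show "((\<lambda>y. 2 / 3 * y ^ 3) has_real_derivative 2 * x\<^sup>2) (at x)" for x :: real
      by (auto intro!: derivative_eq_intros)
    show "filterlim (\<lambda>y::real. 2 / 3 * y ^ 3) at_top at_top" by real_asymp
  qed (auto intro!: continuous_intros)
  also have "\<dots> = (\<integral>\<^sup>+w. f w \<partial>lborel)"
    by (intro nn_integral_cong) (auto simp: f_def indicator_def)
  also have "\<dots> = ennreal (Gamma (5 / 3))"
    unfolding f_def by (rule Gamma_conv_nn_integral_real[symmetric]) simp
  also have "ennreal C * \<dots> = ennreal (C * Gamma (5 / 3))"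
    by (intro ennreal_mult[symmetric]) (auto simp: C_def intro!: Gamma_real_nonneg)
  finally have "limit_integral {0..} = C * Gamma (5 / 3)"
  proof (rule ennreal_inj[THEN iffD1, rotated 2])
    show "0 \<le> limit_integral {0..}" unfolding limit_integral_def
      using limit_density_bounds(1) by (intro Bochner_Integration.integral_nonneg) (auto simp: indicator_def)
    show "0 \<le> C * Gamma (5 / 3)" by (auto simp: C_def intro!: Gamma_real_nonneg)
  qed
  moreover have "2 * C = 2 powr (4 / 3) * 3 powr (- 1 / 3)"
  proof -
    have "2 * C = 2 powr 2 * 3 powr (-1) * (3 powr (2 / 3) / 2 powr (2 / 3))"
      by (simp add: C_def powr_divide powr_numeral powr_minus_divide)
    also have "\<dots> = (2 powr 2 / 2 powr (2 / 3)) * (3 powr (-1) * 3 powr (2 / 3))" by simp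
    also have "\<dots> = 2 powr (4 / 3) * 3 powr (- 1 / 3)"
      unfolding powr_diff[symmetric] powr_add[symmetric] by simp
    finally show ?thesis .
  qed
  ultimately show ?thesis by (simp add: a1'_def algebra_simps)
qed

section \<open>Independent blocks\<close>

lemma borel_measurable_Arg2pi [measurable]: "Arg2pi \<in> borel_measurable borel"
  by (rule borel_measurableI_le) (use closed_Arg2pi2pi_le in simp)

lemma Arg2pi_rcis: "R > 0 \<Longrightarrow> 0 \<le> \<theta> \<Longrightarrow> \<theta> < 2 * pi \<Longrightarrow> Arg2pi (rcis R \<theta>) = \<theta>"
  by (rule Arg2pi_unique[of R]) (simp_all add: rcis_def cis_conv_exp)

lemma rcis_Arg2pi: "rcis (norm z) (Arg2pi z) = z"
  by (simp add: complex_eq_iff cos_Arg2pi sin_Arg2pi)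

text \<open>The radial coordinate of a sector is the tangent \<open>vertex_tan\<close>, measured in units of
  \<open>r powr (-1/3)\<close>.\<close>

definition sector :: "real \<Rightarrow> real set \<Rightarrow> real \<Rightarrow> real \<Rightarrow> complex set" where
  "sector r A a b = {v. norm v > r \<and> vertex_tan r (norm v) / r powr (- 1 / 3) \<in> A \<and> a \<le> Arg2pi v \<and> Arg2pi v < b}"

lemma measurable_sector [measurable]:
  assumes [measurable]: "A \<in> sets borel" shows "sector r A a b \<in> sets borel"
  unfolding sector_def by measurable

context polar_poisson_process
begin

text \<open>Substitutes R = r sqrt(1 + s^2). By \<open>eq\<close>, the angle that \<open>B\<close>
  occupies on a circle is a function \<open>b\<close> of the tangent only, so it passes through
  unchanged.\<close>

lemma expected_vertices_tan:
  assumes B: "B \<in> sets borel" and b [measurable]: "b \<in> borel_measurable borel"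
    and eq: "\<And>R. R > r \<Longrightarrow> (\<integral>\<^sup>+\<theta>. indicator turn \<theta> * indicator B (rcis R \<theta>) \<partial>lborel) = b (vertex_tan r R)"
  shows "(\<integral>\<^sup>+\<omega>. ecard (vertices (\<Phi> \<omega>) \<inter> B) \<partial>M)
    = (\<integral>\<^sup>+s. indicator {0..} s * (ennreal (vertex_density r s) * b s) \<partial>lborel)"
proof -
  define f where "f R = ennreal (vertex_weight r R) *
        (ennreal (exp (- cut_measure r R)) * b (vertex_tan r R))" for R
  have [measurable]: "f \<in> borel_measurable borel" unfolding f_def by measurable
  define g where "g s = r * sqrt (1 + s\<^sup>2)" for s
  define g' where "g' s = r * s / sqrt (1 + s\<^sup>2)" for s
  have [measurable]: "g \<in> borel_measurable borel" "g' \<in> borel_measurable borel"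
    unfolding g_def[abs_def] g'_def[abs_def] by measurable
  have pos: "0 < 1 + s\<^sup>2" "sqrt (1 + s\<^sup>2) > 0" for s :: real using one_plus_square_pos[of s] by simp_all
  have "(\<integral>\<^sup>+\<omega>. ecard (vertices (\<Phi> \<omega>) \<inter> B) \<partial>M) = (\<integral>\<^sup>+R. f R * indicator {g 0..} R \<partial>lborel)"
    unfolding expected_vertices[OF B]
  proof (rule nn_integral_cong)
    fix R
    have g0: "g 0 = r" by (simp add: g_def)
    consider "R < r" | "R = r" | "R > r" by linarith
    then show "indicator {r<..} R * ennreal (vertex_weight r R) *
        (ennreal (exp (- cut_measure r R)) * (\<integral>\<^sup>+\<theta>. indicator turn \<theta> * indicator B (rcis R \<theta>) \<partial>lborel))
      = f R * indicator {g 0..} R"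
    proof cases
      \<comment> \<open>The substitution formula includes the endpoint R = r, which the intensity
        leaves out; there the weight vanishes.\<close>
      case 2
      then have "vertex_tan r R = 0" using r_pos by (simp add: vertex_tan_def)
      then have "f R = 0" by (simp add: f_def)
      then show ?thesis using 2 by simp
    qed (simp_all add: g0 f_def eq)
  qed
  also have "\<dots> = (\<integral>\<^sup>+s. f (g s) * ennreal (g' s) * indicator {0..} s \<partial>lborel)"
  proof (rule nn_integral_substitution_atLeast)
    show "(g has_real_derivative g' x) (at x)" for x
      unfolding g_def[abs_def] g'_def using pos[of x]
      by (auto intro!: derivative_eq_intros simp: field_simps)
    show "continuous_on {0..} g'"
      unfolding g'_def[abs_def] using pos by (intro continuous_intros) (simp add: less_imp_neq[symmetric])
    show "0 \<le> g' x" if "x \<ge> 0" for x using that r_pos pos[of x] by (simp add: g'_def)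
    show "filterlim g at_top at_top" unfolding g_def[abs_def] using r_pos by real_asymp
  qed measurable
  also have "\<dots> = (\<integral>\<^sup>+s. indicator {0..} s * (ennreal (vertex_density r s) * b s) \<partial>lborel)"
  proof (rule nn_integral_cong)
    fix s :: real
    show "f (g s) * ennreal (g' s) * indicator {0..} s = indicator {0..} s * (ennreal (vertex_density r s) * b s)"
    proof (cases "s \<ge> 0")
      case True
      have tan: "vertex_tan r (g s) = s"
      proof -
        have "(g s / r)\<^sup>2 = 1 + s\<^sup>2" using r_pos pos[of s] by (simp add: g_def)
        then show ?thesis using True by (simp add: vertex_tan_def)
      qed
      have "sin (2 * arctan s) = 2 * (s / sqrt (1 + s\<^sup>2)) * (1 / sqrt (1 + s\<^sup>2))"
        by (simp only: sin_double sin_arctan cos_arctan)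
      also have "\<dots> = 2 * s / (1 + s\<^sup>2)" using pos[of s] by simp
      finally have sin: "sin (2 * arctan s) = 2 * s / (1 + s\<^sup>2)" .
      have nn: "0 \<le> g s * (2 * arctan s - 2 * s / (1 + s\<^sup>2))"
        using arctan_minus_bounds(1)[OF True] r_pos pos[of s] by (simp add: g_def)
      have gg: "g s * g' s = r\<^sup>2 * s" using pos[of s] by (simp add: g_def g'_def power2_eq_square)
      have cm: "cut_measure r (g s) = 2 * r * (s - arctan s)" by (simp add: cut_measure_def tan)
      have "vertex_density r s = (r\<^sup>2 * s) * (2 * (arctan s - s / (1 + s\<^sup>2))) * exp (- (2 * r * (s - arctan s)))"
        by (simp add: vertex_density_def)
      also have "\<dots> = (g s * g' s) * (2 * (arctan s - s / (1 + s\<^sup>2))) * exp (- cut_measure r (g s))"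
        by (simp only: gg cm)
      also have "\<dots> = g s * (2 * (arctan s - s / (1 + s\<^sup>2))) * exp (- cut_measure r (g s)) * g' s"
        by (simp only: mult_ac)
      also have "2 * (arctan s - s / (1 + s\<^sup>2)) = 2 * arctan s - 2 * s / (1 + s\<^sup>2)" by simp
      finally have vd: "vertex_density r s = g s * (2 * arctan s - 2 * s / (1 + s\<^sup>2)) * exp (- cut_measure r (g s)) * g' s" .
      have "g' s \<ge> 0" using True r_pos pos[of s] by (simp add: g'_def)
      then have "ennreal (vertex_density r s)
          = ennreal (g s * (2 * arctan s - 2 * s / (1 + s\<^sup>2))) * ennreal (exp (- cut_measure r (g s))) * ennreal (g' s)"
        unfolding vd using nn by (simp only: ennreal_mult'' exp_ge_zero)
      moreover have "f (g s) = ennreal (g s * (2 * arctan s - 2 * s / (1 + s\<^sup>2))) * (ennreal (exp (- cut_measure r (g s))) * b s)"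
        unfolding f_def tan sin ..
      ultimately show ?thesis using True by (simp add: mult_ac)
    qed simp
  qed
  finally show ?thesis .
qed

text \<open>The origin of the order r^(1/3): in the variable y = s / r^(-1/3) the density is of
  order r^(2/3), and the substitution contributes r^(-1/3).\<close>

lemma expected_vertices_scaled:
  assumes B: "B \<in> sets borel" and A: "A \<in> sets borel" "A \<subseteq> {0..}" and \<beta>: "\<beta> \<ge> 0" and r: "r \<ge> 27"
    and eq: "\<And>R. R > r \<Longrightarrow> (\<integral>\<^sup>+\<theta>. indicator turn \<theta> * indicator B (rcis R \<theta>) \<partial>lborel)
        = ennreal \<beta> * indicator A (vertex_tan r R / r powr (- 1 / 3))"
  shows "(\<integral>\<^sup>+\<omega>. ecard (vertices (\<Phi> \<omega>) \<inter> B) \<partial>M) = ennreal (\<beta> * r powr (1 / 3) * density_integral A r)"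
proof -
  note [measurable] = A(1)
  define c where "c = r powr (- 1 / 3)"
  have c: "c > 0" using r_pos by (simp add: c_def)
  define h where "h s = indicator {0..} s * (ennreal (vertex_density r s) * (ennreal \<beta> * indicator A (s / c)))" for s
  have [measurable]: "h \<in> borel_measurable borel" unfolding h_def[abs_def] by measurable
  have cc: "c * vertex_density r (c * y) = r powr (1 / 3) * scaled_density r y" for y
  proof -
    have "r powr (1 / 3) * r powr (- 2 / 3) = c" unfolding c_def powr_add[symmetric] by simp
    then show ?thesis by (simp add: scaled_density_def c_def flip: mult.assoc)
  qed
  have "(\<integral>\<^sup>+\<omega>. ecard (vertices (\<Phi> \<omega>) \<inter> B) \<partial>M) = (\<integral>\<^sup>+s. h s \<partial>lborel)"
    unfolding h_def by (rule expected_vertices_tan[OF B]) (measurable, simp add: eq c_def)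
  also have "\<dots> = ennreal \<bar>c\<bar> * (\<integral>\<^sup>+y. h (0 + c * y) \<partial>lborel)"
    using c by (intro nn_integral_real_affine) auto
  also have "\<dots> = (\<integral>\<^sup>+y. ennreal c * h (0 + c * y) \<partial>lborel)"
    using c by (subst nn_integral_cmult) auto
  also have "\<dots> = (\<integral>\<^sup>+y. ennreal (\<beta> * r powr (1 / 3) * (indicator A y * scaled_density r y)) \<partial>lborel)"
  proof (rule nn_integral_cong)
    fix y
    show "ennreal c * h (0 + c * y) = ennreal (\<beta> * r powr (1 / 3) * (indicator A y * scaled_density r y))"
    proof (cases "y \<in> A")
      case True
      then have y: "y \<ge> 0" using A by auto
      have "ennreal c * h (0 + c * y) = ennreal (\<beta> * (c * vertex_density r (c * y)))"
        using True y c \<beta> vertex_density_nonneg[of "c * y" r]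
        by (simp add: h_def ennreal_mult mult_ac)
      then show ?thesis using True unfolding cc by (simp add: mult_ac)
    next
      case False
      then show ?thesis using c by (simp add: h_def)
    qed
  qed
  also have "\<dots> = ennreal (\<integral>y. \<beta> * r powr (1 / 3) * (indicator A y * scaled_density r y) \<partial>lborel)"
  proof (intro nn_integral_eq_integral integrable_mult_right integrable_scaled_density[OF A r] always_eventually allI)
    fix y
    show "0 \<le> \<beta> * r powr (1 / 3) * (indicator A y * scaled_density r y)"
      using A \<beta> scaled_density_nonneg[of y r] by (cases "y \<in> A") auto
  qed
  also have "(\<integral>y. \<beta> * r powr (1 / 3) * (indicator A y * scaled_density r y) \<partial>lborel) = \<beta> * r powr (1 / 3) * density_integral A r"
    unfolding density_integral_def by simp
  finally show ?thesis .
qed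

lemma expected_vertices_total:
  assumes "r \<ge> 27"
  shows "(\<integral>\<^sup>+\<omega>. ecard (vertices (\<Phi> \<omega>)) \<partial>M) = ennreal (2 * pi * r powr (1 / 3) * density_integral {0..} r)"
proof -
  have "(\<integral>\<^sup>+\<omega>. ecard (vertices (\<Phi> \<omega>) \<inter> UNIV) \<partial>M) = ennreal (2 * pi * r powr (1 / 3) * density_integral {0..} r)"
  proof (rule expected_vertices_scaled)
    fix R assume R: "R > r"
    then have "vertex_tan r R / r powr (- 1 / 3) \<in> {0..}" using vertex_tan(1)[OF r_pos R] by simp
    then show "(\<integral>\<^sup>+\<theta>. indicator turn \<theta> * indicator UNIV (rcis R \<theta>) \<partial>lborel)
        = ennreal (2 * pi) * indicator {0..} (vertex_tan r R / r powr (- 1 / 3))"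
      by simp
  qed (use assms in auto)
  then show ?thesis by simp
qed

lemma expected_vertices_sector:
  assumes A: "A \<in> sets borel" "A \<subseteq> {0..}" and r: "r \<ge> 27" and ab: "0 \<le> a" "a \<le> b" "b \<le> 2 * pi"
  shows "(\<integral>\<^sup>+\<omega>. ecard (vertices (\<Phi> \<omega>) \<inter> sector r A a b) \<partial>M)
    = ennreal ((b - a) * r powr (1 / 3) * density_integral A r)"
proof (rule expected_vertices_scaled[OF measurable_sector[OF A(1)] A])
  fix R assume R: "R > r"
  let ?s = "vertex_tan r R / r powr (- 1 / 3)"
  have "(\<integral>\<^sup>+\<theta>. indicator turn \<theta> * indicator (sector r A a b) (rcis R \<theta>) \<partial>lborel)
     = (\<integral>\<^sup>+\<theta>. indicator {a..<b} \<theta> * indicator A ?s \<partial>lborel)"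
  proof (rule nn_integral_cong)
    fix \<theta>
    show "indicator turn \<theta> * indicator (sector r A a b) (rcis R \<theta>) = indicator {a..<b} \<theta> * (indicator A ?s :: ennreal)"
    proof (cases "\<theta> \<in> turn")
      case True
      then have "Arg2pi (rcis R \<theta>) = \<theta>" using R r_pos by (intro Arg2pi_rcis) auto
      then have "rcis R \<theta> \<in> sector r A a b \<longleftrightarrow> ?s \<in> A \<and> \<theta> \<in> {a..<b}"
        using R r_pos by (auto simp: sector_def)
      then show ?thesis using True by (auto simp: indicator_def)
    next
      case False
      then show ?thesis using ab by (auto simp: indicator_def)
    qed
  qed
  also have "\<dots> = (\<integral>\<^sup>+\<theta>. indicator {a..<b} \<theta> \<partial>lborel) * indicator A ?s"
    by (rule nn_integral_multc) measurable
  also have "(\<integral>\<^sup>+\<theta>. indicator {a..<b} \<theta> \<partial>lborel) = ennreal (b - a)"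
    using ab by simp
  finally show "(\<integral>\<^sup>+\<theta>. indicator turn \<theta> * indicator (sector r A a b) (rcis R \<theta>) \<partial>lborel)
      = ennreal (b - a) * indicator A ?s" .
qed (use ab r in auto)

end

section \<open>Which lines can affect a vertex\<close>

lemma abs_le_of_cos_ge:
  assumes \<alpha>: "0 < \<alpha>" "\<alpha> < pi" and y: "\<bar>y\<bar> < 2 * pi - \<alpha>" and c: "cos y \<ge> cos \<alpha>"
  shows "\<bar>y\<bar> \<le> \<alpha>"
proof (rule ccontr)
  assume n: "\<not> \<bar>y\<bar> \<le> \<alpha>"
  have "cos \<bar>y\<bar> < cos \<alpha>"
  proof (cases "\<bar>y\<bar> \<le> pi")
    case True
    then show ?thesis using n \<alpha> by (intro cos_monotone_0_pi) auto
  next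
    case False
    have "cos (2 * pi - \<bar>y\<bar>) < cos \<alpha>" using False n \<alpha> y by (intro cos_monotone_0_pi) auto
    then show ?thesis by (simp add: cos_diff)
  qed
  then show False using c by simp
qed

lemma arctan_less_self: "s > 0 \<Longrightarrow> arctan s < s"
proof -
  assume s: "s > 0"
  show ?thesis
  proof (cases "s \<le> 1")
    case True
    have "0 < s ^ 3" using s by simp
    then show ?thesis using minus_arctan_bounds(1)[of s] s True by linarith
  next
    case False
    then show ?thesis using minus_arctan_bounds(2)[of s] by simp
  qed
qed

text \<open>A foot in the closed disk of \<open>v\<close> at distance at least r has an angle to
  \<open>v\<close> with cosine at least r / R = cos \<alpha>, and \<alpha> = arctan \<sigma> <
  \<sigma> <= \<eta>. So \<eta> bounds both the angular reach and, through R = r sqrt(1 +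
  \<sigma>^2), the radial one.\<close>

lemma sector_local:
  assumes r: "r > 0" and v: "v \<in> sector r {0..T} a b" and \<eta>: "\<eta> = T * r powr (- 1 / 3)"
    and ab: "\<eta> \<le> a" "b \<le> 2 * pi - \<eta>"
    and x: "x \<in> closed_cut_disk v" "norm x \<ge> r"
  shows "a - \<eta> < Arg2pi x" "Arg2pi x < b + \<eta>" "norm x \<le> r * sqrt (1 + \<eta>\<^sup>2)"
proof -
  define R \<phi> \<theta> \<sigma> where "R = norm v" and "\<phi> = Arg2pi v" and "\<theta> = Arg2pi x" and "\<sigma> = vertex_tan r (norm v)"
  have R: "R > r" and \<phi>: "a \<le> \<phi>" "\<phi> < b" using v by (auto simp: sector_def R_def \<phi>_def)
  have "\<sigma> / r powr (- 1 / 3) \<le> T" using v by (auto simp: sector_def \<sigma>_def)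
  then have \<sigma>: "\<sigma> \<le> \<eta>" using r by (simp add: \<eta> pos_divide_le_eq)
  have \<sigma>0: "\<sigma> > 0" using vertex_tan(1)[OF r R] by (simp add: \<sigma>_def R_def)
  define \<alpha> where "\<alpha> = arctan \<sigma>"
  have \<alpha>: "0 < \<alpha>" "\<alpha> < pi / 2" "cos \<alpha> = r / R" using vertex_tan[OF r R] by (simp_all add: \<alpha>_def \<sigma>_def R_def)
  have \<alpha>\<eta>: "\<alpha> < \<eta>" using arctan_less_self[OF \<sigma>0] \<sigma> by (simp add: \<alpha>_def)
  have \<theta>: "0 \<le> \<theta>" "\<theta> < 2 * pi" using Arg2pi[of x] by (auto simp: \<theta>_def)
  have "norm x * norm x \<le> inner v x"
    using x(1) by (simp add: closed_cut_disk_def power2_norm_eq_inner[symmetric] power2_eq_square)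
  also have "inner v x = R * norm x * cos (\<theta> - \<phi>)"
    using inner_rcis[of R \<phi> "norm x" \<theta>] by (simp add: R_def \<phi>_def \<theta>_def rcis_Arg2pi)
  finally have "norm x * norm x \<le> norm x * (R * cos (\<theta> - \<phi>))" by (simp add: mult_ac)
  moreover have "0 < norm x" using x(2) r by linarith
  ultimately have "norm x \<le> R * cos (\<theta> - \<phi>)" by (simp only: mult_le_cancel_left_pos)
  then have "r / R \<le> cos (\<theta> - \<phi>)" using x(2) R r by (simp add: field_simps)
  \<comment> \<open>The margins \<eta> at 0 and at 2\<pi> keep |\<theta> - \<phi>| below 2\<pi> -
    \<alpha>, so \<open>Arg2pi\<close> cannot wrap around.\<close>
  then have "\<bar>\<theta> - \<phi>\<bar> \<le> \<alpha>"
    using \<alpha> \<alpha>\<eta> ab \<phi> \<theta> by (intro abs_le_of_cos_ge) auto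
  then show "a - \<eta> < Arg2pi x" "Arg2pi x < b + \<eta>" using \<phi> \<alpha>\<eta> by (auto simp: \<theta>_def abs_le_iff)
  have "norm x \<le> R" using closed_cut_disk_subset[of v] x(1) by (auto simp: R_def)
  also have "R \<le> r * sqrt (1 + \<eta>\<^sup>2)"
  proof -
    have "R / r > 1" using R r by simp
    then have "(R / r)\<^sup>2 = 1 + \<sigma>\<^sup>2" by (simp add: \<sigma>_def vertex_tan_def R_def one_less_power less_imp_le)
    also have "\<dots> \<le> 1 + \<eta>\<^sup>2" using \<sigma> \<sigma>0 by simp
    finally have "sqrt ((R / r)\<^sup>2) \<le> sqrt (1 + \<eta>\<^sup>2)" by (rule real_sqrt_le_mono)
    moreover have "sqrt ((R / r)\<^sup>2) = R / r" using R r by (simp only: real_sqrt_abs) simp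
    ultimately have "R / r \<le> sqrt (1 + \<eta>\<^sup>2)" by (simp only:)
    then show ?thesis using r by (simp only: pos_divide_le_eq mult.commute)
  qed
  finally show "norm x \<le> r * sqrt (1 + \<eta>\<^sup>2)" .
qed

text \<open>Lines through \<open>v\<close> and lines cutting it off all have feet in the closed disk
  of \<open>v\<close>; no others decide whether \<open>v\<close> is a vertex.\<close>

lemma vertices_Int_eq:
  assumes "\<And>x. x \<in> S \<Longrightarrow> x \<in> closed_cut_disk v \<Longrightarrow> x \<in> A"
  shows "v \<in> vertices (S \<inter> A) \<longleftrightarrow> v \<in> vertices S"
proof -
  have on: "x \<in> closed_cut_disk v" if "inner v x = inner x x" for x
    using that by (simp add: closed_cut_disk_def)
  have "S \<inter> A \<inter> cut_disk v = {} \<longleftrightarrow> S \<inter> cut_disk v = {}"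
    using assms cut_disk_subset[of v] by blast
  then show ?thesis unfolding vertices_def mem_crofton_cell using assms on by blast
qed

lemma card_vertices_le:
  assumes "finite F" shows "card (vertices F \<inter> B) \<le> (card F)\<^sup>2"
proof -
  have "vertices F \<inter> B \<subseteq> (\<lambda>(x, y). meet x y) ` (F \<times> F)" by (auto simp: vertices_altdef)
  then have "card (vertices F \<inter> B) \<le> card ((\<lambda>(x, y). meet x y) ` (F \<times> F))"
    using assms by (intro card_mono) auto
  also have "\<dots> \<le> card (F \<times> F)" using assms by (intro card_image_le) auto
  finally show ?thesis by (simp add: card_cartesian_product power2_eq_square)
qed

lemma real_card_eq: "real (card X) = enn2real (ecard X)"
  by (simp add: emeasure_count_space)

text \<open>The constant is 4^4, from taking the fourth power of x/4 <= exp(x/4).\<close>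

lemma power4_le_exp:
  fixes x :: real assumes "x \<ge> 0" shows "x ^ 4 \<le> 256 * exp x"
proof -
  have "x / 4 \<le> exp (x / 4)" using exp_ge_add_one_self[of "x / 4"] by linarith
  then have "(x / 4) ^ 4 \<le> exp (x / 4) ^ 4" using assms by (intro power_mono) auto
  also have "exp (x / 4) ^ 4 = exp x" by (simp flip: exp_of_nat_mult)
  finally show ?thesis by (simp add: power_divide)
qed

text \<open>The parameters cut the plane into \<open>m\<close> angular regions. Vertices in the corresponding blocks,
  which stay away by \<open>\<eta>\<close> from the boundaries of the regions, only depend on the process in the
  region, so that their numbers are independent.\<close>

locale sector_partition = polar_poisson_process M r \<Phi> for M :: "'w measure" and r \<Phi> +
  fixes T :: real and m :: nat
  assumes r27: "r \<ge> 27" and T: "T \<ge> 1" and m: "m > 0"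
    and m_le: "real m * T\<^sup>2 \<le> r powr (1 / 3)" and m_ge: "r powr (1 / 3) \<le> 2 * T\<^sup>2 * real m"
begin

definition \<eta> :: real where "\<eta> = T * r powr (- 1 / 3)"

abbreviation angle :: "nat \<Rightarrow> real" where
  "angle i \<equiv> 2 * pi * real i / real m"

definition block :: "nat \<Rightarrow> complex set" where
  "block i = sector r {0..T} (angle i + \<eta>) (angle (Suc i) - \<eta>)"

text \<open>Where the feet relevant to a block lie according to \<open>sector_local\<close>. The
  strict angular bounds make regions with different indices disjoint.\<close>

definition region :: "nat \<Rightarrow> complex set" where
  "region i = {x. r < norm x \<and> norm x \<le> r * sqrt (1 + \<eta>\<^sup>2) \<and>
     angle i < Arg2pi x \<and> Arg2pi x < angle (Suc i)}"

text \<open>Restricting the process first makes the count a function of its points in one region, as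
  independence requires. Almost surely it agrees with the number of vertices of the full process in
  the block.\<close>

definition block_count :: "nat \<Rightarrow> 'w \<Rightarrow> real" where
  "block_count i \<omega> = real (card (vertices (\<Phi> \<omega> \<inter> region i) \<inter> block i))"

lemma \<eta>_pos: "\<eta> > 0" using T r_pos by (simp add: \<eta>_def)

text \<open>The gaps take the angle 2 \<eta> m in total, so after scaling their loss vanishes as T
  grows.\<close>

lemma \<eta>_m: "\<eta> * real m \<le> 1 / T"
proof -
  have "r powr (- 1 / 3) * r powr (1 / 3) = 1" using r_pos unfolding powr_add[symmetric] by simp
  then have "r powr (- 1 / 3) * (real m * T\<^sup>2) \<le> 1"
    using mult_left_mono[OF m_le, of "r powr (- 1 / 3)"] by simp
  then have "\<eta> * real m * T \<le> 1" by (simp add: \<eta>_def power2_eq_square mult_ac)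
  then show ?thesis using T by (simp add: field_simps)
qed

lemma block_width: "2 * \<eta> \<le> 2 * pi / real m"
proof -
  have "\<eta> * real m \<le> pi" using \<eta>_m T pi_gt3 by (smt (verit) divide_le_eq_1_pos)
  then show ?thesis using m by (simp add: field_simps)
qed

lemma angle_le: "i < m \<Longrightarrow> angle (Suc i) \<le> 2 * pi"
  using m by (simp add: field_simps del: of_nat_Suc)

lemma measurable_block [measurable]: "block i \<in> sets borel"
  unfolding block_def by measurable

lemma measurable_region [measurable]: "region i \<in> sets borel"
  unfolding region_def by measurable

lemma bounded_region: "bounded (region i)"
  by (rule boundedI[of _ "r * sqrt (1 + \<eta>\<^sup>2)"]) (simp add: region_def)

lemma region_disjoint:
  assumes "i \<noteq> j" shows "region i \<inter> region j = {}"
proof -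
  have "region i \<inter> region j = {}" if "i < j" for i j
  proof -
    have "angle (Suc i) \<le> angle j"
      using that by (intro divide_right_mono mult_left_mono) auto
    then show ?thesis by (auto simp: region_def)
  qed
  from this[of i j] this[of j i] show ?thesis using assms by (cases "i < j") auto
qed

lemma block_local:
  assumes i: "i < m" and v: "v \<in> block i" and x: "x \<in> closed_cut_disk v" "norm x \<ge> r"
  shows "norm x \<le> r * sqrt (1 + \<eta>\<^sup>2)" "angle i < Arg2pi x"
    "Arg2pi x < angle (Suc i)"
proof -
  note * = sector_local[OF r_pos v[unfolded block_def] \<eta>_def _ _ x]
  have "\<eta> \<le> angle i + \<eta>" "angle (Suc i) - \<eta> \<le> 2 * pi - \<eta>"
    using angle_le[OF i] by simp_all
  from *[OF this] show "norm x \<le> r * sqrt (1 + \<eta>\<^sup>2)" "angle i < Arg2pi x"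
    "Arg2pi x < angle (Suc i)" by simp_all
qed

lemma block_norm:
  assumes v: "v \<in> block i" and i: "i < m"
  shows "r < norm v" "angle i < Arg2pi v" "Arg2pi v < angle (Suc i)"
    "norm v \<le> r * sqrt (1 + \<eta>\<^sup>2)"
proof -
  show nv: "r < norm v" using v by (simp add: block_def sector_def)
  have "v \<in> closed_cut_disk v" by (simp add: closed_cut_disk_def)
  from block_local[OF i v this] nv show "angle i < Arg2pi v"
    "Arg2pi v < angle (Suc i)" "norm v \<le> r * sqrt (1 + \<eta>\<^sup>2)" by simp_all
qed

lemma block_subset_region: "i < m \<Longrightarrow> block i \<subseteq> region i"
  using block_norm by (auto simp: region_def)

lemma bounded_block: "i < m \<Longrightarrow> bounded (block i)"
  using bounded_subset[OF bounded_region block_subset_region] .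

lemma block_disjoint: "i < m \<Longrightarrow> j < m \<Longrightarrow> i \<noteq> j \<Longrightarrow> block i \<inter> block j = {}"
  using region_disjoint[of i j] block_subset_region[of i] block_subset_region[of j] by blast

lemma vertices_block:
  assumes "i < m" "S \<inter> cball 0 r = {}"
  shows "vertices (S \<inter> region i) \<inter> block i = vertices S \<inter> block i"
proof -
  have "v \<in> vertices (S \<inter> region i) \<longleftrightarrow> v \<in> vertices S" if "v \<in> block i" for v
  proof (rule vertices_Int_eq)
    fix x assume x: "x \<in> S" "x \<in> closed_cut_disk v"
    then have "norm x > r" using assms(2) by (auto simp: disjoint_iff)
    then show "x \<in> region i" using block_local[OF assms(1) that x(2)] by (simp add: region_def)
  qed
  then show ?thesis by blast
qed

text \<open>The deterministic foot has angle 0 and norm r, whereas feet of norm at least r in the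
  closed disk of a block point have positive angle. The additional line therefore cuts off no vertex
  of a block.\<close>

lemma block_vertices_insert:
  assumes "i < m" shows "vertices S \<inter> block i \<subseteq> vertices (insert (of_real r) S)"
proof
  fix v assume v: "v \<in> vertices S \<inter> block i"
  have "of_real r \<notin> closed_cut_disk v"
  proof
    assume "of_real r \<in> closed_cut_disk v"
    from block_local(2)[OF assms _ this, of] v r_pos have "angle i < Arg2pi (of_real r)" by simp
    moreover have "0 \<le> angle i" by simp
    ultimately show False using r_pos by (simp only: Arg2pi_of_real split: if_splits)
  qed
  then have "of_real r \<notin> cut_disk v" using cut_disk_subset by blast
  then show "v \<in> vertices (insert (of_real r) S)" using v by (auto simp: vertices_def mem_crofton_cell)
qed

text \<open>A vertex off the line Re v = r is the crossing of two lines of \<open>S\<close>, and it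
  is not cut off by \<open>S\<close> either.\<close>

lemma vertices_insert_subset:
  "vertices (insert (of_real r) S) \<subseteq> vertices S \<union> {v \<in> vertices (insert (of_real r) S). Re v = r}"
proof
  fix v assume v: "v \<in> vertices (insert (of_real r) S)"
  then have "of_real r \<notin> cut_disk v" by (auto simp: vertices_def mem_crofton_cell)
  then have le: "Re v \<le> r" using r_pos by (simp add: cut_disk_def inner_complex_def not_less)
  show "v \<in> vertices S \<union> {v \<in> vertices (insert (of_real r) S). Re v = r}"
  proof (cases "Re v = r")
    case False
    then have "inner v (of_real r) \<noteq> inner (of_real r) (of_real r :: complex)"
      using r_pos by (simp add: inner_complex_def)
    then have "v \<in> vertices S" using v by (auto simp: vertices_def mem_crofton_cell)
    then show ?thesis by simp
  qed (use v in simp)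
qed

lemma AE_void_disk: "AE \<omega> in M. \<Phi> \<omega> \<inter> cball 0 r = {}"
proof -
  have "cball 0 r \<in> null_sets (polar_intensity r)"
  proof -
    have "{x \<in> space (polar_intensity r). \<not> norm x > r} = cball 0 r" by (auto simp: not_less)
    then show ?thesis using AE_polar_intensity[OF r_pos] by (subst (asm) AE_iff_null) (simp_all add: not_less)
  qed
  then have "measure (polar_intensity r) (cball 0 r) = 0" by (simp add: measure_def null_sets_def)
  then have "prob {\<omega> \<in> space M. \<Phi> \<omega> \<inter> cball 0 r = {}} = 1" by (simp add: prob_void)
  then show ?thesis by (subst (asm) prob_Collect_eq_1) (simp_all add: void_event)
qed

lemma measurable_count_config:
  assumes "i < m" shows "(\<lambda>S. real (card (vertices S \<inter> block i))) \<in> borel_measurable configurations"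
proof -
  have "(\<lambda>S. vertices S) \<in> configurations \<rightarrow>\<^sub>M configurations" by (rule measurable_vertices) simp
  from measurable_compose[OF this measurable_card_configurations[OF measurable_block bounded_block[OF assms]]]
  show ?thesis by (rule measurable_compose) simp
qed

lemma measurable_count: "i < m \<Longrightarrow> block_count i \<in> borel_measurable M"
  unfolding block_count_def[abs_def]
  by (rule measurable_compose[OF measurable_Int_configurations[OF measurable_process measurable_region] measurable_count_config])

lemma indep_count:
  assumes "i < m" "j < m" "i \<noteq> j"
  shows "indep_var borel (block_count i) borel (block_count j)"
proof -
  have "indep_var configurations (\<lambda>\<omega>. \<Phi> \<omega> \<inter> region i) configurations (\<lambda>\<omega>. \<Phi> \<omega> \<inter> region j)"
    by (rule indep_restrictions[OF measurable_region measurable_region region_disjoint[OF assms(3)]])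
  from indep_var_compose[OF this measurable_count_config[OF assms(1)] measurable_count_config[OF assms(2)]]
  show ?thesis by (simp add: comp_def block_count_def[abs_def])
qed

section \<open>Moments of the block counts\<close>

definition block_mean :: real where
  "block_mean = (2 * pi / real m - 2 * \<eta>) * r powr (1 / 3) * density_integral {0..T} r"

lemma density_integral_nonneg: "A \<subseteq> {0..} \<Longrightarrow> density_integral A r \<ge> 0"
  unfolding density_integral_def using scaled_density_nonneg
  by (intro Bochner_Integration.integral_nonneg) (auto simp: indicator_def)

lemma block_mean_nonneg: "block_mean \<ge> 0"
  unfolding block_mean_def using block_width density_integral_nonneg[of "{0..T}"] by (intro mult_nonneg_nonneg) auto

lemma expected_count:
  assumes i: "i < m" shows "integrable M (block_count i)" "expectation (block_count i) = block_mean"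
proof -
  have nn: "(\<integral>\<^sup>+\<omega>. ennreal (block_count i \<omega>) \<partial>M) = ennreal block_mean"
  proof -
    have "AE \<omega> in M. ennreal (block_count i \<omega>) = ecard (vertices (\<Phi> \<omega>) \<inter> block i)"
      using AE_void_disk AE_space
    proof eventually_elim
      case (elim \<omega>)
      have "vertices (\<Phi> \<omega>) \<in> locally_finite_sets"
        using locally_finite_process[OF elim(2)] by (rule locally_finite_vertices)
      then have "finite (vertices (\<Phi> \<omega>) \<inter> block i)" using bounded_block[OF i] by (rule locally_finite_setsD)
      then show ?case
        using elim(1) i by (simp add: block_count_def vertices_block emeasure_count_space ennreal_of_nat_eq_real_of_nat)
    qed
    then have "(\<integral>\<^sup>+\<omega>. ennreal (block_count i \<omega>) \<partial>M) = (\<integral>\<^sup>+\<omega>. ecard (vertices (\<Phi> \<omega>) \<inter> block i) \<partial>M)"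
      by (rule nn_integral_cong_AE)
    also have "\<dots> = ennreal ((angle (Suc i) - \<eta> - (angle i + \<eta>)) * r powr (1 / 3) * density_integral {0..T} r)"
      unfolding block_def
    proof (rule expected_vertices_sector)
      show "0 \<le> angle i + \<eta>" using \<eta>_pos by (intro add_nonneg_nonneg) auto
      show "angle i + \<eta> \<le> angle (Suc i) - \<eta>"
        using block_width by (simp add: field_simps add_divide_distrib)
      show "angle (Suc i) - \<eta> \<le> 2 * pi" using angle_le[OF i] \<eta>_pos by simp
    qed (use r27 in auto)
    also have "angle (Suc i) - \<eta> - (angle i + \<eta>) = 2 * pi / real m - 2 * \<eta>"
      by (simp add: field_simps add_divide_distrib)
    finally show ?thesis by (simp add: block_mean_def)
  qed
  show "integrable M (block_count i)"
    using nn measurable_count[OF i] by (intro integrableI_nonneg) (auto simp: block_count_def)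
  show "expectation (block_count i) = block_mean"
    using nn measurable_count[OF i] block_mean_nonneg by (subst integral_eq_nn_integral) (auto simp: block_count_def)
qed

definition moment_bound :: real where
  "moment_bound = 256 * exp (2 * pi * T ^ 4 * (exp 1 - 1))"

text \<open>The angular width is 2\<pi> / m and the thickness is at most r \<eta>^2 / 2 = T^2
  r^(1/3) / 2, which \<open>m_ge\<close> bounds by T^4 m. The factors m cancel, so the bound is free
  of r.\<close>

lemma measure_region:
  assumes "i < m" shows "measure (polar_intensity r) (region i) \<le> 2 * pi * T ^ 4"
proof -
  define u where "u = r * sqrt (1 + \<eta>\<^sup>2)"
  have "r * 1 \<le> r * sqrt (1 + \<eta>\<^sup>2)" using r_pos by (intro mult_left_mono) auto
  then have u: "r \<le> u" by (simp add: u_def)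
  have "sqrt (1 + \<eta>\<^sup>2) \<le> 1 + \<eta>\<^sup>2 / 2"
  proof (rule real_le_lsqrt)
    have "(1 + \<eta>\<^sup>2 / 2)\<^sup>2 = 1 + \<eta>\<^sup>2 + (\<eta>\<^sup>2 / 2)\<^sup>2"
      by (simp add: power2_sum)
    then show "1 + \<eta>\<^sup>2 \<le> (1 + \<eta>\<^sup>2 / 2)\<^sup>2" using zero_le_power2[of "\<eta>\<^sup>2 / 2"] by linarith
  qed simp
  then have "u - r \<le> r * (\<eta>\<^sup>2 / 2)"
    using mult_left_mono[of "sqrt (1 + \<eta>\<^sup>2)" "1 + \<eta>\<^sup>2 / 2" r] r_pos by (simp add: u_def algebra_simps)
  also have "r * (\<eta>\<^sup>2 / 2) = T\<^sup>2 / 2 * r powr (1 / 3)"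
  proof -
    have "r * (r powr (- 1 / 3))\<^sup>2 = r powr 1 * (r powr (- 1 / 3)) powr 2" using r_pos by (simp add: powr_numeral)
    also have "\<dots> = r powr (1 / 3)" unfolding powr_powr powr_add[symmetric] by simp
    finally show ?thesis by (simp add: \<eta>_def power_mult_distrib)
  qed
  also have "\<dots> \<le> T\<^sup>2 / 2 * (2 * T\<^sup>2 * real m)" by (intro mult_left_mono m_ge) simp
  also have "\<dots> = T ^ 4 * real m" by (simp add: power2_eq_square power4_eq_xxxx)
  finally have ur: "u - r \<le> T ^ 4 * real m" .
  let ?a = "angle i" and ?b = "angle (Suc i)"
  have ab: "?b - ?a = 2 * pi / real m" by (simp add: field_simps add_divide_distrib)
  have "emeasure (polar_intensity r) (region i) = (\<integral>\<^sup>+x. indicator (region i) x \<partial>polar_intensity r)" by simp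
  also have "\<dots> = (\<integral>\<^sup>+\<theta>. \<integral>\<^sup>+\<rho>. indicator turn \<theta> * (indicator {r<..} \<rho> * indicator (region i) (rcis \<rho> \<theta>)) \<partial>lborel \<partial>lborel)"
    by (rule nn_integral_polar) measurable
  also have "\<dots> \<le> (\<integral>\<^sup>+\<theta>. \<integral>\<^sup>+\<rho>. indicator {?a..?b} \<theta> * indicator {r..u} \<rho> \<partial>lborel \<partial>lborel)"
  proof (intro nn_integral_mono)
    fix \<theta> \<rho> :: real
    show "indicator turn \<theta> * (indicator {r<..} \<rho> * indicator (region i) (rcis \<rho> \<theta>))
      \<le> (indicator {?a..?b} \<theta> * indicator {r..u} \<rho> :: ennreal)"
    proof (cases "\<theta> \<in> turn \<and> \<rho> > r \<and> rcis \<rho> \<theta> \<in> region i")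
      case True
      then have "Arg2pi (rcis \<rho> \<theta>) = \<theta>" using r_pos by (intro Arg2pi_rcis) auto
      then have "\<theta> \<in> {?a..?b} \<and> \<rho> \<in> {r..u}" using True r_pos by (auto simp: region_def u_def)
      then show ?thesis by (auto simp: indicator_def)
    qed (auto simp: indicator_def)
  qed
  also have "\<dots> = ennreal (?b - ?a) * ennreal (u - r)"
  proof -
    have "?a \<le> ?b" using ab m by (smt (verit) divide_nonneg_nonneg of_nat_0_le_iff pi_ge_zero)
    then show ?thesis using u by (simp add: nn_integral_cmult nn_integral_multc del: of_nat_Suc)
  qed
  also have "\<dots> = ennreal (2 * pi / real m * (u - r))" unfolding ab using u by (intro ennreal_mult[symmetric]) auto
  also have "\<dots> \<le> ennreal (2 * pi / real m * (T ^ 4 * real m))"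
    using ur by (intro ennreal_leI mult_left_mono) auto
  also have "2 * pi / real m * (T ^ 4 * real m) = 2 * pi * T ^ 4" using m by simp
  finally show ?thesis by (simp add: measure_def enn2real_leI)
qed

text \<open>With n points in the region there are at most n^2 vertices, and n^4 <= 256 exp(n). The
  exponential moment of n depends only on the measure of the region.\<close>

lemma second_moment:
  assumes i: "i < m" shows "integrable M (\<lambda>\<omega>. (block_count i \<omega>)\<^sup>2)" "expectation (\<lambda>\<omega>. (block_count i \<omega>)\<^sup>2) \<le> moment_bound"
proof -
  note [measurable] = measurable_count[OF i]
  have "(\<integral>\<^sup>+\<omega>. ennreal ((block_count i \<omega>)\<^sup>2) \<partial>M) \<le> (\<integral>\<^sup>+\<omega>. ennreal 256 * ennreal (exp (card (\<Phi> \<omega> \<inter> region i))) \<partial>M)"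
  proof (rule nn_integral_mono)
    fix \<omega> assume \<omega>: "\<omega> \<in> space M"
    let ?n = "card (\<Phi> \<omega> \<inter> region i)"
    have "card (vertices (\<Phi> \<omega> \<inter> region i) \<inter> block i) \<le> ?n\<^sup>2"
      by (rule card_vertices_le[OF finite_process_Int[OF \<omega> bounded_region]])
    then have "block_count i \<omega> \<le> (real ?n)\<^sup>2" unfolding block_count_def by (metis of_nat_le_iff of_nat_power)
    then have "(block_count i \<omega>)\<^sup>2 \<le> ((real ?n)\<^sup>2)\<^sup>2" by (intro power_mono) (auto simp: block_count_def)
    also have "\<dots> = real ?n ^ 4" by (simp flip: power_mult)
    also have "\<dots> \<le> 256 * exp (real ?n)" by (rule power4_le_exp) simp
    finally show "ennreal ((block_count i \<omega>)\<^sup>2) \<le> ennreal 256 * ennreal (exp ?n)"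
      by (subst ennreal_mult[symmetric]) (auto intro: ennreal_leI)
  qed
  also have "\<dots> = ennreal 256 * (\<integral>\<^sup>+\<omega>. ennreal (exp (card (\<Phi> \<omega> \<inter> region i))) \<partial>M)"
    using measurable_card_process[OF measurable_region bounded_region, of i] by (intro nn_integral_cmult) measurable
  also have "\<dots> = ennreal (256 * exp (measure (polar_intensity r) (region i) * (exp 1 - 1)))"
    by (simp only: nn_integral_exp_card[OF measurable_region bounded_region]) (subst ennreal_mult, auto)
  also have "\<dots> \<le> ennreal moment_bound"
    unfolding moment_bound_def using measure_region[OF i]
    by (intro ennreal_leI mult_left_mono) (auto intro!: mult_right_mono)
  finally have nn: "(\<integral>\<^sup>+\<omega>. ennreal ((block_count i \<omega>)\<^sup>2) \<partial>M) \<le> ennreal moment_bound" .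
  show "integrable M (\<lambda>\<omega>. (block_count i \<omega>)\<^sup>2)"
    by (rule integrableI_nonneg) (use nn in \<open>auto simp: less_top[symmetric] top_unique\<close>)
  show "expectation (\<lambda>\<omega>. (block_count i \<omega>)\<^sup>2) \<le> moment_bound"
    using nn by (subst integral_eq_nn_integral) (auto intro!: enn2real_leI simp: moment_bound_def)
qed

definition total_count :: "'w \<Rightarrow> real" where "total_count \<omega> = (\<Sum>i<m. block_count i \<omega>)"

lemma integrable_total_count: "integrable M total_count"
  unfolding total_count_def[abs_def] using expected_count(1) by (intro Bochner_Integration.integrable_sum) auto

lemma expected_total_count: "expectation total_count = real m * block_mean"
proof -
  have "expectation total_count = (\<Sum>i<m. expectation (block_count i))"
    unfolding total_count_def[abs_def] using expected_count(1) by (intro Bochner_Integration.integral_sum) auto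
  then show ?thesis using expected_count(2) by simp
qed

text \<open>Pairwise independence kills the mixed terms, so the variance is at most m times
  \<open>moment_bound\<close>. The square root of this bounds the mean absolute deviation.\<close>

lemma L1_total_count:
  "integrable M (\<lambda>\<omega>. \<bar>total_count \<omega> - real m * block_mean\<bar>)"
  "expectation (\<lambda>\<omega>. \<bar>total_count \<omega> - real m * block_mean\<bar>) \<le> sqrt (real m * moment_bound)"
proof -
  define Z where "Z i \<omega> = block_count i \<omega> - block_mean" for i \<omega>
  have Z_int: "integrable M (Z i)" and Z_0: "expectation (Z i) = 0" if "i < m" for i
    using expected_count[OF that] unfolding Z_def[abs_def] by (auto simp: prob_space)
  have Z_sq: "integrable M (\<lambda>\<omega>. Z i \<omega> * Z i \<omega>)" and Z_var: "expectation (\<lambda>\<omega>. Z i \<omega> * Z i \<omega>) \<le> moment_bound" if i: "i < m" for i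
  proof -
    have eq: "(\<lambda>\<omega>. Z i \<omega> * Z i \<omega>) = (\<lambda>\<omega>. (block_count i \<omega>)\<^sup>2 - 2 * block_mean * block_count i \<omega> + block_mean\<^sup>2)"
      by (auto simp: Z_def power2_eq_square algebra_simps)
    show "integrable M (\<lambda>\<omega>. Z i \<omega> * Z i \<omega>)"
      unfolding eq using expected_count[OF i] second_moment[OF i] by auto
    have "expectation (\<lambda>\<omega>. Z i \<omega> * Z i \<omega>) = expectation (\<lambda>\<omega>. (block_count i \<omega>)\<^sup>2) - block_mean\<^sup>2"
      unfolding eq using expected_count[OF i] second_moment[OF i] by (simp add: prob_space power2_eq_square)
    then show "expectation (\<lambda>\<omega>. Z i \<omega> * Z i \<omega>) \<le> moment_bound"
      using second_moment(2)[OF i] by (smt (verit) zero_le_power2)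
  qed
  have Z_ind: "integrable M (\<lambda>\<omega>. Z i \<omega> * Z j \<omega>)" "expectation (\<lambda>\<omega>. Z i \<omega> * Z j \<omega>) = 0"
    if "i < m" "j < m" "i \<noteq> j" for i j
  proof -
    have "indep_var borel ((\<lambda>x. x - block_mean) \<circ> block_count i) borel ((\<lambda>x. x - block_mean) \<circ> block_count j)"
      by (rule indep_var_compose[OF indep_count[OF that]]) auto
    then have ind: "indep_var borel (Z i) borel (Z j)" by (simp add: comp_def Z_def[abs_def])
    show "integrable M (\<lambda>\<omega>. Z i \<omega> * Z j \<omega>)"
      by (rule indep_var_integrable[OF ind Z_int[OF that(1)] Z_int[OF that(2)]])
    show "expectation (\<lambda>\<omega>. Z i \<omega> * Z j \<omega>) = 0"
      using indep_var_lebesgue_integral[OF ind Z_int[OF that(1)] Z_int[OF that(2)]] Z_0[OF that(1)] by simp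
  qed
  have Z_prod: "integrable M (\<lambda>\<omega>. Z i \<omega> * Z j \<omega>)" if "i < m" "j < m" for i j
    using Z_sq[OF that(1)] Z_ind(1)[OF that] by (cases "i = j") auto
  have sum: "total_count \<omega> - real m * block_mean = (\<Sum>i<m. Z i \<omega>)" for \<omega>
    by (simp add: total_count_def Z_def sum_subtractf)
  have sq: "(\<Sum>i<m. Z i \<omega>)\<^sup>2 = (\<Sum>i<m. \<Sum>j<m. Z i \<omega> * Z j \<omega>)" for \<omega>
    by (simp add: power2_eq_square sum_product)
  have int_sq: "integrable M (\<lambda>\<omega>. (\<Sum>i<m. Z i \<omega>)\<^sup>2)"
    unfolding sq using Z_prod by (intro Bochner_Integration.integrable_sum) auto
  have "expectation (\<lambda>\<omega>. (\<Sum>i<m. Z i \<omega>)\<^sup>2) = (\<Sum>i<m. \<Sum>j<m. expectation (\<lambda>\<omega>. Z i \<omega> * Z j \<omega>))"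
  proof -
    have "expectation (\<lambda>\<omega>. (\<Sum>i<m. Z i \<omega>)\<^sup>2) = (\<Sum>i<m. expectation (\<lambda>\<omega>. \<Sum>j<m. Z i \<omega> * Z j \<omega>))"
      unfolding sq using Z_prod by (intro Bochner_Integration.integral_sum Bochner_Integration.integrable_sum) auto
    also have "\<dots> = (\<Sum>i<m. \<Sum>j<m. expectation (\<lambda>\<omega>. Z i \<omega> * Z j \<omega>))"
      using Z_prod by (intro sum.cong refl Bochner_Integration.integral_sum) auto
    finally show ?thesis .
  qed
  also have "\<dots> \<le> (\<Sum>i<m. moment_bound)"
  proof (rule sum_mono)
    fix i assume "i \<in> {..<m}"
    then have "(\<Sum>j<m. expectation (\<lambda>\<omega>. Z i \<omega> * Z j \<omega>)) = (\<Sum>j\<in>{i}. expectation (\<lambda>\<omega>. Z i \<omega> * Z j \<omega>))"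
      using Z_ind(2) by (intro sum.mono_neutral_right) auto
    then show "(\<Sum>j<m. expectation (\<lambda>\<omega>. Z i \<omega> * Z j \<omega>)) \<le> moment_bound"
      using Z_var \<open>i \<in> {..<m}\<close> by simp
  qed
  finally have var: "expectation (\<lambda>\<omega>. (\<Sum>i<m. Z i \<omega>)\<^sup>2) \<le> real m * moment_bound" by simp
  have int1: "integrable M (\<lambda>\<omega>. \<bar>\<Sum>i<m. Z i \<omega>\<bar>)"
    using Z_int by (intro integrable_abs Bochner_Integration.integrable_sum) auto
  then show "integrable M (\<lambda>\<omega>. \<bar>total_count \<omega> - real m * block_mean\<bar>)" by (simp add: sum)
  define K where "K = sqrt (real m * moment_bound)"
  have mb: "real m * moment_bound > 0" using m by (simp add: moment_bound_def)
  have K: "K > 0" "K * K = real m * moment_bound" using mb by (simp_all add: K_def)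
  \<comment> \<open>The arithmetic-geometric mean inequality, with K the bound on the standard
    deviation, takes the place of the Cauchy-Schwarz inequality.\<close>
  have amgm: "\<bar>x\<bar> \<le> (x\<^sup>2 / K + K) / 2" for x :: real
  proof -
    have "0 \<le> (\<bar>x\<bar> - K)\<^sup>2 / K" using K by simp
    also have "(\<bar>x\<bar> - K)\<^sup>2 / K = x\<^sup>2 / K + K - 2 * \<bar>x\<bar>"
      using K by (simp add: field_simps power2_eq_square)
    finally show ?thesis by simp
  qed
  have "expectation (\<lambda>\<omega>. \<bar>\<Sum>i<m. Z i \<omega>\<bar>) \<le> expectation (\<lambda>\<omega>. ((\<Sum>i<m. Z i \<omega>)\<^sup>2 / K + K) / 2)"
    using int_sq amgm by (intro integral_mono int1) auto
  also have "\<dots> = (expectation (\<lambda>\<omega>. (\<Sum>i<m. Z i \<omega>)\<^sup>2) / K + K) / 2"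
    using int_sq by (simp add: prob_space)
  also have "\<dots> \<le> (real m * moment_bound / K + K) / 2"
    using var K by (intro divide_right_mono add_right_mono) auto
  also have "\<dots> = K" using K by (simp flip: K(2))
  finally show "expectation (\<lambda>\<omega>. \<bar>total_count \<omega> - real m * block_mean\<bar>) \<le> sqrt (real m * moment_bound)"
    unfolding sum K_def .
qed

section \<open>Comparison of the blocks with the whole cell\<close>

definition vertex_count :: "'w \<Rightarrow> real" where
  "vertex_count \<omega> = real (card (vertices (insert (of_real r) (\<Phi> \<omega>))))"

definition total_mean :: real where
  "total_mean = 2 * pi * r powr (1 / 3) * density_integral {0..} r"

lemma total_vertices:
  "integrable M (\<lambda>\<omega>. real (card (vertices (\<Phi> \<omega>))))"
  "expectation (\<lambda>\<omega>. real (card (vertices (\<Phi> \<omega>)))) = total_mean"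
  "AE \<omega> in M. finite (vertices (\<Phi> \<omega>))"
proof -
  have [measurable]: "(\<lambda>\<omega>. ecard (vertices (\<Phi> \<omega>))) \<in> borel_measurable M"
    using measurable_ecard_Int[OF measurable_vertices[OF measurable_process], of UNIV] by simp
  have nn: "(\<integral>\<^sup>+\<omega>. ecard (vertices (\<Phi> \<omega>)) \<partial>M) = ennreal total_mean"
    using expected_vertices_total[OF r27] by (simp add: total_mean_def)
  then have "AE \<omega> in M. ecard (vertices (\<Phi> \<omega>)) \<noteq> \<infinity>"
    by (intro nn_integral_PInf_AE) auto
  then show fin: "AE \<omega> in M. finite (vertices (\<Phi> \<omega>))"
    by eventually_elim (auto simp: emeasure_count_space split: if_splits)
  have m': "(\<lambda>\<omega>. real (card (vertices (\<Phi> \<omega>)))) \<in> borel_measurable M"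
    unfolding real_card_eq by measurable
  have nn': "(\<integral>\<^sup>+\<omega>. ennreal (real (card (vertices (\<Phi> \<omega>)))) \<partial>M) = ennreal total_mean"
    unfolding nn[symmetric]
    by (rule nn_integral_cong_AE, use fin in eventually_elim) (simp add: emeasure_count_space ennreal_of_nat_eq_real_of_nat)
  have "total_mean \<ge> 0" unfolding total_mean_def using density_integral_nonneg[of "{0..}"] by simp
  then show "integrable M (\<lambda>\<omega>. real (card (vertices (\<Phi> \<omega>))))"
    "expectation (\<lambda>\<omega>. real (card (vertices (\<Phi> \<omega>)))) = total_mean"
    using nn' m' by (auto intro!: integrableI_nonneg simp: integral_eq_nn_integral)
qed

text \<open>Block vertices are distinct and survive the additional line, which gives the lower
  bound; new vertices lie on that line, at most two, which gives the upper bound.\<close>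

lemma total_count_le_vertex_count:
  "AE \<omega> in M. total_count \<omega> \<le> vertex_count \<omega> \<and> vertex_count \<omega> \<le> real (card (vertices (\<Phi> \<omega>))) + 2"
  using AE_void_disk total_vertices(3) AE_space
proof eventually_elim
  case (elim \<omega>)
  let ?S = "\<Phi> \<omega>" let ?V = "vertices ?S" and ?V' = "vertices (insert (of_real r) ?S)"
  have "ecard {v \<in> ?V'. Re v = r} \<le> 2"
    by (rule vertices_on_vertical_line[OF locally_finite_sets_insert[OF locally_finite_process[OF elim(3)]]])
  then have L: "finite {v \<in> ?V'. Re v = r}" "card {v \<in> ?V'. Re v = r} \<le> 2"
  proof -
    show fin: "finite {v \<in> ?V'. Re v = r}"
      using \<open>ecard {v \<in> ?V'. Re v = r} \<le> 2\<close> by (rule_tac ccontr) (simp add: emeasure_count_space top_unique)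
    have "of_nat (card {v \<in> ?V'. Re v = r}) \<le> (of_nat 2 :: ennreal)"
      using \<open>ecard {v \<in> ?V'. Re v = r} \<le> 2\<close> fin by (simp add: emeasure_count_space)
    then show "card {v \<in> ?V'. Re v = r} \<le> 2" by (simp only: of_nat_le_iff)
  qed
  have finV': "finite ?V'" by (rule finite_subset[OF vertices_insert_subset]) (use elim(2) L in simp)
  have "card ?V' \<le> card (?V \<union> {v \<in> ?V'. Re v = r})"
    using elim(2) L by (intro card_mono[OF _ vertices_insert_subset]) simp
  also have "\<dots> \<le> card ?V + card {v \<in> ?V'. Re v = r}" by (rule card_Un_le)
  finally have le: "card ?V' \<le> card ?V + 2" using L(2) by simp
  have "total_count \<omega> = (\<Sum>i<m. real (card (?V \<inter> block i)))"
    unfolding total_count_def block_count_def using elim(1) by (intro sum.cong refl) (simp add: vertices_block)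
  also have "\<dots> = real (\<Sum>i\<in>{..<m}. card (?V \<inter> block i))" by simp
  also have "(\<Sum>i\<in>{..<m}. card (?V \<inter> block i)) = card (\<Union>i<m. ?V \<inter> block i)"
  proof (rule card_UN_disjoint[symmetric])
    show "\<forall>i\<in>{..<m}. \<forall>j\<in>{..<m}. i \<noteq> j \<longrightarrow> (?V \<inter> block i) \<inter> (?V \<inter> block j) = {}"
      using block_disjoint by blast
  qed (use elim(2) in auto)
  also have "\<dots> \<le> card ?V'"
    using block_vertices_insert by (intro card_mono[OF finV']) blast
  finally have "total_count \<omega> \<le> real (card ?V')" by simp
  then show ?case using le unfolding vertex_count_def by (metis of_nat_add of_nat_le_iff of_nat_numeral)
qed

lemma measurable_vertex_count: "vertex_count \<in> borel_measurable M"
proof -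
  have "(\<lambda>\<omega>. insert (of_real r) (\<Phi> \<omega>)) \<in> M \<rightarrow>\<^sub>M configurations"
    by (rule measurable_insert_configurations) auto
  from measurable_ecard_Int[OF measurable_vertices[OF this], of UNIV]
  show ?thesis unfolding vertex_count_def[abs_def] real_card_eq by simp
qed

text \<open>The squeeze bounds the distance of \<open>vertex_count\<close> from
  \<open>total_count\<close> by 2 plus the number of all vertices of \<Phi> minus
  \<open>total_count\<close>. Its mean is a difference of known expectations, so a fluctuation
  estimate is used for the blocks alone.\<close>

lemma vertex_count_L1:
  "integrable M vertex_count"
  "expectation (\<lambda>\<omega>. \<bar>vertex_count \<omega> - c\<bar>)
     \<le> 2 + total_mean - real m * block_mean + sqrt (real m * moment_bound) + \<bar>real m * block_mean - c\<bar>"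
proof -
  let ?W = "\<lambda>\<omega>. real (card (vertices (\<Phi> \<omega>)))"
  show int: "integrable M vertex_count"
  proof (rule Bochner_Integration.integrable_bound[of M "\<lambda>\<omega>. ?W \<omega> + 2"])
    show "AE \<omega> in M. norm (vertex_count \<omega>) \<le> norm (?W \<omega> + 2)"
      using total_count_le_vertex_count by eventually_elim (simp add: vertex_count_def)
  qed (use total_vertices(1) measurable_vertex_count in auto)
  have "expectation (\<lambda>\<omega>. \<bar>vertex_count \<omega> - c\<bar>)
    \<le> expectation (\<lambda>\<omega>. (2 + ?W \<omega> - total_count \<omega>) + \<bar>total_count \<omega> - real m * block_mean\<bar> + \<bar>real m * block_mean - c\<bar>)"
  proof (rule integral_mono_AE)
    show "AE \<omega> in M. \<bar>vertex_count \<omega> - c\<bar> \<le> (2 + ?W \<omega> - total_count \<omega>) + \<bar>total_count \<omega> - real m * block_mean\<bar> + \<bar>real m * block_mean - c\<bar>"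
      using total_count_le_vertex_count by eventually_elim linarith
  qed (use int total_vertices(1) integrable_total_count L1_total_count(1) in auto)
  also have "\<dots> = 2 + total_mean - real m * block_mean + expectation (\<lambda>\<omega>. \<bar>total_count \<omega> - real m * block_mean\<bar>) + \<bar>real m * block_mean - c\<bar>"
    using total_vertices integrable_total_count L1_total_count(1) expected_total_count by (simp add: prob_space)
  finally show "expectation (\<lambda>\<omega>. \<bar>vertex_count \<omega> - c\<bar>)
     \<le> 2 + total_mean - real m * block_mean + sqrt (real m * moment_bound) + \<bar>real m * block_mean - c\<bar>"
    using L1_total_count(2) by linarith
qed

end

section \<open>Convergence in mean\<close>

lemma a1'_pos: "a1' > 0"
  unfolding a1'_def by (intro mult_pos_pos) (auto intro: Gamma_real_pos)

text \<open>The bound of \<open>vertex_count_L1\<close> divided by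
  \<open>a1' * r powr (1 / 3)\<close>. Its terms stand for the deterministic line, the truncation at
  T, the gaps, the fluctuation of the block counts and the error of the normalising
  constant.\<close>

definition L1_bound :: "real \<Rightarrow> real \<Rightarrow> real" where
  "L1_bound T r = (2 / r powr (1 / 3) + 2 * pi * (density_integral {0..} r - density_integral {0..T} r)
     + 4 / T * density_integral {0..T} r + sqrt (256 * exp (2 * pi * T ^ 4 * (exp 1 - 1)) / r powr (1 / 3))
     + \<bar>2 * pi * density_integral {0..T} r - a1'\<bar>) / a1'"

definition L1_limit :: "real \<Rightarrow> real" where
  "L1_limit T = (2 * pi * (limit_integral {0..} - limit_integral {0..T})
     + 4 / T * limit_integral {0..T} + \<bar>2 * pi * limit_integral {0..T} - a1'\<bar>) / a1'"

lemma L1_bound_tendsto: "(L1_bound T \<longlongrightarrow> L1_limit T) at_top"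
proof -
  have 1: "((\<lambda>r::real. 2 / r powr (1 / 3)) \<longlongrightarrow> 0) at_top" by real_asymp
  have 2: "((\<lambda>r::real. sqrt (c / r powr (1 / 3))) \<longlongrightarrow> 0) at_top" for c :: real
  proof -
    have "((\<lambda>r::real. c / r powr (1 / 3)) \<longlongrightarrow> 0) at_top" by real_asymp
    from tendsto_real_sqrt[OF this] show ?thesis by simp
  qed
  have "(L1_bound T \<longlongrightarrow> (0 + 2 * pi * (limit_integral {0..} - limit_integral {0..T})
     + 4 / T * limit_integral {0..T} + 0 + \<bar>2 * pi * limit_integral {0..T} - a1'\<bar>) / a1') at_top"
    unfolding L1_bound_def[abs_def] using a1'_pos
    by (intro tendsto_intros 1 2 density_integral_tendsto) auto
  then show ?thesis by (simp add: L1_limit_def)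
qed

lemma L1_limit_tendsto: "(L1_limit \<longlongrightarrow> 0) at_top"
proof -
  have 1: "((\<lambda>T::real. 4 / T) \<longlongrightarrow> 0) at_top" by real_asymp
  have "(L1_limit \<longlongrightarrow> (2 * pi * (limit_integral {0..} - limit_integral {0..})
     + 0 * limit_integral {0..} + \<bar>2 * pi * limit_integral {0..} - a1'\<bar>) / a1') at_top"
    unfolding L1_limit_def[abs_def] using a1'_pos
    by (intro tendsto_intros 1 limit_integral_tendsto) auto
  then show ?thesis by (simp add: limit_integral_eq)
qed

lemma (in polar_poisson_process) vertex_count_L1_bound:
  assumes r: "r \<ge> 27" and T: "T \<ge> 1" and rT: "r powr (1 / 3) \<ge> 2 * T\<^sup>2"
    and N: "\<And>\<omega>. \<omega> \<in> space M \<Longrightarrow> N \<omega> = real (card (vertices (insert (of_real r) (\<Phi> \<omega>))))"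
  shows "integrable M N" "expectation (\<lambda>\<omega>. \<bar>N \<omega> / (a1' * r powr (1 / 3)) - 1\<bar>) \<le> L1_bound T r"
proof -
  define \<rho> where "\<rho> = r powr (1 / 3)"
  \<comment> \<open>The quotient is at least 2 by \<open>rT\<close>, so rounding down costs at most
    half of it; this gives \<open>m_ge\<close> with its factor 2.\<close>
  define m where "m = nat \<lfloor>\<rho> / T\<^sup>2\<rfloor>"
  have T2: "T\<^sup>2 \<ge> 1" using T by (simp add: one_le_power)
  then have Tp: "T\<^sup>2 > 0" by linarith
  have \<rho>T: "\<rho> / T\<^sup>2 \<ge> 2" using rT Tp by (simp add: \<rho>_def pos_le_divide_eq)
  have m1: "real m \<le> \<rho> / T\<^sup>2" "\<rho> / T\<^sup>2 < real m + 1" using \<rho>T by (simp_all add: m_def)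
  have \<rho>: "\<rho> > 0" using r by (simp add: \<rho>_def)
  interpret sector_partition M r \<Phi> T m
  proof
    show "m > 0" using \<rho>T m1 by (cases m) auto
    show "real m * T\<^sup>2 \<le> r powr (1 / 3)" using m1(1) Tp by (simp add: \<rho>_def pos_le_divide_eq)
    have "\<rho> / T\<^sup>2 \<le> 2 * real m" using m1(2) \<rho>T by linarith
    then show "r powr (1 / 3) \<le> 2 * T\<^sup>2 * real m" using Tp by (simp add: \<rho>_def pos_divide_le_eq mult_ac)
  qed (use r T in auto)
  define c where "c = a1' * \<rho>"
  have c: "c > 0" using a1'_pos \<rho> by (simp add: c_def)
  have int: "integrable M vertex_count" by (rule vertex_count_L1)
  have NN: "N \<omega> = vertex_count \<omega>" if "\<omega> \<in> space M" for \<omega> using N[OF that] by (simp add: vertex_count_def)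
  show "integrable M N" using int by (rule Bochner_Integration.integrable_cong[THEN iffD2, OF refl, rotated]) (rule NN)
  define k where "k = density_integral {0..T} r"
  define C where "C = 256 * exp (2 * pi * T ^ 4 * (exp 1 - 1))"
  have k: "k \<ge> 0" unfolding k_def by (rule density_integral_nonneg) auto
  \<comment> \<open>The expected number of vertices lost in the gaps. It enters twice, in the mean
    and in its distance to \<open>c\<close>, which explains 4/T in \<open>L1_bound\<close>.\<close>
  define q where "q = 2 * (\<eta> * real m) * \<rho> * k"
  have q: "0 \<le> q" "q \<le> 2 / T * \<rho> * k"
  proof -
    show "0 \<le> q" using \<eta>_pos \<rho> k by (simp add: q_def)
    have "2 * (\<eta> * real m) \<le> 2 / T" using \<eta>_m by simp
    then show "q \<le> 2 / T * \<rho> * k" unfolding q_def using \<rho> k by (intro mult_right_mono) auto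
  qed
  have mb: "real m * block_mean = 2 * pi * \<rho> * k - q"
    using m by (simp add: block_mean_def q_def \<rho>_def k_def field_simps)
  have tm: "total_mean = 2 * pi * \<rho> * density_integral {0..} r" by (simp add: total_mean_def \<rho>_def)
  have "real m \<le> \<rho>"
  proof -
    have "\<rho> / T\<^sup>2 \<le> \<rho> / 1" using T2 \<rho> by (intro divide_left_mono) auto
    then show ?thesis using m1 by simp
  qed
  then have sq: "sqrt (real m * moment_bound) \<le> sqrt (\<rho> * C)"
    by (intro real_sqrt_le_mono) (auto simp: moment_bound_def C_def intro!: mult_right_mono)
  have "expectation (\<lambda>\<omega>. \<bar>vertex_count \<omega> - c\<bar>)
     \<le> 2 + total_mean - real m * block_mean + sqrt (real m * moment_bound) + \<bar>real m * block_mean - c\<bar>"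
    by (rule vertex_count_L1)
  also have "\<dots> \<le> 2 + 2 * pi * \<rho> * density_integral {0..} r - (2 * pi * \<rho> * k - q) + sqrt (\<rho> * C) + (\<bar>2 * pi * \<rho> * k - c\<bar> + q)"
    unfolding mb tm using sq q by (intro add_mono) auto
  also have "\<dots> \<le> 2 + 2 * pi * \<rho> * density_integral {0..} r - 2 * pi * \<rho> * k + 4 / T * \<rho> * k + sqrt (\<rho> * C) + \<bar>2 * pi * \<rho> * k - c\<bar>"
    using q by simp
  also have "\<dots> = c * L1_bound T r"
  proof -
    have s: "\<rho> * sqrt (C / \<rho>) = sqrt (\<rho> * C)"
    proof -
      have "\<rho> * sqrt (C / \<rho>) = sqrt (\<rho>\<^sup>2 * (C / \<rho>))" using \<rho> by (simp only: real_sqrt_mult real_sqrt_abs abs_of_pos)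
      also have "\<rho>\<^sup>2 * (C / \<rho>) = \<rho> * C" using \<rho> by (simp add: power2_eq_square)
      finally show ?thesis .
    qed
    have a: "\<rho> * \<bar>2 * pi * k - a1'\<bar> = \<bar>2 * pi * \<rho> * k - c\<bar>"
    proof -
      have "2 * pi * \<rho> * k - c = \<rho> * (2 * pi * k - a1')" by (simp add: c_def algebra_simps)
      then show ?thesis using \<rho> by (simp add: abs_mult)
    qed
    have "c * L1_bound T r = \<rho> * (2 / \<rho> + 2 * pi * (density_integral {0..} r - k)
       + 4 / T * k + sqrt (C / \<rho>) + \<bar>2 * pi * k - a1'\<bar>)"
      using a1'_pos by (simp add: L1_bound_def c_def \<rho>_def k_def C_def)
    also have "\<dots> = 2 + 2 * pi * \<rho> * density_integral {0..} r - 2 * pi * \<rho> * k + 4 / T * \<rho> * k + \<rho> * sqrt (C / \<rho>) + \<rho> * \<bar>2 * pi * k - a1'\<bar>"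
      using \<rho> by (simp add: algebra_simps)
    finally show ?thesis unfolding s a by simp
  qed
  finally have "expectation (\<lambda>\<omega>. \<bar>vertex_count \<omega> - c\<bar>) \<le> c * L1_bound T r" .
  moreover have "expectation (\<lambda>\<omega>. \<bar>N \<omega> / c - 1\<bar>) = expectation (\<lambda>\<omega>. \<bar>vertex_count \<omega> - c\<bar>) / c"
  proof -
    have "\<bar>x / c - 1\<bar> = \<bar>x - c\<bar> / c" for x
    proof -
      have "x / c - 1 = (x - c) / c" using c by (simp add: field_simps)
      then show ?thesis using c by simp
    qed
    then have "expectation (\<lambda>\<omega>. \<bar>N \<omega> / c - 1\<bar>) = expectation (\<lambda>\<omega>. \<bar>vertex_count \<omega> - c\<bar> / c)"
      by (intro Bochner_Integration.integral_cong refl) (simp add: NN)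
    then show ?thesis by simp
  qed
  ultimately have "expectation (\<lambda>\<omega>. \<bar>N \<omega> / c - 1\<bar>) \<le> L1_bound T r"
    using c by (simp add: pos_divide_le_eq mult.commute)
  then show "expectation (\<lambda>\<omega>. \<bar>N \<omega> / (a1' * r powr (1 / 3)) - 1\<bar>) \<le> L1_bound T r"
    by (simp add: c_def \<rho>_def)
qed

theorem theorem3:
  fixes M :: "real \<Rightarrow> 'w measure"
    and \<Phi> :: "real \<Rightarrow> 'w \<Rightarrow> complex set"
    and \<Theta> :: "real \<Rightarrow> 'w \<Rightarrow> real"
    and N :: "real \<Rightarrow> 'w \<Rightarrow> real"
  assumes "\<And>r. r > 0 \<Longrightarrow> conditioned_line_process (M r) r (\<Phi> r) (\<Theta> r)"
    and "\<And>r \<omega>. N r \<omega> = real (num_vertices (conditioned_cell r (\<Phi> r \<omega>) (\<Theta> r \<omega>)))"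
  shows "(\<forall>\<^sub>F r in at_top. integrable (M r) (N r)) \<and>
         ((\<lambda>r. (\<integral>\<omega>. N r \<omega> \<partial>M r) / (a1' * r powr (1/3))) \<longlongrightarrow> 1) at_top \<and>
         ((\<lambda>r. \<integral>\<omega>. \<bar>N r \<omega> / (a1' * r powr (1/3)) - 1\<bar> \<partial>M r) \<longlongrightarrow> 0) at_top"
proof -
  let ?L = "\<lambda>r. \<integral>\<omega>. \<bar>N r \<omega> / (a1' * r powr (1/3)) - 1\<bar> \<partial>M r"
  have ppp: "polar_poisson_process (M r) r (\<Phi> r)" if "r > 0" for r
    using assms(1)[OF that] that
    by (simp add: conditioned_line_process_def polar_poisson_process_def poisson_process_def polar_poisson_process_axioms_def)
  have bound: "integrable (M r) (N r) \<and> ?L r \<le> L1_bound T r"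
    if r: "r \<ge> 27" "T \<ge> 1" "r powr (1 / 3) \<ge> 2 * T\<^sup>2" for r T
  proof -
    interpret polar_poisson_process "M r" r "\<Phi> r" using r by (intro ppp) simp
    have "N r \<omega> = real (card (vertices (insert (of_real r) (\<Phi> r \<omega>))))" if "\<omega> \<in> space (M r)" for \<omega>
      by (simp add: assms(2) num_vertices_conditioned_cell[OF locally_finite_process[OF that]])
    from vertex_count_L1_bound[OF r this] show ?thesis by blast
  qed
  have large: "\<forall>\<^sub>F r::real in at_top. r \<ge> 27 \<and> r powr (1 / 3) \<ge> c" for c :: real
  proof (intro eventually_conj eventually_ge_at_top)
    have "filterlim (\<lambda>r::real. r powr (1 / 3)) at_top at_top" by real_asymp
    then show "\<forall>\<^sub>F r::real in at_top. r powr (1 / 3) \<ge> c" by (simp add: filterlim_at_top)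
  qed
  have int: "\<forall>\<^sub>F r in at_top. integrable (M r) (N r)"
    using large[of "2 * 1\<^sup>2"] by eventually_elim (use bound[of _ 1] in auto)
  have L: "(?L \<longlongrightarrow> 0) at_top"
  proof (rule order_tendstoI)
    fix e :: real assume "e < 0"
    moreover have "?L r \<ge> 0" for r by (rule Bochner_Integration.integral_nonneg) simp
    ultimately show "\<forall>\<^sub>F r in at_top. e < ?L r"
      by (intro always_eventually allI) (rule less_le_trans)
  next
    \<comment> \<open>The order of the limits matters: T is fixed first by the limiting bound, since
      the fluctuation term grows with T and vanishes only as r grows.\<close>
    fix e :: real assume e: "0 < e"
    have "\<forall>\<^sub>F T in at_top. L1_limit T < e \<and> T \<ge> 1"
      using order_tendstoD(2)[OF L1_limit_tendsto e] eventually_ge_at_top[of 1] by eventually_elim simp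
    then obtain T where T: "L1_limit T < e" "T \<ge> 1"
      using eventually_happens by (metis (mono_tags, lifting) trivial_limit_at_top_linorder)
    show "\<forall>\<^sub>F r in at_top. ?L r < e"
      using order_tendstoD(2)[OF L1_bound_tendsto T(1)] large[of "2 * T\<^sup>2"]
    proof eventually_elim
      case (elim r)
      then show ?case using bound[of r T] T(2) by fastforce
    qed
  qed
  \<comment> \<open>The asymptotics of the mean follows from the convergence in mean, since |E X -
    1| <= E |X - 1|.\<close>
  have "((\<lambda>r. (\<integral>\<omega>. N r \<omega> \<partial>M r) / (a1' * r powr (1/3)) - 1) \<longlongrightarrow> 0) at_top"
  proof (rule Lim_null_comparison[OF _ L])
    show "\<forall>\<^sub>F r in at_top. norm ((\<integral>\<omega>. N r \<omega> \<partial>M r) / (a1' * r powr (1/3)) - 1) \<le> ?L r"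
      using int eventually_gt_at_top[of 0]
    proof eventually_elim
      case (elim r)
      interpret polar_poisson_process "M r" r "\<Phi> r" using elim by (intro ppp)
      have "(\<integral>\<omega>. N r \<omega> \<partial>M r) / (a1' * r powr (1/3)) - 1 = (\<integral>\<omega>. N r \<omega> / (a1' * r powr (1/3)) - 1 \<partial>M r)"
        using elim by (simp add: prob_space)
      then show ?case by (simp add: integral_abs_bound)
    qed
  qed
  then have "((\<lambda>r. (\<integral>\<omega>. N r \<omega> \<partial>M r) / (a1' * r powr (1/3))) \<longlongrightarrow> 1) at_top"
    using LIM_zero_iff by (simp add: Lim_null[symmetric])
  with int L show ?thesis by blast
qed

end
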